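(* Let $n$ be a positive odd integer, and let $M=(n-1)/2$ or $M=n-1$. Then $$\sum_{k=0}^{M}[4k+1]\frac{(q;q^2)_k^2(q^2;q^4)_k^2}{(q^2;q^2)_k^2(q^4;q^4)_k^2}q^k\equiv[n]q^{(1-n)/2}\left\{1+[n]^2\frac{(n^2-1)(1-q)^2}{24}\right\}\sum_{k=0}^{(n-1)/2}\frac{(q;q^2)_k^4}{(q^4;q^4)_k^2}q^{2k}\pmod{[n]\Phi_n(q)^3}.$$
   Context: For a nonnegative integer $k$, $(x;q)_0=1$ and $(x;q)_k=(1-x)(1-xq)\cdots(1-xq^{k-1})$ for $k\ge 1$; the same notation is used with base $q$ replaced by $q^2$ or $q^4$. $[m]=(1-q^m)/(1-q)$, and $\Phi_n(q)$ is the $n$-th cyclotomic polynomial in $q$. For rational functions $A,B\in\mathbb{Q}(q)$ and a polynomial $P\in\mathbb{Q}[q]$, $A\equiv B\pmod P$ means that $A-B$, written in lowest terms, has numerator divisible by $P$. *)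

theory Defs
  imports
    Complex_Main
    "HOL-Computational_Algebra.Computational_Algebra"
    "HOL-Computational_Algebra.Field_as_Ring"
begin

text \<open>The indeterminate of $\mathbb{Q}(q)$, which is modelled as \<^typ>\<open>rat poly fract\<close>.\<close>

definition qvar :: "rat poly fract" where
  "qvar = to_fract [:0, 1:]"

text \<open>The \<open>q\<close>-shifted factorial $(x;b)_k$ with base \<open>b\<close>.\<close>

definition qpoch :: "'a::comm_ring_1 \<Rightarrow> 'a \<Rightarrow> nat \<Rightarrow> 'a" where
  "qpoch x b k = (\<Prod>i<k. 1 - x * b ^ i)"

text \<open>
  The \<open>q\<close>-integer $[m] = (1-q^m)/(1-q)$ is needed both as an element of $\mathbb{Q}(q)$ and as
  a polynomial (in the modulus of a congruence).  On a field, \<open>div\<close> is the same operation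
  as \<open>/\<close>; on polynomials the division is exact.  The lemma \<open>to_fract_qint\<close> relates the two.
\<close>

definition qint :: "'a::idom_divide \<Rightarrow> nat \<Rightarrow> 'a" where
  "qint x m = (1 - x ^ m) div (1 - x)"

lemma qint_field: "qint (x :: 'a::field) m = (1 - x ^ m) / (1 - x)"
  by (simp add: qint_def)

lemma qint_conv_sum:
  assumes "x \<noteq> 1"
  shows "qint x m = (\<Sum>i<m. x ^ i)"
  using assms by (simp add: qint_def one_diff_power_eq)

lemma qvar_neq_1: "qvar \<noteq> 1"
  unfolding qvar_def by (metis one_pCons pCons_eq_iff to_fract_1 to_fract_eq_iff zero_neq_one)

lemma to_fract_qint: "to_fract (qint [:0, 1:] m) = qint qvar m"
proof -
  have "to_fract (x ^ k) = to_fract x ^ k" for x :: "rat poly" and k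
    by (induction k) auto
  moreover have "to_fract (sum f {..<k}) = (\<Sum>i<k. to_fract (f i))"
    for f :: "nat \<Rightarrow> rat poly" and k
    by (induction k) auto
  moreover have "[:0, 1:] \<noteq> (1 :: rat poly)"
    by (simp add: one_pCons)
  ultimately show ?thesis
    using qvar_neq_1 by (simp add: qint_conv_sum qvar_def)
qed

text \<open>
  The \<open>n\<close>-th cyclotomic polynomial is the product of the linear factors belonging to the
  primitive \<open>n\<close>-th roots of unity.  The product is formed over the complex numbers;
  the rational polynomial is the unique one that is mapped to it (see \<open>of_rat_cyclotomic\<close>).
  In particular $\Phi_1(q) = q - 1$.
\<close>

definition cyclotomic_complex :: "nat \<Rightarrow> complex poly" where
  "cyclotomic_complex n =
     (\<Prod>k | k \<in> {1..n} \<and> coprime k n. [:- cis (2 * pi * real k / real n), 1:])"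

definition cyclotomic :: "nat \<Rightarrow> rat poly" where
  "cyclotomic n = (THE p. map_poly of_rat p = cyclotomic_complex n)"

text \<open>
  Congruence of rational functions modulo a polynomial: the numerator of the difference in lowest
  terms is divisible by the modulus.
\<close>

definition ratfun_cong :: "rat poly fract \<Rightarrow> rat poly fract \<Rightarrow> rat poly \<Rightarrow> bool"
    (\<open>(\<open>indent=1 notation=\<open>mixfix ratfun_cong\<close>\<close>[_ \<equiv> _] '(ratmod _'))\<close>) where
  "[A \<equiv> B] (ratmod P) \<longleftrightarrow> P dvd fst (quot_of_fract (A - B))"


subsection \<open>Well-definedness of the cyclotomic polynomials\<close>

lemma of_rat_poly_mult:
  "map_poly (of_rat :: rat \<Rightarrow> 'a::field_char_0) (p * q) = map_poly of_rat p * map_poly of_rat q"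
  by (rule poly_eqI) (simp add: coeff_map_poly coeff_mult of_rat_sum of_rat_mult)

lemma of_rat_poly_add:
  "map_poly (of_rat :: rat \<Rightarrow> 'a::field_char_0) (p + q) = map_poly of_rat p + map_poly of_rat q"
  by (rule poly_eqI) (simp add: coeff_map_poly of_rat_add)

lemma of_rat_poly_prod:
  "map_poly (of_rat :: rat \<Rightarrow> 'a::field_char_0) (prod f A) = (\<Prod>x\<in>A. map_poly of_rat (f x))"
  by (induction A rule: infinite_finite_induct)
     (auto simp: of_rat_poly_mult intro!: poly_eqI simp: coeff_map_poly coeff_1)

lemma of_rat_poly_eq_iff:
  "map_poly (of_rat :: rat \<Rightarrow> 'a::field_char_0) p = map_poly of_rat q \<longleftrightarrow> p = q"
  by (auto simp: poly_eq_iff coeff_map_poly)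

lemma degree_of_rat_poly:
  "degree (map_poly (of_rat :: rat \<Rightarrow> 'a::field_char_0) p) = degree p"
  by (rule degree_map_poly) auto

lemma prod_all_roots_unity:
  assumes "n > 0"
  shows "(\<Prod>k\<in>{1..n}. [:- cis (2 * pi * real k / real n), 1:]) = monom 1 n - (1 :: complex poly)"
proof -
  define z where "z k = cis (2 * pi * real k / real n)" for k :: nat
  have "z n = z 0"
    using assms by (simp add: z_def)
  moreover have "{1..n} = insert n {1..<n}" "{..<n} = insert 0 {1..<n}"
    using assms by auto
  ultimately have "(\<Prod>k\<in>{1..n}. [:- z k, 1:]) = (\<Prod>k<n. [:- z k, 1:])"
    by simp
  also have "\<dots> = (\<Prod>w | w ^ n = 1. [:- w, 1:])"
    unfolding z_def
    using prod.reindex_bij_betw[OF bij_betw_roots_unity[OF assms], of "\<lambda>w. [:- w, 1:]"] by simp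
  also have "\<dots> = monom 1 n - 1"
  proof -
    let ?R = "{w :: complex. w ^ n = 1}" and ?f = "monom 1 n - 1 :: complex poly"
    let ?g = "\<Prod>w\<in>?R. [:- w, 1:]"
    have fin: "finite ?R" and card: "card ?R = n"
      using assms by (auto intro: finite_roots_unity card_roots_unity_eq)
    have deg: "degree ?g = n"
      using card by (simp add: degree_prod_eq_sum_degree)
    have lc: "coeff ?g n = 1"
      using lead_coeff_prod[of "\<lambda>w. [:- w, 1:]" ?R] deg by simp
    have "degree (?g - ?f) < n"
    proof (rule degree_lessI)
      show "?g - ?f \<noteq> 0 \<or> n > 0" using assms by simp
      show "\<forall>k\<ge>n. coeff (?g - ?f) k = 0"
        using assms deg lc by (auto simp: coeff_eq_0 le_less coeff_1)
    qed
    moreover have "poly (?g - ?f) w = 0" if "w \<in> ?R" for w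
      using that fin by (auto simp: poly_prod poly_monom)
    ultimately have "?g - ?f = 0"
      using card by (intro poly_eqI_degree[of ?R]) auto
    thus ?thesis by simp
  qed
  finally show ?thesis by (simp add: z_def)
qed

lemma prod_cyclotomic_complex:
  assumes "n > 0"
  shows "(\<Prod>d | d dvd n. cyclotomic_complex d) = monom 1 n - 1"
proof -
  let ?S = "SIGMA d:{d. d dvd n}. {k. k \<in> {1..d} \<and> coprime k d}"
  let ?h = "\<lambda>(d, k). k * (n div d)"
  have fin: "finite {d. d dvd n}" using assms by simp
  have bij: "bij_betw ?h ?S {1..n}"
  proof (rule bij_betwI[where g = "\<lambda>m. (n div gcd m n, m div gcd m n)"])
    show "?h \<in> ?S \<rightarrow> {1..n}"
      using assms by (auto elim!: dvdE)
    show "(\<lambda>m. (n div gcd m n, m div gcd m n)) \<in> {1..n} \<rightarrow> ?S"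
    proof
      fix m assume m: "m \<in> {1..n}"
      have "n div gcd m n dvd n"
        by (metis dvd_div_mult_self dvd_triv_left gcd_dvd2)
      moreover have "m div gcd m n > 0"
        using m by (auto simp: div_greater_zero_iff intro!: gcd_le1_nat)
      moreover have "m div gcd m n \<le> n div gcd m n"
        using m by (simp add: div_le_mono)
      moreover have "coprime (m div gcd m n) (n div gcd m n)"
        using assms by (intro div_gcd_coprime) auto
      ultimately show "(n div gcd m n, m div gcd m n) \<in> ?S"
        by auto
    qed
  next
    fix x assume "x \<in> ?S"
    then obtain d k where x: "x = (d, k)" and d: "d dvd n" "1 \<le> k" "k \<le> d" "coprime k d"
      by auto
    from d obtain e where e: "n = d * e" by auto
    with assms have "d > 0" "e > 0" by auto
    moreover have "gcd (k * e) (d * e) = e"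
      using d by (metis coprime_imp_gcd_eq_1 gcd_mult_distrib_nat mult.commute mult.right_neutral)
    ultimately show "(\<lambda>m. (n div gcd m n, m div gcd m n)) (?h x) = x"
      by (simp add: x e)
  next
    fix m assume m: "m \<in> {1..n}"
    obtain e where "n = gcd m n * e"
      by (meson dvdE gcd_dvd2)
    hence "n div (n div gcd m n) = gcd m n"
      using assms by (metis mult_eq_0_iff nonzero_mult_div_cancel_left
          nonzero_mult_div_cancel_right not_gr0)
    thus "?h ((\<lambda>m. (n div gcd m n, m div gcd m n)) m) = m"
      by simp
  qed
  have "(\<Prod>d | d dvd n. cyclotomic_complex d) =
        (\<Prod>(d, k)\<in>?S. [:- cis (2 * pi * real k / real d), 1:])"
    unfolding cyclotomic_complex_def using fin by (subst prod.Sigma) auto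
  also have "\<dots> = (\<Prod>x\<in>?S. [:- cis (2 * pi * real (?h x) / real n), 1:])"
    using assms by (intro prod.cong) (auto elim!: dvdE simp: field_simps)
  also have "\<dots> = (\<Prod>k\<in>{1..n}. [:- cis (2 * pi * real k / real n), 1:])"
    by (rule prod.reindex_bij_betw[OF bij])
  finally show ?thesis
    using prod_all_roots_unity[OF assms] by simp
qed

lemma cyclotomic_complex_rational: "\<exists>p. map_poly of_rat p = cyclotomic_complex n"
proof (induction n rule: less_induct)
  case (less n)
  show ?case
  proof (cases "n = 0")
    case True
    have "map_poly of_rat (1 :: rat poly) = (1 :: complex poly)"
      by (rule poly_eqI) (simp add: coeff_map_poly coeff_1)
    thus ?thesis
      using True by (intro exI[of _ 1]) (simp add: cyclotomic_complex_def)
  next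
    case False
    then have n: "n > 0" by simp
    from less obtain P where P: "\<And>d. d < n \<Longrightarrow> map_poly of_rat (P d) = cyclotomic_complex d"
      by metis
    define D where "D = {d. d dvd n \<and> d < n}"
    define B where "B = (\<Prod>d\<in>D. P d)"
    define F where "F = (monom 1 n - 1 :: rat poly)"
    let ?m = "map_poly of_rat :: rat poly \<Rightarrow> complex poly"
    have D: "finite D" "{d. d dvd n} = insert n D" "n \<notin> D"
      using n by (auto simp: D_def dest: dvd_imp_le)
    have "?m B = (\<Prod>d\<in>D. cyclotomic_complex d)"
      unfolding B_def of_rat_poly_prod by (intro prod.cong) (auto simp: D_def P)
    hence "cyclotomic_complex n * ?m B = monom 1 n - 1"
      using prod_cyclotomic_complex[OF n] D by simp
    also have "\<dots> = ?m F"
      unfolding F_def by (rule poly_eqI) (simp add: coeff_map_poly coeff_1 of_rat_diff)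
    finally have eq: "cyclotomic_complex n * ?m B = ?m F" .
    have "coeff F n = 1"
      using n by (simp add: F_def coeff_1)
    hence "F \<noteq> 0" by auto
    hence B: "B \<noteq> 0"
      using eq of_rat_poly_eq_iff[of F 0, where 'a = complex] by auto
    have "?m F = ?m (F div B) * ?m B + ?m (F mod B)"
      by (metis div_mult_mod_eq of_rat_poly_add of_rat_poly_mult)
    with eq have eq': "(cyclotomic_complex n - ?m (F div B)) * ?m B = ?m (F mod B)"
      by (simp add: algebra_simps)
    have "cyclotomic_complex n - ?m (F div B) = 0"
    proof (rule ccontr)
      assume nz: "cyclotomic_complex n - ?m (F div B) \<noteq> 0"
      have "?m B \<noteq> 0"
        using B of_rat_poly_eq_iff[of B 0, where 'a = complex] by simp
      with nz have "?m (F mod B) \<noteq> 0" and "degree (?m (F mod B)) \<ge> degree (?m B)"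
        by (simp_all flip: eq' add: degree_mult_eq)
      thus False
        using degree_mod_less[OF B, of F] by (auto simp: degree_of_rat_poly)
    qed
    thus ?thesis by (intro exI[of _ "F div B"]) simp
  qed
qed

lemma of_rat_cyclotomic: "map_poly of_rat (cyclotomic n) = cyclotomic_complex n"
  unfolding cyclotomic_def
  by (rule theI') (metis cyclotomic_complex_rational of_rat_poly_eq_iff)

end

theory Submission
  imports Defs
begin

text \<open>
  Put \<open>x = q\<^sup>n\<close>, \<open>N = (n - 1) / 2\<close> and deform the summand into one with two further parameters,
  \<open>\<alpha>\<close> (even under \<open>\<alpha> \<mapsto> 1/\<alpha>\<close>) and \<open>\<beta>\<close>, which enter through separate factors.  Let
  \<open>F \<alpha> \<beta>\<close> be the deformed sum.  Watson's transformation
  turns \<open>F \<alpha> (1/x)\<close> and \<open>F x 1\<close> into multiples of a terminating \<open>4\<phi>3\<close> sum \<open>H \<alpha> \<beta>\<close>.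
  Since the summand is a product of a function of \<open>\<alpha>\<close> and a function of \<open>\<beta>\<close>, the combination
  \<open>F 1 1 - F 1 (1/x) - F x 1 + F x (1/x)\<close> is termwise divisible by \<open>(1 - x)\<^sup>2 (1 - x)\<close>, and the
  antisymmetry of the very-well-poised terms under \<open>k \<mapsto> N - k\<close> at a primitive \<open>n\<close>-th root of unity
  yields a fourth factor.  The same combination of \<open>H\<close> is divisible by \<open>(1 - x)\<^sup>3\<close>, and the prefactors
  of \<open>F 1 (1/x)\<close> and \<open>F x (1/x)\<close> differ by the factor \<open>1 + (1 - x)\<^sup>2 (n\<^sup>2 - 1) / 24\<close> up to
  \<open>(1 - x)\<^sup>3\<close>.  This is the congruence modulo \<open>\<Phi>\<^sub>n\<^sup>4\<close>.  For a proper divisor \<open>d > 1\<close> of \<open>n\<close>, the sum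
  splits at a primitive \<open>d\<close>-th root of unity into blocks of length \<open>d\<close>, each of which vanishes by the
  same antisymmetry.
\<close>


subsection \<open>Watson's transformation\<close>

text \<open>All series have base \<open>q\<^sup>2\<close> with a = q and b = c = -q, because
  (q^2;q^4)_k splits as (q;q^2)_k (-q;q^2)_k. The obstacle is that \<open>F 1 1\<close> does not
  terminate at \<open>N\<close> by itself. The parameter q/x = q^(-2N) does terminate, and it is
  present only for \<beta> = 1/x or \<alpha> = x. Evenness makes the error of the
  \<alpha>-deformation quadratic in 1 - x, that of the \<beta>-deformation is linear, so the mixed
  difference is cubic. For \<open>H\<close> three powers suffice, since Watson's prefactor
  contributes one more 1 - x. The constant 24 comes from the sum of y/(1 - y)^2 over the powers y =
  z^2, z^4, ..., z^(2N) of a primitive root z, which is -(n^2 - 1)/24. All congruences live in the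
  ring of rational functions regular at the primitive n-th roots of unity. There 1 - x and \<Phi>_n
  differ by a unit, so another power is gained by checking that a cofactor vanishes at these roots.
  For a divisor d the summation index exceeds d, where numerator and denominator of the summand
  vanish together; Gaussian binomials show that the quotient stays regular.\<close>

lemma qpoch_0 [simp]: "qpoch x q 0 = 1"
  by (simp add: qpoch_def)

lemma qpoch_Suc: "qpoch x q (Suc k) = qpoch x q k * (1 - x * q ^ k)"
  by (simp add: qpoch_def)

lemma qpoch_Suc': "qpoch x q (Suc k) = (1 - x) * qpoch (x * q) q k"
  by (simp add: qpoch_def prod.lessThan_Suc_shift mult.assoc del: prod.lessThan_Suc)

lemma qpoch_add: "qpoch x q (m + k) = qpoch x q m * qpoch (x * q ^ m) q k"
  by (induction k) (simp_all add: qpoch_Suc power_add mult_ac)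

lemma qpoch_nonzero:
  fixes x :: "'a::idom"
  assumes "\<And>i. x * q ^ i \<noteq> 1"
  shows "qpoch x q k \<noteq> 0"
  using assms by (auto simp: qpoch_def)

text \<open>
  The right-hand side of this and of the next telescoping identity is a Wilf--Zeilberger
  certificate; it vanishes at the end of the summation range when \<open>Q = q\<^sup>N\<close> or \<open>K = q\<^sup>N\<close>.
\<close>

lemma sum_6phi5_telescope:
  fixes a d e q Q :: "'a::field"
  defines "y \<equiv> a * q / (d * e)"
  assumes de: "d \<noteq> 0" "e \<noteq> 0"
    and q: "\<And>i. q * q ^ i \<noteq> 1"
    and ad: "\<And>i. a * q / d * q ^ i \<noteq> 1" and ae: "\<And>i. a * q / e * q ^ i \<noteq> 1"
    and aQ: "\<And>i. a * q * Q * q ^ i \<noteq> 1"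
  shows "(\<Sum>k\<le>m. qpoch a q k * (1 - a * q ^ (2 * k)) * qpoch d q k * qpoch e q k
            / (qpoch q q k * qpoch (a * q / d) q k * qpoch (a * q / e) q k) * y ^ k
            * ((1 - a * q * Q / d) * (1 - a * q * Q / e)
                 * ((\<Prod>i<k. q * Q - q ^ i) / qpoch (a * q * (q * Q)) q k)
               - (1 - a * q * Q) * (1 - y * Q) * ((\<Prod>i<k. Q - q ^ i) / qpoch (a * q * Q) q k)))
       = (1 - a) * y * Q * qpoch d q (Suc m) * qpoch e q (Suc m) * qpoch (a * q) q m
           / (qpoch q q m * qpoch (a * q / d) q m * qpoch (a * q / e) q m) * y ^ m
           * ((\<Prod>i<m. Q - q ^ i) / qpoch (a * q * (q * Q)) q m)" (is "sum ?t _ = ?G m")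
proof (induction m)
  case 0
  show ?case using de by (simp add: qpoch_Suc y_def field_simps)
next
  case (Suc m)
  define v where "v = q ^ m"
  have nz: "qpoch q q m \<noteq> 0" "qpoch (a * q / d) q m \<noteq> 0" "qpoch (a * q / e) q m \<noteq> 0"
     "qpoch (a * q * Q) q m \<noteq> 0"
    using q ad ae aQ by (auto intro!: qpoch_nonzero)
  have aQ': "a * q * (q * Q) * q ^ i \<noteq> 1" for i
    using aQ[of "Suc i"] by (simp add: mult_ac)
  have nz': "qpoch (a * q * (q * Q)) q m \<noteq> 0"
    using aQ' by (auto intro!: qpoch_nonzero)
  have nv: "1 - q * v \<noteq> 0" "1 - a * q / d * v \<noteq> 0" "1 - a * q / e * v \<noteq> 0"
     "1 - a * q * (q * Q) * v \<noteq> 0" "1 - a * q * Q \<noteq> 0"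
    using q[of m] ad[of m] ae[of m] aQ'[of m] aQ[of 0] by (auto simp: v_def)
  \<comment> \<open>\<open>W\<close> is the common factor of the certificate at m, the certificate
    at m + 1 and the new summand. Once it is pulled out, the induction step is a polynomial
    identity, with the inverses of d and e as extra variables.\<close>
  define W where "W = (1 - a) * qpoch (a * q) q m * qpoch d q (Suc m) * qpoch e q (Suc m) * y ^ m
      * (\<Prod>i<m. Q - q ^ i) / (qpoch q q m * qpoch (a * q / d) q m * qpoch (a * q / e) q m
      * qpoch (a * q * (q * Q)) q m * ((1 - q * v) * (1 - a * q / d * v) * (1 - a * q / e * v)
      * (1 - a * q * (q * Q) * v)))"
  have G0: "?G m = W * y * Q * ((1 - q * v) * (1 - a * q / d * v) * (1 - a * q / e * v)
      * (1 - a * q * (q * Q) * v))"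
    using nz nz' nv unfolding W_def by simp
  have G1: "?G (Suc m) = W * y * Q * ((1 - d * q * v) * (1 - e * q * v) * (1 - a * q * v) * y * (Q - v))"
    unfolding W_def by (simp add: qpoch_Suc v_def mult_ac)
  have p1: "(\<Prod>i<Suc m. q * Q - q ^ i) = (q * Q - 1) * v * (\<Prod>i<m. Q - q ^ i)"
  proof -
    have "(\<Prod>i<Suc m. q * Q - q ^ i) = (q * Q - 1) * (\<Prod>i<m. q * (Q - q ^ i))"
      by (simp add: prod.lessThan_Suc_shift algebra_simps del: prod.lessThan_Suc)
    thus ?thesis by (simp add: prod.distrib v_def)
  qed
  have p2: "qpoch (a * q * Q) q (Suc m) = (1 - a * q * Q) * qpoch (a * q * (q * Q)) q m"
    by (simp add: qpoch_Suc' mult_ac)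
  have t: "?t (Suc m) = W * y * ((1 - a * (q * v)\<^sup>2) * ((1 - a * q * Q / d) * (1 - a * q * Q / e) * ((q * Q - 1) * v)
       - (1 - y * Q) * (Q - v) * (1 - a * q * (q * Q) * v)))"
  proof -
    have 1: "(1 - a * q * Q / d) * (1 - a * q * Q / e)
                 * ((\<Prod>i<Suc m. q * Q - q ^ i) / qpoch (a * q * (q * Q)) q (Suc m))
               - (1 - a * q * Q) * (1 - y * Q) * ((\<Prod>i<Suc m. Q - q ^ i) / qpoch (a * q * Q) q (Suc m))
        = (\<Prod>i<m. Q - q ^ i) / (qpoch (a * q * (q * Q)) q m * (1 - a * q * (q * Q) * v)) *
          ((1 - a * q * Q / d) * (1 - a * q * Q / e) * ((q * Q - 1) * v)
             - (1 - y * Q) * (Q - v) * (1 - a * q * (q * Q) * v))" (is "?l = ?r")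
    proof -
      have aux: "P / (Z * E) * (A * B - C * D * E) = A * (B * P / (Z * E)) - C * (D * P / Z)"
        if "E \<noteq> 0" "Z \<noteq> 0" for P Z E A B C D :: 'a
        using that by (simp add: field_simps)
      have "?r = (1 - a * q * Q / d) * (1 - a * q * Q / e) *
            ((q * Q - 1) * v * (\<Prod>i<m. Q - q ^ i) / (qpoch (a * q * (q * Q)) q m * (1 - a * q * (q * Q) * v)))
          - (1 - y * Q) * ((Q - v) * (\<Prod>i<m. Q - q ^ i) / qpoch (a * q * (q * Q)) q m)"
        by (rule aux) (use nz' nv in auto)
      also have "\<dots> = ?l"
        unfolding p1 p2 using nv by (simp add: qpoch_Suc v_def mult_ac)
      finally show ?thesis ..
    qed
    have 2: "q ^ (2 * Suc m) = (q * v)\<^sup>2"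
      by (simp add: v_def power_mult_distrib flip: power_mult) (simp add: power2_eq_square mult_ac power_add)
    show ?thesis
      unfolding 1 2 W_def qpoch_Suc'[of a]
      by (simp add: qpoch_Suc v_def mult_ac)
  qed
  define \<delta> \<eta> where "\<delta> = inverse d" and "\<eta> = inverse e"
  have de': "d * \<delta> = 1" "e * \<eta> = 1" using de by (auto simp: \<delta>_def \<eta>_def)
  have yy: "y = a * q * \<delta> * \<eta>"
    by (simp add: y_def \<delta>_def \<eta>_def field_simps)
  have "Q * ((1 - q * v) * (1 - a * q * \<delta> * v) * (1 - a * q * \<eta> * v) * (1 - a * q * (q * Q) * v))
     + (1 - a * (q * v)\<^sup>2) * ((1 - a * q * Q * \<delta>) * (1 - a * q * Q * \<eta>) * ((q * Q - 1) * v)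
       - (1 - y * Q) * (Q - v) * (1 - a * q * (q * Q) * v))
     = Q * ((1 - d * q * v) * (1 - e * q * v) * (1 - a * q * v) * y * (Q - v))"
    using de' unfolding yy by algebra
  hence "?G m + ?t (Suc m) = ?G (Suc m)"
    unfolding G0 G1 t by (simp add: \<delta>_def \<eta>_def divide_inverse mult.assoc flip: distrib_left)
  thus ?case using Suc.IH by simp
qed

lemma saalschuetz_telescope:
  fixes a b c q K :: "'a::field"
  defines "l \<equiv> a * q / (b * c)"
  assumes bc: "b \<noteq> 0" "c \<noteq> 0" and K: "K \<noteq> 0" "q \<noteq> 0"
    and q: "\<And>i. q * q ^ i \<noteq> 1"
    and ab: "\<And>i. a * q / b * q ^ i \<noteq> 1" and ac: "\<And>i. a * q / c * q ^ i \<noteq> 1"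
  shows "(\<Sum>j\<le>m. qpoch l q j / (qpoch q q j * qpoch (a * q / b) q j * qpoch (a * q / c) q j) * q ^ j
            * ((1 - a * q * K / b) * (1 - a * q * K / c) * (qpoch (1 / (q * K)) q j * qpoch (a * (q * K)) q j)
               - l * (1 - b * K) * (1 - c * K) * (qpoch (1 / K) q j * qpoch (a * K) q j)))
       = (1 - a * q * K\<^sup>2) * qpoch l q (Suc m)
           / (qpoch q q m * qpoch (a * q / b) q m * qpoch (a * q / c) q m)
           * (qpoch (1 / K) q m * qpoch (a * (q * K)) q m)" (is "sum ?t _ = ?G m")
proof (induction m)
  case 0
  show ?case using bc by (simp add: qpoch_Suc l_def field_simps power2_eq_square)
next
  case (Suc m)
  define v where "v = q ^ m"
  have nv: "1 - q * v \<noteq> 0" "1 - a * q / b * v \<noteq> 0" "1 - a * q / c * v \<noteq> 0"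
    using q[of m] ab[of m] ac[of m] by (auto simp: v_def)
  define W where "W = qpoch l q (Suc m) * qpoch (1 / K) q m * qpoch (a * (q * K)) q m
     / (qpoch q q m * qpoch (a * q / b) q m * qpoch (a * q / c) q m
      * ((1 - q * v) * (1 - a * q / b * v) * (1 - a * q / c * v)))"
  have aux: "A * B / C * (D * E) = B * D * E / (C * U) * (A * U)" if "U \<noteq> 0" for A B C D E U :: 'a
    using that by simp
  have G0: "?G m = W * ((1 - a * q * K\<^sup>2) * ((1 - q * v) * (1 - a * q / b * v) * (1 - a * q / c * v)))"
    unfolding W_def by (rule aux) (use nv in auto)
  have G1: "?G (Suc m) = W * ((1 - a * q * K\<^sup>2) * ((1 - l * (q * v)) * (1 - 1 / K * v) * (1 - a * (q * K) * v)))"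
    unfolding W_def by (simp add: qpoch_Suc v_def mult_ac)
  have s1: "qpoch (1 / (q * K)) q (Suc m) * qpoch (a * (q * K)) q (Suc m) =
     (1 - 1 / (q * K)) * qpoch (1 / K) q m * qpoch (a * (q * K)) q m * (1 - a * (q * K) * v)"
    using K unfolding qpoch_Suc'[of "1 / (q * K)"] by (simp add: qpoch_Suc v_def mult_ac)
  have s2: "qpoch (1 / K) q (Suc m) * qpoch (a * K) q (Suc m) =
     (1 - a * K) * qpoch (1 / K) q m * qpoch (a * (q * K)) q m * (1 - 1 / K * v)"
    unfolding qpoch_Suc'[of "a * K"] by (simp add: qpoch_Suc v_def mult_ac)
  have t: "?t (Suc m) = W * (q * v * ((1 - a * q * K / b) * (1 - a * q * K / c) * ((1 - 1 / (q * K)) * (1 - a * (q * K) * v))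
       - l * (1 - b * K) * (1 - c * K) * ((1 - a * K) * (1 - 1 / K * v))))"
  proof -
    have aux: "L / Z * qq * (A1 * A2 * (u1 * p * r * w1) - l * B1 * B2 * (u2 * p * r * w2))
       = L * p * r / Z * (qq * (A1 * A2 * (u1 * w1) - l * B1 * B2 * (u2 * w2)))"
      for L Z qq A1 A2 u1 p r w1 B1 B2 u2 w2 :: 'a
      by (simp add: divide_inverse algebra_simps)
    show ?thesis
      unfolding s1 s2 aux W_def by (simp add: qpoch_Suc v_def mult_ac)
  qed
  define \<beta> \<gamma> \<kappa> \<rho> where "\<beta> = inverse b" and "\<gamma> = inverse c" and "\<kappa> = inverse K" and "\<rho> = inverse q"
  have inv: "b * \<beta> = 1" "c * \<gamma> = 1" "K * \<kappa> = 1" "q * \<rho> = 1"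
    using bc K by (auto simp: \<beta>_def \<gamma>_def \<kappa>_def \<rho>_def)
  have ll: "l = a * q * \<beta> * \<gamma>"
    by (simp add: l_def \<beta>_def \<gamma>_def field_simps)
  have "(1 - a * q * K\<^sup>2) * ((1 - q * v) * (1 - a * q * \<beta> * v) * (1 - a * q * \<gamma> * v))
     + q * v * ((1 - a * q * K * \<beta>) * (1 - a * q * K * \<gamma>) * ((1 - \<rho> * \<kappa>) * (1 - a * (q * K) * v))
       - l * (1 - b * K) * (1 - c * K) * ((1 - a * K) * (1 - \<kappa> * v)))
     = (1 - a * q * K\<^sup>2) * ((1 - l * (q * v)) * (1 - \<kappa> * v) * (1 - a * (q * K) * v))"
    using inv unfolding ll by algebra
  hence "?G m + ?t (Suc m) = ?G (Suc m)"
    unfolding G0 G1 t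
    by (simp add: \<beta>_def \<gamma>_def \<kappa>_def \<rho>_def divide_inverse mult.assoc flip: distrib_left)
  thus ?case using Suc.IH by simp
qed

text \<open>The product of the \<open>q ^ N - q ^ i\<close> is (q^(-N);q)_k q^(Nk), so this is
  Rogers' terminating 6phi5 sum with the denominator 1 - a cleared. The telescoping identity at
  \<open>Q = q ^ N\<close> is a first-order recurrence in \<open>N\<close>, which the closed form
  satisfies.\<close>

lemma sum_6phi5:
  fixes a d e q :: "'a::field"
  defines "y \<equiv> a * q / (d * e)"
  assumes de: "d \<noteq> 0" "e \<noteq> 0"
    and q: "\<And>i. q * q ^ i \<noteq> 1" and a: "\<And>i. a * q * q ^ i \<noteq> 1"
    and ad: "\<And>i. a * q / d * q ^ i \<noteq> 1" and ae: "\<And>i. a * q / e * q ^ i \<noteq> 1"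
  shows "(\<Sum>k\<le>N. qpoch a q k * (1 - a * q ^ (2 * k)) * qpoch d q k * qpoch e q k
            / (qpoch q q k * qpoch (a * q / d) q k * qpoch (a * q / e) q k) * y ^ k
            * ((\<Prod>i<k. q ^ N - q ^ i) / qpoch (a * q * q ^ N) q k))
       = (1 - a) * (qpoch (a * q) q N * qpoch y q N / (qpoch (a * q / d) q N * qpoch (a * q / e) q N))"
proof (induction N)
  case 0
  show ?case by simp
next
  case (Suc N)
  define \<phi> where "\<phi> k = qpoch a q k * (1 - a * q ^ (2 * k)) * qpoch d q k * qpoch e q k
            / (qpoch q q k * qpoch (a * q / d) q k * qpoch (a * q / e) q k) * y ^ k" for k
  define z where "z Q k = (\<Prod>i<k. Q - q ^ i) / qpoch (a * q * Q) q k" for Q k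
  define A B where "A = (1 - a * q * q ^ N / d) * (1 - a * q * q ^ N / e)"
    and "B = (1 - a * q * q ^ N) * (1 - y * q ^ N)"
  have "(\<Prod>i<Suc N. q ^ N - q ^ i) = 0" by simp
  moreover have "a * q * q ^ N * q ^ i \<noteq> 1" for i
    using a[of "N + i"] by (simp add: power_add mult_ac)
  ultimately have "(\<Sum>k\<le>Suc N. \<phi> k * (A * z (q * q ^ N) k - B * z (q ^ N) k)) = 0"
    using sum_6phi5_telescope[OF de q ad ae, of "q ^ N" "Suc N"]
    unfolding \<phi>_def z_def A_def B_def y_def by simp
  hence "A * (\<Sum>k\<le>Suc N. \<phi> k * z (q ^ Suc N) k) = B * (\<Sum>k\<le>Suc N. \<phi> k * z (q ^ N) k)"
    by (simp add: sum_subtractf sum_distrib_left algebra_simps del: sum.atMost_Suc)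
  also have "z (q ^ N) (Suc N) = 0"
    by (simp add: z_def)
  hence "(\<Sum>k\<le>Suc N. \<phi> k * z (q ^ N) k) = (\<Sum>k\<le>N. \<phi> k * z (q ^ N) k)"
    by simp
  also have "\<dots> = (1 - a) * (qpoch (a * q) q N * qpoch y q N / (qpoch (a * q / d) q N * qpoch (a * q / e) q N))"
    using Suc.IH by (simp add: \<phi>_def z_def)
  finally have eq: "A * (\<Sum>k\<le>Suc N. \<phi> k * z (q ^ Suc N) k) = B * \<dots>" .
  have A: "A \<noteq> 0"
    using ad[of N] ae[of N] by (simp add: A_def)
  have "(\<Sum>k\<le>Suc N. \<phi> k * z (q ^ Suc N) k) =
     B * ((1 - a) * (qpoch (a * q) q N * qpoch y q N / (qpoch (a * q / d) q N * qpoch (a * q / e) q N))) / A"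
    using eq A by (metis nonzero_mult_div_cancel_left)
  also have "\<dots> = (1 - a) * (qpoch (a * q) q (Suc N) * qpoch y q (Suc N)
                  / (qpoch (a * q / d) q (Suc N) * qpoch (a * q / e) q (Suc N)))"
    by (simp add: qpoch_Suc A_def B_def mult_ac)
  finally show ?case
    by (simp add: \<phi>_def z_def)
qed

text \<open>The balanced terminating 3phi2 with upper parameters l, q^(-k), a q^k. Telescoping at
  \<open>K = q ^ k\<close> gives a first-order recurrence in k.\<close>

lemma sum_saalschuetz:
  fixes a b c q :: "'a::field"
  defines "l \<equiv> a * q / (b * c)"
  assumes bc: "b \<noteq> 0" "c \<noteq> 0" and q0: "q \<noteq> 0"
    and q: "\<And>i. q * q ^ i \<noteq> 1"
    and ab: "\<And>i. a * q / b * q ^ i \<noteq> 1" and ac: "\<And>i. a * q / c * q ^ i \<noteq> 1"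
  shows "(\<Sum>j\<le>k. qpoch l q j / (qpoch q q j * qpoch (a * q / b) q j * qpoch (a * q / c) q j) * q ^ j
            * (qpoch (1 / q ^ k) q j * qpoch (a * q ^ k) q j))
       = qpoch b q k * qpoch c q k / (qpoch (a * q / b) q k * qpoch (a * q / c) q k) * l ^ k"
proof (induction k)
  case 0
  show ?case by simp
next
  case (Suc N)
  define \<phi> where "\<phi> j = qpoch l q j / (qpoch q q j * qpoch (a * q / b) q j * qpoch (a * q / c) q j) * q ^ j" for j
  define z where "z K j = qpoch (1 / K) q j * qpoch (a * K) q j" for K j
  define A B where "A = (1 - a * q * q ^ N / b) * (1 - a * q * q ^ N / c)"
    and "B = l * (1 - b * q ^ N) * (1 - c * q ^ N)"
  have 0: "qpoch (1 / q ^ N) q (Suc N) = 0"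
    using q0 by (simp add: qpoch_Suc)
  hence "(\<Sum>k\<le>Suc N. \<phi> k * (A * z (q * q ^ N) k - B * z (q ^ N) k)) = 0"
    using saalschuetz_telescope[OF bc _ q0 q ab ac, of "q ^ N" "Suc N"] q0
    unfolding \<phi>_def z_def A_def B_def l_def by simp
  hence "A * (\<Sum>k\<le>Suc N. \<phi> k * z (q ^ Suc N) k) = B * (\<Sum>k\<le>Suc N. \<phi> k * z (q ^ N) k)"
    by (simp add: sum_subtractf sum_distrib_left algebra_simps del: sum.atMost_Suc)
  also have "(\<Sum>k\<le>Suc N. \<phi> k * z (q ^ N) k) = (\<Sum>k\<le>N. \<phi> k * z (q ^ N) k)"
    using 0 by (simp add: z_def)
  also have "\<dots> = qpoch b q N * qpoch c q N / (qpoch (a * q / b) q N * qpoch (a * q / c) q N) * l ^ N"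
    using Suc.IH by (simp add: \<phi>_def z_def)
  finally have eq: "A * (\<Sum>k\<le>Suc N. \<phi> k * z (q ^ Suc N) k) = B * \<dots>" .
  have A: "A \<noteq> 0"
    using ab[of N] ac[of N] by (simp add: A_def)
  have "(\<Sum>k\<le>Suc N. \<phi> k * z (q ^ Suc N) k) =
     B * (qpoch b q N * qpoch c q N / (qpoch (a * q / b) q N * qpoch (a * q / c) q N) * l ^ N) / A"
    using eq A by (metis nonzero_mult_div_cancel_left)
  also have "\<dots> = qpoch b q (Suc N) * qpoch c q (Suc N)
                  / (qpoch (a * q / b) q (Suc N) * qpoch (a * q / c) q (Suc N)) * l ^ Suc N"
    by (simp add: qpoch_Suc A_def B_def mult_ac)
  finally show ?case
    by (simp add: \<phi>_def z_def)
qed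

text \<open>Read backwards, the product on the left has the factors 1 - 1/(x q^i), each of which is
  -1/(x q^i) times 1 - x q^i.\<close>

lemma qpoch_reverse:
  fixes x q :: "'a::field"
  assumes "x \<noteq> 0" "q \<noteq> 0"
  shows "qpoch (q / (x * q ^ j)) q j = (\<Prod>i<j. - 1 / (x * q ^ i)) * qpoch x q j"
proof -
  have "qpoch (q / (x * q ^ j)) q j = (\<Prod>i<j. 1 - q / (x * q ^ j) * q ^ (j - Suc i))"
    unfolding qpoch_def by (rule prod.nat_diff_reindex[symmetric])
  also have "\<dots> = (\<Prod>i<j. - 1 / (x * q ^ i) * (1 - x * q ^ i))"
  proof (rule prod.cong)
    fix i assume "i \<in> {..<j}"
    then obtain m where "j = Suc (i + m)" using less_imp_Suc_add by auto
    thus "1 - q / (x * q ^ j) * q ^ (j - Suc i) = - 1 / (x * q ^ i) * (1 - x * q ^ i)"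
      using assms by (simp add: field_simps power_add)
  qed simp
  finally show ?thesis
    by (simp only: qpoch_def prod.distrib)
qed

text \<open>
  Bailey's argument: the factors involving \<open>b\<close> and \<open>c\<close> are expanded by the \<open>q\<close>-Saalschuetz sum, and after
  interchanging the summations the inner sum is a shifted \<open>6\<phi>5\<close>.
\<close>

lemma watson_8phi7:
  fixes a b c d e q :: "'a::field"
  defines "l \<equiv> a * q / (b * c)" and "y \<equiv> a * q / (d * e)"
  assumes nz: "a \<noteq> 0" "b \<noteq> 0" "c \<noteq> 0" "d \<noteq> 0" "e \<noteq> 0" "q \<noteq> 0"
    and q: "\<And>i. q * q ^ i \<noteq> 1" and a: "\<And>i. a * q * q ^ i \<noteq> 1"
    and ab: "\<And>i. a * q / b * q ^ i \<noteq> 1" and ac: "\<And>i. a * q / c * q ^ i \<noteq> 1"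
    and ad: "\<And>i. a * q / d * q ^ i \<noteq> 1" and ae: "\<And>i. a * q / e * q ^ i \<noteq> 1"
    and de: "\<And>i. d * e / (a * q ^ N) * q ^ i \<noteq> 1"
  shows "(\<Sum>k\<le>N. qpoch a q k * (1 - a * q ^ (2 * k))
            * (qpoch b q k * qpoch c q k * qpoch d q k * qpoch e q k * qpoch (1 / q ^ N) q k)
            / (qpoch q q k * qpoch (a * q / b) q k * qpoch (a * q / c) q k * qpoch (a * q / d) q k
                 * qpoch (a * q / e) q k * qpoch (a * q * q ^ N) q k) * (l * y * q ^ N) ^ k)
       = (1 - a) * (qpoch (a * q) q N * qpoch y q N / (qpoch (a * q / d) q N * qpoch (a * q / e) q N))
          * (\<Sum>j\<le>N. qpoch l q j * qpoch d q j * qpoch e q j * qpoch (1 / q ^ N) q j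
               / (qpoch q q j * qpoch (a * q / b) q j * qpoch (a * q / c) q j
                    * qpoch (d * e / (a * q ^ N)) q j) * q ^ j)" (is "?lhs = ?C * ?rhs")
proof -
  define z where "z k = (\<Prod>i<k. q ^ N - q ^ i) / qpoch (a * q * q ^ N) q k" for k
  define \<phi> where "\<phi> k = qpoch a q k * (1 - a * q ^ (2 * k)) * qpoch d q k * qpoch e q k
            / (qpoch q q k * qpoch (a * q / d) q k * qpoch (a * q / e) q k) * y ^ k * z k" for k
  define \<chi> where "\<chi> j = qpoch l q j
            / (qpoch q q j * qpoch (a * q / b) q j * qpoch (a * q / c) q j) * q ^ j" for j
  define \<sigma> where "\<sigma> j k = qpoch (1 / q ^ k) q j * qpoch (a * q ^ k) q j" for j k
  have y0: "y \<noteq> 0" using nz by (simp add: y_def)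
  have prod_q: "(\<Prod>i<k. q ^ N - q ^ i) = qpoch (1 / q ^ N) q k * (q ^ N) ^ k" for k
  proof -
    have "(\<Prod>i<k. q ^ N - q ^ i) = (\<Prod>i<k. (1 - 1 / q ^ N * q ^ i) * q ^ N)"
      using nz by (intro prod.cong) (simp_all add: field_simps)
    thus ?thesis by (simp add: qpoch_def prod.distrib)
  qed
  have \<sigma>_0: "\<sigma> j k = 0" if "k < j" for j k
    using that nz by (auto simp: \<sigma>_def qpoch_def)
  have inner: "(\<Sum>k\<le>N. \<phi> k * \<sigma> j k) = ?C * (qpoch d q j * qpoch e q j * qpoch (1 / q ^ N) q j
      / qpoch (d * e / (a * q ^ N)) q j)" if j: "j \<le> N" for j
  proof -
    \<comment> \<open>Only k \<ge> j contributes. Shifting k by j replaces a, d, e, N by a q^(2j), d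
      q^j, e q^j, N - j and leaves y unchanged, so the inner sum is again a 6phi5.\<close>
    define a' d' e' where "a' = a * q ^ (2 * j)" and "d' = d * q ^ j" and "e' = e * q ^ j"
    define n where "n = N - j"
    have N: "N = j + n" using j by (simp add: n_def)
    have y': "a' * q / (d' * e') = y"
      using nz by (simp add: a'_def d'_def e'_def y_def power_add power_mult power2_eq_square field_simps)
    have ad': "a' * q / d' = a * q / d * q ^ j" and ae': "a' * q / e' = a * q / e * q ^ j"
      using nz by (simp_all add: a'_def d'_def e'_def mult_2_right power_add field_simps)
    \<comment> \<open>The sign and power (-1)^j q^(-j(j+1)/2) produced by reversing
      (q^(-k);q)_j.\<close>
    define r where "r = (\<Prod>i<j. - 1 / q ^ Suc i)"
    define D where "D = r * qpoch a q (2 * j) * qpoch d q j * qpoch e q j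
       / (qpoch (a * q / d) q j * qpoch (a * q / e) q j) * y ^ j * z j"
    have term_eq: "\<phi> (m + j) * \<sigma> j (m + j) = D *
        (qpoch a' q m * (1 - a' * q ^ (2 * m)) * qpoch d' q m * qpoch e' q m
            / (qpoch q q m * qpoch (a' * q / d') q m * qpoch (a' * q / e') q m) * y ^ m
            * ((\<Prod>i<m. q ^ n - q ^ i) / qpoch (a' * q * q ^ n) q m))" for m
    proof -
      have 1: "qpoch (1 / q ^ (m + j)) q j * qpoch q q m * (q ^ j) ^ m = r * qpoch q q (m + j)"
      proof -
        have "qpoch (1 / q ^ (m + j)) q j = qpoch (q / (q * q ^ m * q ^ j)) q j"
          using nz by (simp add: power_add)
        also have "\<dots> = (\<Prod>i<j. - 1 / (q * q ^ m * q ^ i)) * qpoch (q * q ^ m) q j"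
          by (rule qpoch_reverse) (use nz in auto)
        also have "(\<Prod>i<j. - 1 / (q * q ^ m * q ^ i)) = (\<Prod>i<j. (- 1 / q ^ Suc i) * (1 / q ^ m))"
          by (rule prod.cong) (use nz in \<open>auto simp: field_simps\<close>)
        also have "\<dots> = r * (1 / q ^ m) ^ j"
          by (simp only: prod.distrib r_def) simp
        finally show ?thesis
          unfolding qpoch_add[of q q m j]
          using nz by (simp add: power_divide field_simps flip: power_mult)
      qed
      have 2: "qpoch a q (m + j) * qpoch (a * q ^ (m + j)) q j = qpoch a q (2 * j) * qpoch a' q m"
        unfolding a'_def by (simp flip: qpoch_add add: mult_2 add_ac)
      have 3: "(\<Prod>i<m + j. q ^ N - q ^ i) = (\<Prod>i<j. q ^ N - q ^ i) * ((q ^ j) ^ m * (\<Prod>i<m. q ^ n - q ^ i))"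
      proof -
        have "(\<Prod>i<j + m. q ^ N - q ^ i) = (\<Prod>i<j. q ^ N - q ^ i) * (\<Prod>i<m. q ^ N - q ^ (j + i))"
          by (induction m) (simp_all add: mult_ac)
        also have "(\<Prod>i<m. q ^ N - q ^ (j + i)) = (\<Prod>i<m. q ^ j * (q ^ n - q ^ i))"
          by (simp add: N power_add algebra_simps)
        finally show ?thesis by (simp add: prod.distrib add.commute)
      qed
      have 4: "qpoch (a * q * q ^ N) q (m + j) = qpoch (a * q * q ^ N) q j * qpoch (a' * q * q ^ n) q m"
        unfolding add.commute[of m] qpoch_add by (simp add: N a'_def power_add mult_2_right mult_ac)
      have 5: "qpoch d q (m + j) = qpoch d q j * qpoch d' q m" "qpoch e q (m + j) = qpoch e q j * qpoch e' q m"
        "qpoch (a * q / d) q (m + j) = qpoch (a * q / d) q j * qpoch (a' * q / d') q m"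
        "qpoch (a * q / e) q (m + j) = qpoch (a * q / e) q j * qpoch (a' * q / e') q m"
        unfolding add.commute[of m] qpoch_add ad' ae' by (simp_all add: d'_def e'_def)
      have 6: "a * q ^ (2 * (m + j)) = a' * q ^ (2 * m)"
        by (simp add: a'_def power_add mult_ac distrib_left)
      have nz': "qpoch q q m \<noteq> 0" "qpoch q q (m + j) \<noteq> 0" "q ^ j \<noteq> 0"
        using q nz by (auto intro!: qpoch_nonzero)
      have "\<phi> (m + j) * \<sigma> j (m + j) =
        (qpoch (1 / q ^ (m + j)) q j * qpoch q q m * (q ^ j) ^ m) *
        (qpoch a q (m + j) * qpoch (a * q ^ (m + j)) q j) *
        (1 - a' * q ^ (2 * m)) * (qpoch d q j * qpoch d' q m) * (qpoch e q j * qpoch e' q m)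
        * y ^ (m + j) * (\<Prod>i<j. q ^ N - q ^ i) * (\<Prod>i<m. q ^ n - q ^ i)
        / (qpoch q q (m + j) * qpoch q q m * (qpoch (a * q / d) q j * qpoch (a' * q / d') q m) *
           (qpoch (a * q / e) q j * qpoch (a' * q / e') q m)
           * (qpoch (a * q * q ^ N) q j * qpoch (a' * q * q ^ n) q m))"
        unfolding \<phi>_def \<sigma>_def z_def 3 4 5 6 
        using nz' by (simp add: divide_inverse mult_ac)
      also have "\<dots> = D *
        (qpoch a' q m * (1 - a' * q ^ (2 * m)) * qpoch d' q m * qpoch e' q m
            / (qpoch q q m * qpoch (a' * q / d') q m * qpoch (a' * q / e') q m) * y ^ m
            * ((\<Prod>i<m. q ^ n - q ^ i) / qpoch (a' * q * q ^ n) q m))"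
        unfolding 1 2 D_def z_def power_add[of y]
        using nz' by (simp add: divide_inverse mult_ac)
      finally show ?thesis .
    qed
    have "(\<Sum>k\<le>N. \<phi> k * \<sigma> j k) = (\<Sum>k\<in>{j..N}. \<phi> k * \<sigma> j k)"
      by (rule sum.mono_neutral_right) (auto simp: \<sigma>_0)
    also have "\<dots> = (\<Sum>m\<le>n. \<phi> (m + j) * \<sigma> j (m + j))"
      using sum.shift_bounds_cl_nat_ivl[of "\<lambda>k. \<phi> k * \<sigma> j k" 0 j n] by (simp add: N add.commute atMost_atLeast0)
    also have "\<dots> = D * (\<Sum>m\<le>n. qpoch a' q m * (1 - a' * q ^ (2 * m)) * qpoch d' q m * qpoch e' q m
            / (qpoch q q m * qpoch (a' * q / d') q m * qpoch (a' * q / e') q m) * y ^ m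
            * ((\<Prod>i<m. q ^ n - q ^ i) / qpoch (a' * q * q ^ n) q m))"
      unfolding term_eq sum_distrib_left ..
    also have "(\<Sum>m\<le>n. qpoch a' q m * (1 - a' * q ^ (2 * m)) * qpoch d' q m * qpoch e' q m
            / (qpoch q q m * qpoch (a' * q / d') q m * qpoch (a' * q / e') q m) * y ^ m
            * ((\<Prod>i<m. q ^ n - q ^ i) / qpoch (a' * q * q ^ n) q m)) =
         (1 - a') * (qpoch (a' * q) q n * qpoch y q n / (qpoch (a' * q / d') q n * qpoch (a' * q / e') q n))"
    proof (rule sum_6phi5[where a = a' and d = d' and e = e' and q = q and N = n, unfolded y'])
      show "d' \<noteq> 0" "e' \<noteq> 0" using nz by (auto simp: d'_def e'_def)
      show "q * q ^ i \<noteq> 1" for i by (rule q)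
      show "a' * q * q ^ i \<noteq> 1" for i
        using a[of "2 * j + i"] by (simp add: a'_def power_add mult_ac)
      show "a' * q / d' * q ^ i \<noteq> 1" for i
        using ad[of "j + i"] unfolding ad' by (simp add: power_add mult_ac)
      show "a' * q / e' * q ^ i \<noteq> 1" for i
        using ae[of "j + i"] unfolding ae' by (simp add: power_add mult_ac)
    qed
    also have "D * \<dots> = ?C * (qpoch d q j * qpoch e q j * qpoch (1 / q ^ N) q j
      / qpoch (d * e / (a * q ^ N)) q j)"
    proof -
      have r': "r = (\<Prod>i<j. - 1 / q ^ (j - i))"
        unfolding r_def using prod.nat_diff_reindex[of "\<lambda>i. - 1 / q ^ Suc i" j]
        by (simp add: Suc_diff_Suc)
      have 1: "qpoch a q (2 * j) * (1 - a') * qpoch (a' * q) q n =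
          (1 - a) * (qpoch (a * q) q N * qpoch (a * q * q ^ N) q j)"
      proof -
        have "qpoch a q (2 * j) * (1 - a') * qpoch (a' * q) q n = qpoch a q (2 * j) * qpoch a' q (Suc n)"
          by (simp add: qpoch_Suc')
        also have "\<dots> = qpoch a q (Suc (N + j))"
          unfolding a'_def by (simp flip: qpoch_add add: N add_ac mult_2)
        also have "\<dots> = (1 - a) * (qpoch (a * q) q N * qpoch (a * q * q ^ N) q j)"
          unfolding qpoch_Suc' by (simp add: qpoch_add)
        finally show ?thesis .
      qed
      have 2: "qpoch (a * q / d) q N = qpoch (a * q / d) q j * qpoch (a' * q / d') q n"
          "qpoch (a * q / e) q N = qpoch (a * q / e) q j * qpoch (a' * q / e') q n"
        unfolding N qpoch_add ad' ae' by simp_all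
      \<comment> \<open>The origin of the lower parameter de/(a q^N): (y;q)_N splits into (y;q)_n
        and (y q^n;q)_j, and the second piece, reversed, is (de/(a q^N);q)_j up to the powers
        collected here.\<close>
      have 3: "r * y ^ j * qpoch y q n * (q ^ N) ^ j * qpoch (d * e / (a * q ^ N)) q j = qpoch y q N"
      proof -
        define T where "T = (\<Prod>i<j. - 1 / (y * q ^ n * q ^ i))"
        have "d * e / (a * q ^ N) = q / (y * q ^ n * q ^ j)"
          using nz by (simp add: y_def N power_add field_simps)
        hence T: "qpoch (d * e / (a * q ^ N)) q j = T * qpoch (y * q ^ n) q j"
          using qpoch_reverse[of "y * q ^ n" q j] nz y0 by (simp add: T_def)
        have "r * y ^ j * (q ^ N) ^ j * T
           = (\<Prod>i<j. (- 1 / q ^ (j - i)) * y * q ^ N * (- 1 / (y * q ^ n * q ^ i)))"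
          by (simp only: r' T_def prod.distrib prod_constant card_lessThan)
        also have "\<dots> = (\<Prod>i<j. 1)"
        proof (rule prod.cong)
          fix i assume "i \<in> {..<j}"
          hence "q ^ N = q ^ (j - i) * (q ^ n * q ^ i)"
            by (simp add: N flip: power_add)
          thus "- 1 / q ^ (j - i) * y * q ^ N * (- 1 / (y * q ^ n * q ^ i)) = 1"
            using nz y0 by simp
        qed simp
        finally have 1: "r * y ^ j * (q ^ N) ^ j * T = 1" by simp
        have "r * y ^ j * qpoch y q n * (q ^ N) ^ j * (T * qpoch (y * q ^ n) q j)
            = (r * y ^ j * (q ^ N) ^ j * T) * (qpoch y q n * qpoch (y * q ^ n) q j)"
          by (simp only: mult_ac)
        also have "\<dots> = qpoch y q N"
          unfolding 1 by (simp add: N add.commute flip: qpoch_add)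
        finally show ?thesis by (simp only: T)
      qed
      have "a * q * q ^ N * q ^ i \<noteq> 1" for i
        using a[of "N + i"] by (simp add: power_add mult_ac)
      hence nz': "qpoch (a * q * q ^ N) q j \<noteq> 0"
        by (rule qpoch_nonzero)
      have nz'': "qpoch (d * e / (a * q ^ N)) q j \<noteq> 0"
        using de by (rule qpoch_nonzero)
      have "D * ((1 - a') * (qpoch (a' * q) q n * qpoch y q n / (qpoch (a' * q / d') q n * qpoch (a' * q / e') q n)))
         = (qpoch a q (2 * j) * (1 - a') * qpoch (a' * q) q n)
          * (r * y ^ j * qpoch y q n * (q ^ N) ^ j * qpoch (d * e / (a * q ^ N)) q j)
          * qpoch d q j * qpoch e q j * qpoch (1 / q ^ N) q j
          / ((qpoch (a * q / d) q j * qpoch (a' * q / d') q n)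
             * (qpoch (a * q / e) q j * qpoch (a' * q / e') q n)
             * qpoch (a * q * q ^ N) q j * qpoch (d * e / (a * q ^ N)) q j)"
        unfolding D_def z_def prod_q using nz' nz'' by (simp add: divide_inverse mult_ac)
      also have "\<dots> = ?C * (qpoch d q j * qpoch e q j * qpoch (1 / q ^ N) q j
          / qpoch (d * e / (a * q ^ N)) q j)"
        unfolding 1 3 2[symmetric] using nz' nz'' by (simp add: divide_inverse mult_ac)
      finally show ?thesis .
    qed
    finally show ?thesis .
  qed
  have "?lhs = (\<Sum>k\<le>N. \<phi> k * (qpoch b q k * qpoch c q k
             / (qpoch (a * q / b) q k * qpoch (a * q / c) q k) * l ^ k))"
    unfolding \<phi>_def z_def prod_q
    by (intro sum.cong) (simp_all add: divide_inverse power_mult_distrib mult_ac)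
  also have "\<dots> = (\<Sum>k\<le>N. \<phi> k * (\<Sum>j\<le>k. \<chi> j * \<sigma> j k))"
    using sum_saalschuetz[OF nz(2,3,6) q ab ac] by (simp add: \<chi>_def \<sigma>_def l_def)
  also have "\<dots> = (\<Sum>k\<le>N. \<phi> k * (\<Sum>j\<le>N. \<chi> j * \<sigma> j k))"
  proof (intro sum.cong refl)
    fix k assume "k \<in> {..N}"
    hence "(\<Sum>j\<le>k. \<chi> j * \<sigma> j k) = (\<Sum>j\<le>N. \<chi> j * \<sigma> j k)"
      by (intro sum.mono_neutral_left) (auto simp: \<sigma>_0)
    thus "\<phi> k * (\<Sum>j\<le>k. \<chi> j * \<sigma> j k) = \<phi> k * (\<Sum>j\<le>N. \<chi> j * \<sigma> j k)" by simp
  qed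
  also have "\<dots> = (\<Sum>j\<le>N. \<chi> j * (\<Sum>k\<le>N. \<phi> k * \<sigma> j k))"
    unfolding sum_distrib_left by (subst sum.swap) (simp add: mult_ac)
  also have "\<dots> = (\<Sum>j\<le>N. \<chi> j * (?C * (qpoch d q j * qpoch e q j * qpoch (1 / q ^ N) q j
      / qpoch (d * e / (a * q ^ N)) q j)))"
    by (intro sum.cong refl) (simp add: inner)
  also have "\<dots> = ?C * ?rhs"
    unfolding sum_distrib_left
    by (intro sum.cong refl) (simp add: \<chi>_def divide_inverse mult_ac)
  finally show ?thesis .
qed

subsection \<open>Localization of the rational functions at the primitive roots of unity\<close>

definition rpoly :: "complex \<Rightarrow> rat poly \<Rightarrow> complex" where
  "rpoly z p = poly (map_poly of_rat p) z"

lemma rpoly_0 [simp]: "rpoly z 0 = 0"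
  and rpoly_add: "rpoly z (p + p') = rpoly z p + rpoly z p'"
  and rpoly_mult: "rpoly z (p * p') = rpoly z p * rpoly z p'"
  and rpoly_pCons: "rpoly z (pCons c p) = of_rat c + z * rpoly z p"
  by (simp_all add: rpoly_def of_rat_poly_add of_rat_poly_mult map_poly_pCons)

lemma rpoly_1 [simp]: "rpoly z 1 = 1"
  by (simp add: one_pCons rpoly_pCons)

lemma rpoly_diff: "rpoly z (p - p') = rpoly z p - rpoly z p'"
  using rpoly_add[of z "p - p'" p'] by simp

lemma rpoly_prod: "rpoly z (prod f A) = (\<Prod>x\<in>A. rpoly z (f x))"
  by (induction A rule: infinite_finite_induct) (simp_all add: rpoly_mult)

lemma rpoly_dvd_zero: "p dvd p' \<Longrightarrow> rpoly z p = 0 \<Longrightarrow> rpoly z p' = 0"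
  by (auto simp: rpoly_mult elim!: dvdE)

text \<open>For the primitive n-th roots this is the localization of the polynomial ring at
  \<Phi>_n. The witnessing fraction need not be reduced, so closure under sums and products requires
  no cancellation.\<close>

definition regular_on :: "complex set \<Rightarrow> rat poly fract \<Rightarrow> bool" where
  "regular_on Z A \<longleftrightarrow> (\<exists>a b. A = to_fract a / to_fract b \<and> (\<forall>z\<in>Z. rpoly z b \<noteq> 0))"

text \<open>Meaningful only if \<open>A\<close> is regular at \<open>z\<close>; otherwise the division by zero makes it \<open>0\<close>.\<close>

definition ev :: "complex \<Rightarrow> rat poly fract \<Rightarrow> complex" where
  "ev z A = rpoly z (fst (quot_of_fract A)) / rpoly z (snd (quot_of_fract A))"

lemma quot_of_fract_cross_mult:
  assumes "b \<noteq> 0"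
  shows "fst (quot_of_fract (to_fract a / to_fract b)) * b
       = a * snd (quot_of_fract (to_fract a / to_fract b))"
proof -
  let ?A = "to_fract a / to_fract b"
  have "to_fract (fst (quot_of_fract ?A)) / to_fract (snd (quot_of_fract ?A)) = ?A"
    by (simp flip: Fract_conv_to_fract)
  hence "to_fract (fst (quot_of_fract ?A) * b) = to_fract (a * snd (quot_of_fract ?A))"
    using assms by (simp add: field_simps)
  thus ?thesis by (simp only: to_fract_eq_iff)
qed

text \<open>The reduced denominator is coprime to the reduced numerator and hence divides b, so it
  cannot vanish where b does not. This makes evaluation independent of the fraction chosen.\<close>

lemma ev_fract:
  assumes "rpoly z b \<noteq> 0"
  shows "ev z (to_fract a / to_fract b) = rpoly z a / rpoly z b"
proof -
  let ?A = "to_fract a / to_fract b"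
  define f g where "f = fst (quot_of_fract ?A)" and "g = snd (quot_of_fract ?A)"
  have "b \<noteq> 0" using assms by auto
  hence eq: "f * b = a * g"
    unfolding f_def g_def by (rule quot_of_fract_cross_mult)
  have "g dvd f * b" by (simp add: eq)
  hence "g dvd b"
    using coprime_quot_of_fract[of ?A]
    by (metis coprime_commute coprime_dvd_mult_right_iff f_def g_def)
  hence g: "rpoly z g \<noteq> 0"
    using assms rpoly_dvd_zero by blast
  have "rpoly z f * rpoly z b = rpoly z a * rpoly z g"
    by (simp flip: rpoly_mult add: eq)
  thus ?thesis
    using assms g by (simp add: ev_def f_def g_def field_simps)
qed

context
  fixes Z :: "complex set"
begin

lemma regular_on_to_fract: "regular_on Z (to_fract a)"
  unfolding regular_on_def by (rule exI[of _ a], rule exI[of _ 1]) simp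

lemma ev_to_fract: "ev z (to_fract a) = rpoly z a"
  using ev_fract[of z 1 a] by simp

lemma regular_on_add: "regular_on Z (A + B)" (is ?th1)
  and ev_add: "z \<in> Z \<Longrightarrow> ev z (A + B) = ev z A + ev z B" (is "_ \<Longrightarrow> ?th2")
  and regular_on_mult: "regular_on Z (A * B)" (is ?th3)
  and ev_mult: "z \<in> Z \<Longrightarrow> ev z (A * B) = ev z A * ev z B" (is "_ \<Longrightarrow> ?th4")
  if AB: "regular_on Z A" "regular_on Z B"
proof -
  from AB obtain a b c d where A: "A = to_fract a / to_fract b" "\<And>z. z \<in> Z \<Longrightarrow> rpoly z b \<noteq> 0"
    and B: "B = to_fract c / to_fract d" "\<And>z. z \<in> Z \<Longrightarrow> rpoly z d \<noteq> 0"
    unfolding regular_on_def by blast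
  have s: "A + B = to_fract (a * d + c * b) / to_fract (b * d)" if "b \<noteq> 0" "d \<noteq> 0"
    using that by (simp add: A(1) B(1) field_simps)
  have m: "A * B = to_fract (a * c) / to_fract (b * d)"
    by (simp add: A(1) B(1))
  have bd: "rpoly z (b * d) \<noteq> 0" if "z \<in> Z" for z
    using A(2) B(2) that by (simp add: rpoly_mult)
  show ?th3
    unfolding regular_on_def m using bd by blast
  show ?th4 if "z \<in> Z"
  proof -
    have "ev z (A * B) = rpoly z (a * c) / rpoly z (b * d)"
      by (simp only: m ev_fract[OF bd[OF that]])
    moreover have "ev z A = rpoly z a / rpoly z b" "ev z B = rpoly z c / rpoly z d"
      unfolding A(1) B(1) by (intro ev_fract A(2) B(2) that)+
    ultimately show ?thesis by (simp add: rpoly_mult)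
  qed
  show ?th2 if "z \<in> Z"
  proof -
    have "b \<noteq> 0" "d \<noteq> 0" using A(2)[OF that] B(2)[OF that] by auto
    from s[OF this] have "ev z (A + B) = rpoly z (a * d + c * b) / rpoly z (b * d)"
      by (rule ssubst) (rule ev_fract[OF bd[OF that]])
    moreover have "ev z A = rpoly z a / rpoly z b" "ev z B = rpoly z c / rpoly z d"
      unfolding A(1) B(1) by (intro ev_fract A(2) B(2) that)+
    ultimately show ?thesis
      by (simp only: rpoly_mult rpoly_add add_frac_eq[OF A(2)[OF that] B(2)[OF that]])
  qed
  show ?th1
  proof (cases "Z = {}")
    case True
    have "A + B = to_fract (fst (quot_of_fract (A + B))) / to_fract (snd (quot_of_fract (A + B)))"
      by (simp flip: Fract_conv_to_fract)
    thus ?thesis unfolding regular_on_def using True by blast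
  next
    case False
    then obtain z where "z \<in> Z" by blast
    hence "b \<noteq> 0" "d \<noteq> 0" using A(2) B(2) by fastforce+
    from s[OF this] show ?thesis
      unfolding regular_on_def using bd by blast
  qed
qed

lemma regular_on_0: "regular_on Z 0" and regular_on_1: "regular_on Z 1"
  and regular_on_of_nat: "regular_on Z (of_nat m)"
  and regular_on_qvar: "regular_on Z qvar"
proof -
  show "regular_on Z 0" "regular_on Z 1"
    using regular_on_to_fract[of 0] regular_on_to_fract[of 1] by simp_all
  thus "regular_on Z (of_nat m)"
    by (induction m) (auto intro: regular_on_add)
qed (simp add: qvar_def regular_on_to_fract)

lemma ev_0 [simp]: "ev z 0 = 0" and ev_1 [simp]: "ev z 1 = 1" and ev_qvar [simp]: "ev z qvar = z"
  using ev_to_fract[of z 0] ev_to_fract[of z 1] ev_to_fract[of z "[:0, 1:]"]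
  by (simp_all add: qvar_def rpoly_pCons)

lemma ev_of_nat: "z \<in> Z \<Longrightarrow> ev z (of_nat m) = of_nat m"
  by (induction m) (auto simp: ev_add regular_on_of_nat regular_on_1)

lemma regular_on_minus: "regular_on Z A \<Longrightarrow> regular_on Z (- A)"
  using regular_on_mult[OF regular_on_to_fract[of "- 1"], of A] by simp

lemma ev_minus: "regular_on Z A \<Longrightarrow> z \<in> Z \<Longrightarrow> ev z (- A) = - ev z A"
  using ev_add[of A "- A" z] regular_on_minus[of A] by (simp add: eq_neg_iff_add_eq_0 add.commute)

lemma regular_on_diff: "regular_on Z A \<Longrightarrow> regular_on Z B \<Longrightarrow> regular_on Z (A - B)"
  using regular_on_add[of A "- B"] by (simp add: regular_on_minus)

lemma ev_diff: "regular_on Z A \<Longrightarrow> regular_on Z B \<Longrightarrow> z \<in> Z \<Longrightarrow> ev z (A - B) = ev z A - ev z B"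
  using ev_add[of A "- B" z] by (simp add: regular_on_minus ev_minus)

lemma regular_on_power: "regular_on Z A \<Longrightarrow> regular_on Z (A ^ k)"
  by (induction k) (auto intro: regular_on_1 regular_on_mult)

lemma ev_power: "regular_on Z A \<Longrightarrow> z \<in> Z \<Longrightarrow> ev z (A ^ k) = ev z A ^ k"
  by (induction k) (auto simp: ev_mult regular_on_power)

lemma regular_on_sum: "(\<And>x. x \<in> S \<Longrightarrow> regular_on Z (f x)) \<Longrightarrow> regular_on Z (sum f S)"
  by (induction S rule: infinite_finite_induct) (auto intro: regular_on_0 regular_on_add)

lemma ev_sum: "(\<And>x. x \<in> S \<Longrightarrow> regular_on Z (f x)) \<Longrightarrow> z \<in> Z \<Longrightarrow> ev z (sum f S) = (\<Sum>x\<in>S. ev z (f x))"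
  by (induction S rule: infinite_finite_induct) (auto simp: ev_add regular_on_sum)

lemma regular_on_prod: "(\<And>x. x \<in> S \<Longrightarrow> regular_on Z (f x)) \<Longrightarrow> regular_on Z (prod f S)"
  by (induction S rule: infinite_finite_induct) (auto intro: regular_on_1 regular_on_mult)

lemma ev_prod: "(\<And>x. x \<in> S \<Longrightarrow> regular_on Z (f x)) \<Longrightarrow> z \<in> Z \<Longrightarrow> ev z (prod f S) = (\<Prod>x\<in>S. ev z (f x))"
  by (induction S rule: infinite_finite_induct) (auto simp: ev_mult regular_on_prod)

lemma regular_on_divide: "regular_on Z (A / B)" (is ?th1)
  and ev_divide: "z \<in> Z \<Longrightarrow> ev z (A / B) = ev z A / ev z B" (is "_ \<Longrightarrow> ?th2")
  if AB: "regular_on Z A" "regular_on Z B" and nz: "\<And>z. z \<in> Z \<Longrightarrow> ev z B \<noteq> 0"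
proof -
  from AB obtain c d where B: "B = to_fract c / to_fract d" "\<And>z. z \<in> Z \<Longrightarrow> rpoly z d \<noteq> 0"
    unfolding regular_on_def by blast
  have c: "rpoly z c \<noteq> 0" if "z \<in> Z" for z
    using nz[OF that] B(2)[OF that] by (auto simp: B(1) ev_fract)
  have i: "inverse B = to_fract d / to_fract c"
    by (simp add: B(1))
  have i': "regular_on Z (inverse B)"
    unfolding i regular_on_def using c by blast
  thus ?th1
    unfolding divide_inverse by (intro regular_on_mult AB)
  show ?th2 if "z \<in> Z"
    unfolding divide_inverse ev_mult[OF AB(1) i' that]
    using that unfolding i by (simp add: B(1) ev_fract B(2) c)
qed

lemma ev_qpoch:
  assumes "regular_on Z x" "regular_on Z y" "z \<in> Z"
  shows "ev z (qpoch x y k) = qpoch (ev z x) (ev z y) k"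
  using assms
  by (simp add: qpoch_def ev_prod ev_diff ev_mult ev_power regular_on_diff regular_on_mult regular_on_power regular_on_1)

lemma regular_on_qpoch:
  assumes "regular_on Z x" "regular_on Z y"
  shows "regular_on Z (qpoch x y k)"
  using assms
  by (auto simp: qpoch_def intro!: regular_on_prod regular_on_diff regular_on_mult regular_on_power regular_on_1)

end

lemmas regular_on_intros =
  regular_on_0 regular_on_1 regular_on_of_nat regular_on_qvar regular_on_add regular_on_minus
  regular_on_diff regular_on_mult regular_on_power regular_on_sum regular_on_prod regular_on_divide
  regular_on_qpoch

section \<open>Cyclotomic polynomials and their complex roots\<close>

definition primitive_roots :: "nat \<Rightarrow> complex set" where
  "primitive_roots n = {z. rpoly z (cyclotomic n) = 0}"

lemma primitive_roots_eq:
  "primitive_roots n = (\<lambda>k. cis (2 * pi * real k / real n)) ` {k \<in> {1..n}. coprime k n}"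
  by (auto simp: primitive_roots_def rpoly_def of_rat_cyclotomic cyclotomic_complex_def poly_prod)

lemma primitive_root_power_eq_1:
  assumes "z \<in> primitive_roots n" "n > 0"
  shows "z ^ i = 1 \<longleftrightarrow> n dvd i"
proof -
  from assms obtain k where k: "z = cis (2 * pi * real k / real n)" "coprime k n" 
    by (auto simp: primitive_roots_eq)
  have zn: "z ^ n = 1"
  proof -
    have "z ^ n = cis (2 * pi * real k)"
      using assms by (simp add: k(1) DeMoivre)
    thus ?thesis by simp
  qed
  show ?thesis
  proof
    assume "n dvd i"
    thus "z ^ i = 1" using zn by (auto simp: power_mult elim!: dvdE)
  next
    assume "z ^ i = 1"
    hence "cos (real i * (2 * pi * real k / real n)) = 1"
      unfolding k(1) DeMoivre by (simp add: complex_eq_iff)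
    then obtain m :: int where "real i * (2 * pi * real k / real n) = of_int m * 2 * pi"
      by (auto simp: cos_one_2pi_int)
    hence "real_of_int (int i * int k) = real_of_int (m * int n)"
      using assms by (simp add: field_simps)
    hence "int i * int k = m * int n" by (simp only: of_int_eq_iff)
    hence "int n dvd int (i * k)" by simp
    hence "n dvd i * k" by (simp only: of_nat_dvd_iff)
    thus "n dvd i"
      using k(2) by (simp add: coprime_commute coprime_dvd_mult_left_iff)
  qed
qed

lemma inj_on_primitive_roots:
  "inj_on (\<lambda>k. cis (2 * pi * real k / real n)) {k \<in> {1..n}. coprime k n}"
proof (cases "n > 0")
  case True
  have "inj_on (\<lambda>k. cis (2 * pi * real k / real n)) {1..n}"
  proof (rule inj_onI)
    fix k l assume kl: "k \<in> {1..n}" "l \<in> {1..n}" "cis (2 * pi * real k / real n) = cis (2 * pi * real l / real n)"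
    define z where "z k = cis (2 * pi * real k / real n)" for k :: nat
    have "z n = z 0"
      using True by (simp add: z_def)
    hence *: "z k = z (k mod n)" if "k \<in> {1..n}" for k
      using that by (cases "k = n") simp_all
    have "inj_on z {..<n}"
      unfolding z_def by (rule bij_betw_imp_inj_on[OF bij_betw_roots_unity[OF True]])
    moreover have "z (k mod n) = z (l mod n)"
      using kl(3) *[OF kl(1)] *[OF kl(2)] unfolding z_def by argo
    ultimately have "k mod n = l mod n"
      using True by (auto dest: inj_onD)
    thus "k = l" using kl(1,2) by (cases "k = n"; cases "l = n"; simp)
  qed
  thus ?thesis by (rule inj_on_subset) auto
qed auto

text \<open>Division with remainder is compatible with the field extension. A nonzero remainder
  divisible by the image of p would have too large a degree.\<close>

lemma of_rat_poly_dvd: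
  assumes "map_poly (of_rat :: rat \<Rightarrow> 'a::field_char_0) p dvd map_poly of_rat p'"
  shows "p dvd p'"
proof (cases "p = 0")
  case True
  thus ?thesis using assms of_rat_poly_eq_iff[of p' 0, where 'a = 'a] by simp
next
  case False
  let ?m = "map_poly of_rat :: rat poly \<Rightarrow> 'a poly"
  have "?m (p * (p' div p) + p' mod p) = ?m p * ?m (p' div p) + ?m (p' mod p)"
    by (simp only: of_rat_poly_mult of_rat_poly_add)
  hence "?m p' = ?m p * ?m (p' div p) + ?m (p' mod p)"
    by (simp only: mult_div_mod_eq)
  with assms have "?m p dvd ?m p * ?m (p' div p) + ?m (p' mod p)"
    by (simp only:)
  hence dvd: "?m p dvd ?m (p' mod p)"
    by (rule dvd_add_right_iff[THEN iffD1, rotated]) (rule dvd_triv_left)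
  have "p' mod p = 0"
  proof (rule ccontr)
    assume nz: "p' mod p \<noteq> 0"
    hence "?m (p' mod p) \<noteq> 0"
      using of_rat_poly_eq_iff[of "p' mod p" 0, where 'a = 'a] by simp
    hence "degree (?m p) \<le> degree (?m (p' mod p))"
      using dvd by (intro dvd_imp_degree_le)
    thus False
      using degree_mod_less[OF False, of p'] nz by (simp add: degree_of_rat_poly)
  qed
  thus ?thesis by auto
qed

text \<open>Over the complex numbers \<Phi>_n is a product of distinct linear factors, so vanishing
  at every root gives divisibility there, which then descends to the rationals.\<close>

lemma cyclotomic_dvd_iff: "cyclotomic n dvd p \<longleftrightarrow> (\<forall>z\<in>primitive_roots n. rpoly z p = 0)"
proof
  assume "cyclotomic n dvd p"
  thus "\<forall>z\<in>primitive_roots n. rpoly z p = 0"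
    using rpoly_dvd_zero by (auto simp: primitive_roots_def)
next
  assume *: "\<forall>z\<in>primitive_roots n. rpoly z p = 0"
  have dvd: "(\<Prod>z\<in>S. [:- z, 1:]) dvd f" if "finite S" "\<forall>z\<in>S. poly f z = 0"
    for S :: "complex set" and f
    using that
  proof (induction S arbitrary: f rule: finite_induct)
    case (insert w S)
    then obtain g where g: "f = [:- w, 1:] * g" by (auto simp: poly_eq_0_iff_dvd elim!: dvdE)
    have "\<forall>z\<in>S. poly g z = 0"
      using insert.prems insert.hyps by (auto simp: g)
    from insert.IH[OF this] show ?case
      unfolding g prod.insert[OF insert.hyps(1,2)] by (rule mult_dvd_mono[OF dvd_refl])
  qed auto
  have "map_poly of_rat (cyclotomic n) = (\<Prod>z\<in>primitive_roots n. [:- z, 1:])"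
    unfolding of_rat_cyclotomic cyclotomic_complex_def primitive_roots_eq
    using inj_on_primitive_roots by (subst prod.reindex) auto
  also have "\<dots> dvd map_poly of_rat p"
    using * by (intro dvd) (auto simp: primitive_roots_eq rpoly_def)
  finally show "cyclotomic n dvd p"
    by (rule of_rat_poly_dvd)
qed

lemma coprime_cyclotomic:
  assumes "\<And>z. z \<in> primitive_roots n \<Longrightarrow> rpoly z p \<noteq> 0" "n > 0"
  shows "coprime (cyclotomic n) p"
proof (rule coprimeI)
  fix g assume g: "g dvd cyclotomic n" "g dvd p"
  have "cyclotomic n \<noteq> 0"
  proof
    assume "cyclotomic n = 0"
    hence "\<forall>z. z \<in> primitive_roots n" by (auto simp: primitive_roots_def)
    \<comment> \<open>The number 0 would be among the primitive roots, although its n-th power is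
      not 1.\<close>
    thus False using primitive_root_power_eq_1[of 0 n n] assms by (simp add: zero_power)
  qed
  hence "g \<noteq> 0" using g by auto
  have "degree g = 0"
  proof (rule ccontr)
    assume "degree g \<noteq> 0"
    hence "\<not> constant (poly (map_poly (of_rat :: rat \<Rightarrow> complex) g))"
      by (simp add: constant_degree degree_of_rat_poly)
    then obtain z where "rpoly z g = 0"
      unfolding rpoly_def using fundamental_theorem_of_algebra by blast
    thus False
      using assms g rpoly_dvd_zero by (auto simp: primitive_roots_def)
  qed
  thus "is_unit g"
    using \<open>g \<noteq> 0\<close> by (simp add: is_unit_iff_degree)
qed

lemma prod_cyclotomic:
  assumes "n > 0"
  shows "(\<Prod>d | d dvd n. cyclotomic d) = [:0, 1:] ^ n - 1"
proof -
  have "map_poly (of_rat :: rat \<Rightarrow> complex) ([:0, 1:] ^ n - 1) = monom 1 n - 1"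
  proof -
    have "[:0, 1:] ^ n = (monom 1 n :: rat poly)"
      by (simp add: monom_altdef)
    thus ?thesis
      by (intro poly_eqI) (simp add: coeff_map_poly coeff_1 of_rat_diff)
  qed
  hence "map_poly (of_rat :: rat \<Rightarrow> complex) (\<Prod>d | d dvd n. cyclotomic d) = map_poly of_rat ([:0, 1:] ^ n - 1)"
    using prod_cyclotomic_complex[OF assms]
    by (simp add: of_rat_poly_prod of_rat_cyclotomic)
  thus ?thesis by (simp only: of_rat_poly_eq_iff)
qed

text \<open>The cofactor is, up to sign, the product of the \<Phi>_d over proper divisors d, whose
  roots have smaller order. Locally 1 - q^n is thus \<Phi>_n times a unit and can replace it as the
  element whose powers are counted.\<close>

lemma one_minus_power_eq_cyclotomic:
  assumes "n > 0"
  obtains c where "1 - qvar ^ n = to_fract (cyclotomic n * c)"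
    and "\<And>z. z \<in> primitive_roots n \<Longrightarrow> rpoly z c \<noteq> 0"
proof
  let ?c = "- (\<Prod>d\<in>{d. d dvd n} - {n}. cyclotomic d)"
  have fp: "to_fract (p ^ k) = to_fract p ^ k" for p :: "rat poly" and k
    by (induction k) simp_all
  have "cyclotomic n * ?c = 1 - [:0, 1:] ^ n"
    using assms prod_cyclotomic[OF assms] by (simp add: prod.remove[of "{d. d dvd n}" n])
  hence "to_fract (cyclotomic n * ?c) = to_fract (1 - [:0, 1:] ^ n)"
    by (simp only:)
  thus "1 - qvar ^ n = to_fract (cyclotomic n * ?c)"
    by (simp only: to_fract_diff fp qvar_def to_fract_1)
  fix z assume z: "z \<in> primitive_roots n"
  have "rpoly z (cyclotomic d) \<noteq> 0" if "d dvd n" "d \<noteq> n" for d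
  proof
    assume "rpoly z (cyclotomic d) = 0"
    hence "z \<in> primitive_roots d" by (simp add: primitive_roots_def)
    moreover have "d > 0" using that assms by (auto intro!: Nat.gr0I)
    ultimately have "n dvd d"
      using primitive_root_power_eq_1[of z d d] primitive_root_power_eq_1[OF z assms, of d] by simp
    thus False using that by (simp add: dvd_antisym)
  qed
  thus "rpoly z ?c \<noteq> 0"
    using rpoly_diff[of z 0] assms by (auto simp: rpoly_prod)
qed

text \<open>The device by which a further power of 1 - q^n is gained: vanishing at the roots puts
  \<Phi>_n into the numerator, and the unit cofactor of 1 - q^n is absorbed by the
  denominator.\<close>

lemma regular_on_ev_eq_0:
  assumes "n > 0" and A: "regular_on (primitive_roots n) A"
    and ev: "\<And>z. z \<in> primitive_roots n \<Longrightarrow> ev z A = 0"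
  obtains B where "regular_on (primitive_roots n) B" "A = (1 - qvar ^ n) * B"
proof -
  from A obtain a b where ab: "A = to_fract a / to_fract b"
    "\<And>z. z \<in> primitive_roots n \<Longrightarrow> rpoly z b \<noteq> 0"
    by (auto simp: regular_on_def)
  have "rpoly z a = 0" if "z \<in> primitive_roots n" for z
    using ev[OF that] ab(2)[OF that] by (simp add: ab(1) ev_fract)
  then obtain a' where a': "a = cyclotomic n * a'"
    using cyclotomic_dvd_iff by (metis dvdE)
  obtain c where c: "1 - qvar ^ n = to_fract (cyclotomic n * c)"
    "\<And>z. z \<in> primitive_roots n \<Longrightarrow> rpoly z c \<noteq> 0"
    using one_minus_power_eq_cyclotomic[OF assms(1)] by blast
  show ?thesis
  proof
    show "regular_on (primitive_roots n) (to_fract a' / to_fract (b * c))"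
      unfolding regular_on_def using ab(2) c(2) by (metis mult_eq_0_iff rpoly_mult)
    \<comment> \<open>A root is needed to see that \<open>c\<close>, which vanishes at no primitive
      root, is a nonzero polynomial. The index k = 1 supplies one.\<close>
    obtain z where z: "z \<in> primitive_roots n"
    proof -
      have "cis (2 * pi * real 1 / real n) \<in> primitive_roots n"
        unfolding primitive_roots_eq using assms by (intro imageI) auto
      thus ?thesis by (rule that)
    qed
    have "c \<noteq> 0" using c(2)[OF z] by auto
    thus "A = (1 - qvar ^ n) * (to_fract a' / to_fract (b * c))"
      unfolding c(1) ab(1) a' by (simp add: field_simps)
  qed
qed

text \<open>The representation of A need not be in lowest terms. Cross multiplication puts
  \<Phi>_n^m into the reduced numerator times b, and b is coprime to \<Phi>_n.\<close>

lemma cyclotomic_power_dvd_numerator: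
  assumes "n > 0" "regular_on (primitive_roots n) B" "A = (1 - qvar ^ n) ^ m * B"
  shows "cyclotomic n ^ m dvd fst (quot_of_fract A)"
proof -
  from assms obtain a b where ab: "B = to_fract a / to_fract b"
    "\<And>z. z \<in> primitive_roots n \<Longrightarrow> rpoly z b \<noteq> 0"
    by (auto simp: regular_on_def)
  obtain c where c: "1 - qvar ^ n = to_fract (cyclotomic n * c)"
    "\<And>z. z \<in> primitive_roots n \<Longrightarrow> rpoly z c \<noteq> 0"
    using one_minus_power_eq_cyclotomic[OF assms(1)] by blast
  obtain z where z: "z \<in> primitive_roots n"
  proof -
    have "cis (2 * pi * real 1 / real n) \<in> primitive_roots n"
      unfolding primitive_roots_eq using assms by (intro imageI) auto
    thus ?thesis by (rule that)
  qed
  have b: "b \<noteq> 0" using ab(2)[OF z] by auto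
  have fp: "to_fract (p ^ k) = to_fract p ^ k" for p :: "rat poly" and k
    by (induction k) simp_all
  have A: "A = to_fract ((cyclotomic n * c) ^ m * a) / to_fract b"
    by (simp add: assms(3) c(1) ab(1) fp power_mult_distrib)
  have "cyclotomic n ^ m dvd fst (quot_of_fract A) * b"
    unfolding A quot_of_fract_cross_mult[OF b] power_mult_distrib
    by (intro dvd_mult2) simp
  moreover have "coprime (cyclotomic n ^ m) b"
    using coprime_cyclotomic[OF ab(2) assms(1)] by simp
  ultimately show ?thesis
    by (simp add: coprime_dvd_mult_left_iff)
qed

subsection \<open>Very-well-poised terms at a root of unity\<close>

text \<open>With x = q^(2N+1), reversal turns (q/x;q^2)_N into a multiple of (q^2;q^2)_N and
  (q^2/x;q^2)_N into a multiple of (q;q^2)_N; the two multipliers differ by q^N. It is used at a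
  root of unity, where x = 1, and for generic q to evaluate a Watson prefactor.\<close>

lemma qpoch_half_reflect:
  fixes q :: "'a::field"
  assumes "q \<noteq> 0"
  shows "q ^ N * (qpoch q (q\<^sup>2) N * qpoch (q / q ^ (2 * N + 1)) (q\<^sup>2) N)
       = qpoch (q\<^sup>2 / q ^ (2 * N + 1)) (q\<^sup>2) N * qpoch (q\<^sup>2) (q\<^sup>2) N"
proof -
  have 1: "qpoch (q / q ^ (2 * N + 1)) (q\<^sup>2) N = (\<Prod>i<N. - 1 / (q\<^sup>2 * (q\<^sup>2) ^ i)) * qpoch (q\<^sup>2) (q\<^sup>2) N"
    using qpoch_reverse[of "q\<^sup>2" "q\<^sup>2" N] assms by (simp add: power_mult)
  have "q\<^sup>2 / (q * (q\<^sup>2) ^ N) = q\<^sup>2 / q ^ (2 * N + 1)"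
    by (simp add: power_mult)
  hence 2: "qpoch (q\<^sup>2 / q ^ (2 * N + 1)) (q\<^sup>2) N = (\<Prod>i<N. - 1 / (q * (q\<^sup>2) ^ i)) * qpoch q (q\<^sup>2) N"
    using qpoch_reverse[of q "q\<^sup>2" N] assms by simp
  have "q ^ N * (\<Prod>i<N. - 1 / (q\<^sup>2 * (q\<^sup>2) ^ i)) = (\<Prod>i<N. q * (- 1 / (q\<^sup>2 * (q\<^sup>2) ^ i)))"
    by (simp only: prod.distrib prod_constant card_lessThan)
  also have "\<dots> = (\<Prod>i<N. - 1 / (q * (q\<^sup>2) ^ i))"
    using assms by (intro prod.cong) (simp_all add: power2_eq_square)
  finally have "q ^ N * (\<Prod>i<N. - 1 / (q\<^sup>2 * (q\<^sup>2) ^ i)) * (qpoch q (q\<^sup>2) N * qpoch (q\<^sup>2) (q\<^sup>2) N)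
     = (\<Prod>i<N. - 1 / (q * (q\<^sup>2) ^ i)) * (qpoch q (q\<^sup>2) N * qpoch (q\<^sup>2) (q\<^sup>2) N)"
    by (simp only:)
  thus ?thesis
    unfolding 1 2 by (simp only: mult_ac)
qed

text \<open>The increments between k and N - k cancel in pairs. Partial sums of an antisymmetric
  sequence are therefore symmetric under k \<mapsto> N - k.\<close>

lemma antisymmetric_sum_lessThan:
  fixes \<delta> :: "nat \<Rightarrow> 'a::field_char_0"
  assumes anti: "\<And>i. i < N \<Longrightarrow> \<delta> (N - Suc i) = - \<delta> i" and "k \<le> N"
  shows "(\<Sum>i<N - k. \<delta> i) = (\<Sum>i<k. \<delta> i)"
  using \<open>k \<le> N\<close>
proof (induction k)
  case 0
  have "(\<Sum>i<N. \<delta> i) = (\<Sum>i<N. \<delta> (N - Suc i))"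
    by (rule sum.nat_diff_reindex[symmetric])
  also have "\<dots> = - (\<Sum>i<N. \<delta> i)"
    by (simp add: anti sum_negf)
  finally show ?case by simp
next
  case (Suc k)
  have "(\<Sum>i<N - k. \<delta> i) = (\<Sum>i<N - Suc k. \<delta> i) + \<delta> (N - Suc k)"
    using Suc.prems by (simp add: Suc_diff_Suc flip: sum.lessThan_Suc)
  thus ?case
    using Suc.IH Suc.prems anti[of k] by simp
qed

lemma antisymmetric_sum_atMost:
  fixes h :: "nat \<Rightarrow> 'a::field_char_0"
  assumes "\<And>k. k \<le> N \<Longrightarrow> h (N - k) = - h k"
  shows "(\<Sum>k\<le>N. h k) = 0"
proof -
  have "(\<Sum>k\<le>N. h k) = (\<Sum>k\<le>N. h (N - k))"
    using sum.nat_diff_reindex[of h "Suc N"] by (simp add: lessThan_Suc_atMost)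
  also have "\<dots> = - (\<Sum>k\<le>N. h k)"
    by (simp add: assms sum_negf)
  finally show ?thesis by simp
qed

text \<open>For c = m and y^m = 1 the right-hand side collapses to 2 m y (1 - y). This gives the
  finite Fourier expansion of y/(1 - y)^2 at roots of unity.\<close>

lemma sum_parabola_times_power:
  fixes y c :: "'a::field_char_0"
  shows "(1 - y) ^ 3 * (\<Sum>k<m. of_nat k * (c - of_nat k) * y ^ k) =
     y ^ m * ((1 - y)\<^sup>2 * of_nat m ^ 2 + (2 * y - c * (1 - y)) * (1 - y) * of_nat m
       + y * (1 + y) - c * y * (1 - y)) - (y * (1 + y) - c * y * (1 - y))"
proof (induction m)
  case (Suc m)
  have "(1 - y) ^ 3 * (\<Sum>k<Suc m. of_nat k * (c - of_nat k) * y ^ k)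
     = (1 - y) ^ 3 * (\<Sum>k<m. of_nat k * (c - of_nat k) * y ^ k)
       + (1 - y) ^ 3 * (of_nat m * (c - of_nat m) * y ^ m)"
    by (simp add: distrib_left)
  also have "\<dots> = y ^ Suc m * ((1 - y)\<^sup>2 * of_nat (Suc m) ^ 2 + (2 * y - c * (1 - y)) * (1 - y) * of_nat (Suc m)
       + y * (1 + y) - c * y * (1 - y)) - (y * (1 + y) - c * y * (1 - y))"
  proof -
    have "Y * ((1 - y)\<^sup>2 * M ^ 2 + (2 * y - c * (1 - y)) * (1 - y) * M + y * (1 + y) - c * y * (1 - y))
         - (y * (1 + y) - c * y * (1 - y)) + (1 - y) ^ 3 * (M * (c - M) * Y)
       = y * Y * ((1 - y)\<^sup>2 * (1 + M) ^ 2 + (2 * y - c * (1 - y)) * (1 - y) * (1 + M)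
           + y * (1 + y) - c * y * (1 - y)) - (y * (1 + y) - c * y * (1 - y))" for Y M :: 'a
      by algebra
    thus ?thesis
      unfolding Suc.IH of_nat_Suc power_Suc by this
  qed
  finally show ?case .
qed simp

section \<open>Reflection at a primitive root of odd order\<close>

text \<open>The Koebe function. It enters as minus the coefficient of (1 - x)^2 in (1 - yx)(1 -
  y/x)/(1 - y)^2, and its invariance under y \<mapsto> 1/y drives the reflection argument.\<close>

definition koebe :: "'a::field \<Rightarrow> 'a" where
  "koebe y = y / (1 - y)\<^sup>2"

lemma koebe_inverse: "y \<noteq> 0 \<Longrightarrow> koebe (1 / y) = koebe y"
proof (cases "y = 1")
  case False
  assume "y \<noteq> 0"
  moreover from this have "1 - 1 / y = - (1 - y) / y" by (simp add: field_simps)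
  ultimately show ?thesis
    using False by (simp add: koebe_def power_divide power2_commute) (simp add: power2_eq_square)
qed simp

definition vwp_term :: "'a::field \<Rightarrow> nat \<Rightarrow> 'a" where
  "vwp_term q k = (qpoch q (q ^ 2) k ^ 2 * qpoch (q ^ 2) (q ^ 4) k ^ 2)
             / (qpoch (q ^ 2) (q ^ 2) k ^ 2 * qpoch (q ^ 4) (q ^ 4) k ^ 2) * q ^ k"

text \<open>The coefficient of (1 - x)^2, at a root of unity, in the factor by which the k-th
  summand changes when \<alpha> moves from 1 to x.\<close>

definition even_coeff :: "'a::field \<Rightarrow> nat \<Rightarrow> 'a" where
  "even_coeff q k = (\<Sum>i<k. koebe (q ^ (2 * i + 2)) - koebe (q ^ (2 * i + 1)))"

text \<open>Minus the coefficient of 1 - x in the factor by which the k-th summand changes when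
  \<beta> moves from 1 to 1/x; the constants 1 stem from \<beta>^k in the denominator. Despite the
  name it is also symmetric under k \<mapsto> N - k.\<close>

definition odd_coeff :: "'a::field \<Rightarrow> nat \<Rightarrow> 'a" where
  "odd_coeff q k = (\<Sum>i<k. q ^ (2 * i + 1) / (1 - q ^ (2 * i + 1)) + q ^ (2 * i + 2) / (1 - q ^ (2 * i + 2)) + 1)"

locale odd_root_of_unity =
  fixes z :: "'a::field_char_0" and N :: nat
  assumes power_eq_1_iff: "z ^ i = 1 \<longleftrightarrow> 2 * N + 1 dvd i"
begin

lemma root_power: "z ^ (2 * N + 1) = 1"
  unfolding power_eq_1_iff by simp

lemma root_nonzero [simp]: "z \<noteq> 0"
  using root_power by (intro notI) simp

lemma root_neq_1: "0 < i \<Longrightarrow> i < 2 * N + 1 \<Longrightarrow> z ^ i \<noteq> 1"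
  unfolding power_eq_1_iff by (auto dest: dvd_imp_le)

text \<open>The exponents add up to 2N + 1. So i \<mapsto> N - 1 - i exchanges odd and even
  exponents and inverts the powers.\<close>

lemma power_reflect:
  assumes "i < N"
  shows "z ^ (2 * (N - Suc i) + 1) = 1 / z ^ (2 * i + 2)"
    and "z ^ (2 * (N - Suc i) + 2) = 1 / z ^ (2 * i + 1)"
proof -
  have "z ^ (2 * (N - Suc i) + 1) * z ^ (2 * i + 2) = z ^ (2 * N + 1)"
    unfolding power_add[symmetric] using assms by (intro arg_cong[where f = "\<lambda>m. z ^ m"]) linarith
  thus "z ^ (2 * (N - Suc i) + 1) = 1 / z ^ (2 * i + 2)"
    unfolding root_power by (simp add: eq_divide_eq)
  have "z ^ (2 * (N - Suc i) + 2) * z ^ (2 * i + 1) = z ^ (2 * N + 1)"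
    unfolding power_add[symmetric] using assms by (intro arg_cong[where f = "\<lambda>m. z ^ m"]) linarith
  thus "z ^ (2 * (N - Suc i) + 2) = 1 / z ^ (2 * i + 1)"
    unfolding root_power by (simp add: eq_divide_eq)
qed

text \<open>Reflection exchanges the two Koebe values in each increment, up to inversions that do
  not change them, so the increments are antisymmetric.\<close>

lemma even_coeff_reflect: "k \<le> N \<Longrightarrow> even_coeff z (N - k) = even_coeff z k"
  unfolding even_coeff_def
  by (rule antisymmetric_sum_lessThan) (simp_all only: power_reflect koebe_inverse root_nonzero
      power_not_zero minus_diff_eq simp_thms)

text \<open>y/(1 - y) + 1/2 changes sign under y \<mapsto> 1/y. The constant 1 in each increment is
  exactly the two halves that this needs.\<close>

lemma odd_coeff_reflect: "k \<le> N \<Longrightarrow> odd_coeff z (N - k) = odd_coeff z k"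
  unfolding odd_coeff_def
proof (rule antisymmetric_sum_lessThan)
  fix i assume i: "i < N"
  have *: "1 / y / (1 - 1 / y) = - 1 - y / (1 - y)" if "y \<noteq> 0" "y \<noteq> 1" for y :: 'a
    using that by (simp add: field_simps)
  have "z ^ (2 * i + 1) \<noteq> 1" "z ^ (2 * i + 2) \<noteq> 1"
    using i by (intro root_neq_1; simp)+
  thus "z ^ (2 * (N - Suc i) + 1) / (1 - z ^ (2 * (N - Suc i) + 1)) +
         z ^ (2 * (N - Suc i) + 2) / (1 - z ^ (2 * (N - Suc i) + 2)) + 1 =
         - (z ^ (2 * i + 1) / (1 - z ^ (2 * i + 1)) + z ^ (2 * i + 2) / (1 - z ^ (2 * i + 2)) + 1)"
    unfolding power_reflect[OF i] by (subst (1 2) *) (simp_all del: power_Suc add: algebra_simps)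
qed

text \<open>The source of 24. Koebe values at z^i are 1/(2n) times the sum of k(n - k) z^(ik).
  Summing over 0 < i < n replaces each power sum with 0 < k < n by -1, and the sum of k(n - k) is
  n(n^2 - 1)/6, which gives -(n^2 - 1)/12. Even exponents contribute half of it.\<close>

lemma sum_koebe: "(\<Sum>i<N. koebe (z ^ (2 * i + 2))) = - (of_nat (2 * N + 1) ^ 2 - 1) / 24"
proof -
  define n where "n = 2 * N + 1"
  have n: "n > 0" by (simp add: n_def)
  have zn: "z ^ n = 1" unfolding n_def by (rule root_power)
  have A: "(\<Sum>i<N. koebe (z ^ (2 * i + 1)) + koebe (z ^ (2 * i + 2))) = (\<Sum>i\<in>{1..<n}. koebe (z ^ i))"
    unfolding n_def by (induction N) (simp_all add: sum.atLeastLessThan_Suc)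
  \<comment> \<open>Reflection at k = 0 says that \<open>even_coeff z N\<close> equals the empty
    sum, hence even and odd exponents contribute equally.\<close>
  have B: "(\<Sum>i<N. koebe (z ^ (2 * i + 1))) = (\<Sum>i<N. koebe (z ^ (2 * i + 2)))"
    using even_coeff_reflect[of 0] by (simp add: even_coeff_def sum_subtractf)
  have K: "koebe (z ^ i) = (\<Sum>k<n. of_nat k * (of_nat n - of_nat k) * (z ^ i) ^ k) / (2 * of_nat n)"
    if i: "i \<in> {1..<n}" for i
  proof -
    define y where "y = z ^ i"
    have "y ^ n = (z ^ n) ^ i"
      unfolding y_def by (simp add: mult.commute flip: power_mult)
    hence y: "y \<noteq> 1" "y ^ n = 1"
      using root_neq_1[of i] i zn unfolding y_def n_def by simp_all
    have "(1 - y) ^ 3 * (\<Sum>k<n. of_nat k * (of_nat n - of_nat k) * y ^ k) =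
       (1 - y) * (2 * of_nat n * y)"
      unfolding sum_parabola_times_power y(2) by algebra
    hence "(1 - y) * ((1 - y)\<^sup>2 * (\<Sum>k<n. of_nat k * (of_nat n - of_nat k) * y ^ k)) =
       (1 - y) * (2 * of_nat n * y)"
      by (simp add: power3_eq_cube power2_eq_square mult.assoc)
    hence "(1 - y)\<^sup>2 * (\<Sum>k<n. of_nat k * (of_nat n - of_nat k) * y ^ k) = 2 * of_nat n * y"
      using y(1) by simp
    thus ?thesis
      using y n by (simp add: koebe_def y_def[symmetric] field_simps)
  qed
  have S: "(\<Sum>i\<in>{1..<n}. (z ^ i) ^ k) = - 1" if k: "0 < k" "k < n" for k
  proof -
    have "(z ^ k) ^ n = (z ^ n) ^ k"
      by (simp add: mult.commute flip: power_mult)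
    hence "(1 - z ^ k) * (\<Sum>i<n. (z ^ k) ^ i) = 0"
      using zn by (simp flip: one_diff_power_eq)
    hence "(\<Sum>i<n. (z ^ k) ^ i) = 0"
      using root_neq_1[of k] k by (simp add: n_def)
    moreover have "{..<n} = insert 0 {1..<n}" using n by auto
    ultimately have "1 + (\<Sum>i\<in>{1..<n}. (z ^ k) ^ i) = 0" by simp
    moreover have "(z ^ i) ^ k = (z ^ k) ^ i" for i
      by (simp add: mult.commute flip: power_mult)
    ultimately show ?thesis
      by (simp only: add_eq_0_iff)
  qed
  have P: "6 * (\<Sum>k<m. of_nat k * (c - of_nat k)) = of_nat m * (of_nat m - 1) * (3 * c - 2 * of_nat m + 1)" for m and c :: 'a
    by (induction m) (simp_all add: algebra_simps)
  have "(\<Sum>i\<in>{1..<n}. koebe (z ^ i)) = (\<Sum>i\<in>{1..<n}. \<Sum>k<n. of_nat k * (of_nat n - of_nat k) * (z ^ i) ^ k) / (2 * of_nat n)"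
    by (simp add: K sum_divide_distrib)
  also have "(\<Sum>i\<in>{1..<n}. \<Sum>k<n. of_nat k * (of_nat n - of_nat k) * (z ^ i) ^ k)
     = (\<Sum>k<n. of_nat k * (of_nat n - of_nat k) * (\<Sum>i\<in>{1..<n}. (z ^ i) ^ k))"
    by (subst sum.swap) (simp add: sum_distrib_left)
  also have "\<dots> = (\<Sum>k<n. - (of_nat k * (of_nat n - of_nat k)))"
  proof (intro sum.cong refl)
    fix k assume "k \<in> {..<n}"
    thus "of_nat k * (of_nat n - of_nat k) * (\<Sum>i\<in>{1..<n}. (z ^ i) ^ k) = - (of_nat k * (of_nat n - of_nat k))"
      using S[of k] by (cases "k = 0") simp_all
  qed
  also have "\<dots> = - (of_nat n * (of_nat n - 1) * (of_nat n + 1)) / 6"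
  proof -
    have "6 * (\<Sum>k<n. of_nat k * (of_nat n - of_nat k)) = of_nat n * (of_nat n - 1) * (of_nat n + 1 :: 'a)"
      using P[where m = n and c = "of_nat n"] by simp
    hence "(\<Sum>k<n. of_nat k * (of_nat n - of_nat k)) = of_nat n * (of_nat n - 1) * (of_nat n + 1 :: 'a) / 6"
      by (metis nonzero_mult_div_cancel_left zero_neq_numeral)
    thus ?thesis by (simp only: sum_negf minus_divide_left)
  qed
  also have "of_nat n * (of_nat n - 1) * (of_nat n + 1 :: 'a) = of_nat n * (of_nat n ^ 2 - 1)"
    by algebra
  also have "- (of_nat n * (of_nat n ^ 2 - 1)) / 6 / (2 * of_nat n) = - (of_nat n ^ 2 - 1 :: 'a) / 12"
  proof -
    have "- (x * w) / 6 / (2 * x) = - w / 12" if "x \<noteq> 0" for x w :: 'a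
      using that by simp
    moreover have "of_nat n \<noteq> (0 :: 'a)" using n by simp
    ultimately show ?thesis by this
  qed
  finally have "(\<Sum>i\<in>{1..<n}. koebe (z ^ i)) = - (of_nat n ^ 2 - 1) / 12" .
  hence "2 * (\<Sum>i<N. koebe (z ^ (2 * i + 2))) = - (of_nat n ^ 2 - 1) / 12"
    using A B by (simp add: sum.distrib)
  thus ?thesis
    unfolding n_def by (simp add: field_simps)
qed

text \<open>Since the order is odd, squaring preserves it. Facts about base z^2 thereby carry over
  to base z^4.\<close>

lemma square_root_of_unity: "odd_root_of_unity (z\<^sup>2) N"
proof
  fix i
  have "coprime (2 * N + 1) 2" by simp
  thus "(z\<^sup>2) ^ i = 1 \<longleftrightarrow> 2 * N + 1 dvd i"
    unfolding power_mult[symmetric] power_eq_1_iff by (rule coprime_dvd_mult_right_iff)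
qed

lemma qpoch_half_square: "z ^ N * qpoch z (z\<^sup>2) N ^ 2 = qpoch (z\<^sup>2) (z\<^sup>2) N ^ 2"
  using qpoch_half_reflect[OF root_nonzero, of N] unfolding root_power by (simp add: power2_eq_square)

lemma qpoch_even_nonzero: "k \<le> 2 * N \<Longrightarrow> qpoch (z\<^sup>2) (z\<^sup>2) k \<noteq> 0"
proof -
  assume "k \<le> 2 * N"
  hence "z\<^sup>2 * (z\<^sup>2) ^ i \<noteq> 1" if "i < k" for i
    using that odd_root_of_unity.root_neq_1[OF square_root_of_unity, of "Suc i"] by simp
  thus ?thesis by (auto simp: qpoch_def)
qed

text \<open>Induction through the term ratio \<rho>: reflection replaces its arguments y, y' by
  1/y', 1/y, and the ratio and its reflected counterpart multiply to z^(-4). Each step therefore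
  costs z^4.\<close>

lemma vwp_term_reflect: "k \<le> N \<Longrightarrow> vwp_term z (N - k) = z * z ^ (4 * k) * vwp_term z k"
proof (induction k)
  case 0
  interpret sq: odd_root_of_unity "z\<^sup>2" N by (rule square_root_of_unity)
  have z4: "z ^ 4 = (z\<^sup>2)\<^sup>2" by (simp flip: power_mult)
  have "z ^ (2 * N + 1) = 1" by (rule root_power)
  \<comment> \<open>The extra powers are those that \<open>qpoch_half_square\<close> needs for z and
    for z^2; all shifted factorials then cancel.\<close>
  have "vwp_term z N * (z ^ N * (z\<^sup>2) ^ N) = z ^ N * ((z ^ N * qpoch z (z\<^sup>2) N ^ 2) * ((z\<^sup>2) ^ N * qpoch (z\<^sup>2) ((z\<^sup>2)\<^sup>2) N ^ 2))
          / (qpoch (z\<^sup>2) (z\<^sup>2) N ^ 2 * qpoch ((z\<^sup>2)\<^sup>2) ((z\<^sup>2)\<^sup>2) N ^ 2)"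
    unfolding vwp_term_def z4 by (simp only: mult_ac times_divide_eq_left times_divide_eq_right)
  also have "\<dots> = z ^ N"
    unfolding qpoch_half_square sq.qpoch_half_square
    using qpoch_even_nonzero[of N] sq.qpoch_even_nonzero[of N] by simp
  finally have "vwp_term z N * (z\<^sup>2) ^ N = 1" by simp
  hence "vwp_term z N = 1 / (z\<^sup>2) ^ N" by (simp add: eq_divide_eq)
  also have "\<dots> = z"
    using root_power by (simp add: power_mult divide_eq_eq)
  finally show ?case by (simp add: vwp_term_def)
next
  case (Suc k)
  define y y' where "y = z ^ (2 * k + 1)" and "y' = z ^ (2 * k + 2)"
  have yy: "y \<noteq> 0" "y' \<noteq> 0" "y' = z * y" by (simp_all add: y_def y'_def)
  have y1: "y \<noteq> 1" "y' \<noteq> 1"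
    using Suc.prems unfolding y_def y'_def by (intro root_neq_1; simp)+
  have y2: "y\<^sup>2 \<noteq> 1" "y'\<^sup>2 \<noteq> 1"
    using Suc.prems odd_root_of_unity.root_neq_1[OF square_root_of_unity, of "2 * k + 1"]
       odd_root_of_unity.root_neq_1[OF square_root_of_unity, of "2 * k + 2"]
    unfolding y_def y'_def by (simp_all add: power_mult[symmetric] mult.commute del: power_Suc)
  define \<rho> where "\<rho> u v = (1 - u)\<^sup>2 * (1 - u\<^sup>2)\<^sup>2 / ((1 - v)\<^sup>2 * (1 - v\<^sup>2)\<^sup>2) * z" for u v
  have step: "vwp_term z (Suc j) = vwp_term z j * \<rho> (z ^ (2 * j + 1)) (z ^ (2 * j + 2))" for j
  proof -
    have e: "4 * j = (2 * j) * 2" by simp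
    have "z * (z\<^sup>2) ^ j = z ^ (2 * j + 1)" "z\<^sup>2 * (z\<^sup>2) ^ j = z ^ (2 * j + 2)"
      by (simp_all only: power_mult power_add power_one_right mult.commute[of _ "(z\<^sup>2) ^ j"])
    moreover have "z\<^sup>2 * (z ^ 4) ^ j = (z ^ (2 * j + 1))\<^sup>2" "z ^ 4 * (z ^ 4) ^ j = (z ^ (2 * j + 2))\<^sup>2"
      unfolding power_mult[symmetric] e power_add[symmetric]
      by (rule arg_cong[where f = "\<lambda>m. z ^ m"], simp)+
    ultimately show ?thesis
      by (simp add: vwp_term_def \<rho>_def qpoch_Suc power_mult_distrib del: power_Suc) (simp add: mult_ac)
  qed
  have k: "k < N" using Suc.prems by simp
  have "vwp_term z (N - k) = vwp_term z (Suc (N - Suc k))"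
    using k by (simp add: Suc_diff_Suc)
  also have "\<dots> = vwp_term z (N - Suc k) * \<rho> (1 / y') (1 / y)"
    unfolding step power_reflect[OF k] y_def y'_def ..
  finally have 1: "vwp_term z (N - Suc k) * \<rho> (1 / y') (1 / y) = z * z ^ (4 * k) * vwp_term z k"
    using Suc.IH k by simp
  have inv: "(1 - 1 / u)\<^sup>2 = (1 - u)\<^sup>2 / u\<^sup>2" if "u \<noteq> 0" for u :: 'a
  proof -
    have "1 - 1 / u = - ((1 - u) / u)" using that by (simp add: field_simps)
    thus ?thesis by (simp only: power2_minus power_divide)
  qed
  have inv2: "(1 - (1 / u)\<^sup>2)\<^sup>2 = (1 - u\<^sup>2)\<^sup>2 / u ^ 4" if "u \<noteq> 0" for u :: 'a
    using inv[of "u\<^sup>2"] that by (simp add: power_divide flip: power_mult)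
  \<comment> \<open>Inversion leaves y^6/y'^6 times z^2, and y' = z y makes this z^(-4).\<close>
  have "\<rho> (1 / y') (1 / y) * \<rho> y y' * z ^ 4 = 1"
  proof -
    have "\<rho> (1 / y') (1 / y) * \<rho> y y' = y ^ 6 / y' ^ 6 * z\<^sup>2"
    proof -
      have "U' / v\<^sup>2 * (V' / v ^ 4) / (U / u\<^sup>2 * (V / u ^ 4)) * z * (U * V / (U' * V') * z) = u ^ 6 / v ^ 6 * z\<^sup>2"
        if "U \<noteq> 0" "V \<noteq> 0" "U' \<noteq> 0" "V' \<noteq> 0" "u \<noteq> 0" "v \<noteq> 0" for u v U V U' V' :: 'a
        using that by (simp add: divide_simps) (simp add: power2_eq_square eval_nat_numeral mult_ac)
      thus ?thesis
        unfolding \<rho>_def inv[OF yy(1)] inv[OF yy(2)] inv2[OF yy(1)] inv2[OF yy(2)]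
        using yy(1,2) y1 y2 by simp
    qed
    hence "\<rho> (1 / y') (1 / y) * \<rho> y y' * z ^ 4 = y ^ 6 / y' ^ 6 * (z\<^sup>2 * z ^ 4)"
      by (simp only: mult.assoc)
    also have "z\<^sup>2 * z ^ 4 = z ^ 6"
      by (simp flip: power_add)
    finally show ?thesis
      using yy(1) by (simp add: yy(3) power_mult_distrib)
  qed
  hence "vwp_term z (N - Suc k) = vwp_term z (N - Suc k) * \<rho> (1 / y') (1 / y) * \<rho> y y' * z ^ 4"
    by (simp add: mult.assoc)
  also have "\<dots> = z * z ^ (4 * Suc k) * vwp_term z (Suc k)"
    unfolding 1 step y_def[symmetric] y'_def[symmetric] by (simp add: power_add mult_ac)
  finally show ?case .
qed

text \<open>The reflected factor is 1 - z^(-(4k+1)); the power z^(4k+1) from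
  \<open>vwp_term_reflect\<close> turns it into -(1 - z^(4k+1)).\<close>

lemma vwp_summand_reflect:
  assumes "k \<le> N"
  shows "(1 - z ^ (4 * (N - k) + 1)) * vwp_term z (N - k) = - ((1 - z ^ (4 * k + 1)) * vwp_term z k)"
proof -
  have "z ^ (4 * (N - k) + 1) * z ^ (4 * k + 1) = (z ^ (2 * N + 1)) ^ 2"
    unfolding power_add[symmetric] power_mult[symmetric] using assms
    by (intro arg_cong[where f = "\<lambda>m. z ^ m"]) (auto simp: le_iff_add)
  hence "z ^ (4 * (N - k) + 1) = 1 / z ^ (4 * k + 1)"
    unfolding root_power by (simp add: eq_divide_eq)
  thus ?thesis
    unfolding vwp_term_reflect[OF assms] by (simp add: field_simps)
qed

lemma sum_vwp_summand: "(\<Sum>k\<le>N. (1 - z ^ (4 * k + 1)) * vwp_term z k) = 0"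
  by (rule antisymmetric_sum_atMost) (rule vwp_summand_reflect)

text \<open>Both coefficients are symmetric, so the antisymmetry of the summand survives. This is
  what yields the fourth power of 1 - x.\<close>

lemma sum_vwp_summand_coeffs:
  "(\<Sum>k\<le>N. (1 - z ^ (4 * k + 1)) * vwp_term z k * (even_coeff z k * odd_coeff z k)) = 0"
  by (rule antisymmetric_sum_atMost)
     (simp only: vwp_summand_reflect even_coeff_reflect odd_coeff_reflect mult_minus_left)

text \<open>The factor i = N of (z;z^2)_k is 1 - z^(2N+1). For k > 2N the denominator vanishes too,
  and the value 0 then rests on the convention for division by zero.\<close>

lemma vwp_term_eq_0:
  assumes "N < k" shows "vwp_term z k = 0"
proof -
  have "z * (z\<^sup>2) ^ N = 1"
    using root_power by (simp add: power_mult)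
  hence "qpoch z (z\<^sup>2) k = 0"
    using assms by (auto simp: qpoch_def)
  thus ?thesis by (simp add: vwp_term_def)
qed

end

subsection \<open>The deformed sums\<close>

lemma qpoch_square:
  fixes x b :: "'a::comm_ring_1"
  shows "qpoch (x\<^sup>2) (b\<^sup>2) k = qpoch x b k * qpoch (- x) b k"
proof -
  have "1 - x\<^sup>2 * (b\<^sup>2) ^ i = (1 - x * b ^ i) * (1 + x * b ^ i)" for i
    by (simp add: algebra_simps power2_eq_square power_mult_distrib)
  thus ?thesis by (simp add: qpoch_def prod.distrib)
qed

definition even_factor :: "'a::field \<Rightarrow> 'a \<Rightarrow> nat \<Rightarrow> 'a" where
  "even_factor q \<alpha> k = qpoch (\<alpha> * q) (q\<^sup>2) k * qpoch (q / \<alpha>) (q\<^sup>2) k"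

text \<open>The Watson 8phi7 summand in base \<open>q\<^sup>2\<close> with a = q, b = c = -q, d =
  \<alpha> q, e = q/\<alpha> and sixth parameter \<beta> q, divided by 1 - q. The power \<beta>^k
  keeps the argument q/\<beta> that Watson's formula prescribes.\<close>

definition deformed_summand :: "'a::field \<Rightarrow> 'a \<Rightarrow> 'a \<Rightarrow> nat \<Rightarrow> 'a" where
  "deformed_summand q \<alpha> \<beta> k = (1 - q ^ (4 * k + 1)) / (1 - q)
     * (qpoch q (q\<^sup>2) k * qpoch (- q) (q\<^sup>2) k ^ 2 / (qpoch (q\<^sup>2) (q\<^sup>2) k * qpoch (- (q\<^sup>2)) (q\<^sup>2) k ^ 2) * q ^ k)
     * (even_factor q \<alpha> k / (qpoch (q\<^sup>2 / \<alpha>) (q\<^sup>2) k * qpoch (\<alpha> * q\<^sup>2) (q\<^sup>2) k))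
     * (qpoch (\<beta> * q) (q\<^sup>2) k / (qpoch (q\<^sup>2 / \<beta>) (q\<^sup>2) k * \<beta> ^ k))"

text \<open>One formula that fits both uses of Watson's transformation: the lower parameter de/(a
  q^(2N)) is q^2/x for \<beta> = 1/x and q^2 for \<alpha> = x, \<beta> = 1, that is, \<beta> q^2
  each time.\<close>

definition deformed_4phi3_term :: "'a::field \<Rightarrow> 'a \<Rightarrow> 'a \<Rightarrow> nat \<Rightarrow> 'a" where
  "deformed_4phi3_term q \<alpha> \<beta> j =
     qpoch q (q\<^sup>2) j / (qpoch (q\<^sup>2) (q\<^sup>2) j * qpoch (- (q\<^sup>2)) (q\<^sup>2) j ^ 2) * (q\<^sup>2) ^ j
     * even_factor q \<alpha> j * (qpoch (\<beta> * q) (q\<^sup>2) j / qpoch (\<beta> * q\<^sup>2) (q\<^sup>2) j)"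

context
  fixes q x :: "'a::field" and N :: nat
  assumes q0: "q \<noteq> 0" and q1: "\<And>i. 0 < i \<Longrightarrow> q ^ i \<noteq> 1" and x: "x = q ^ (2 * N + 1)"
begin

text \<open>The nonvanishing conditions of Watson's transformation for these parameters. The ones
  that are not directly of the form q^m \<noteq> 1 with m > 0 follow by squaring, or because 2 + 2i
  and 2N + 1 differ in parity.\<close>

lemma generic_facts:
  shows "q\<^sup>2 * (q\<^sup>2) ^ i \<noteq> 1" "q * q\<^sup>2 * (q\<^sup>2) ^ i \<noteq> 1" "q * (q\<^sup>2) ^ i \<noteq> 1"
    and "q * q\<^sup>2 / (- q) * (q\<^sup>2) ^ i \<noteq> 1"
    and "q\<^sup>2 / x * (q\<^sup>2) ^ i \<noteq> 1" "x * q\<^sup>2 * (q\<^sup>2) ^ i \<noteq> 1"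
proof -
  have "q\<^sup>2 * (q\<^sup>2) ^ i = q ^ (2 + 2 * i)" "q * q\<^sup>2 * (q\<^sup>2) ^ i = q ^ (3 + 2 * i)" "q * (q\<^sup>2) ^ i = q ^ (1 + 2 * i)"
    "x * q\<^sup>2 * (q\<^sup>2) ^ i = q ^ (2 * N + 1 + 2 + 2 * i)"
    by (simp_all only: power_add power_mult x power_one_right) (simp add: power3_eq_cube power2_eq_square mult_ac)
  note p = this
  show "q\<^sup>2 * (q\<^sup>2) ^ i \<noteq> 1" unfolding p(1) by (rule q1) simp
  show "q * q\<^sup>2 * (q\<^sup>2) ^ i \<noteq> 1" unfolding p(2) by (rule q1) simp
  show "q * (q\<^sup>2) ^ i \<noteq> 1" unfolding p(3) by (rule q1) simp
  show "x * q\<^sup>2 * (q\<^sup>2) ^ i \<noteq> 1" unfolding p(4) by (rule q1) simp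
  show "q * q\<^sup>2 / (- q) * (q\<^sup>2) ^ i \<noteq> 1"
  proof
    assume "q * q\<^sup>2 / (- q) * (q\<^sup>2) ^ i = 1"
    moreover have "q * q\<^sup>2 / (- q) * (q\<^sup>2) ^ i = - (q ^ (2 + 2 * i))"
      using q0 by (simp add: power_add power_mult power2_eq_square)
    ultimately have "(q ^ (2 + 2 * i))\<^sup>2 = 1"
      by (metis power2_minus one_power2)
    hence "q ^ ((2 + 2 * i) * 2) = 1"
      by (simp only: power_mult)
    thus False using q1[of "(2 + 2 * i) * 2"] by (simp only:) simp
  qed
  show "q\<^sup>2 / x * (q\<^sup>2) ^ i \<noteq> 1"
  proof
    assume "q\<^sup>2 / x * (q\<^sup>2) ^ i = 1"
    hence "q\<^sup>2 * (q\<^sup>2) ^ i = x"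
      using q0 by (simp add: x)
    hence *: "q ^ (2 + 2 * i) = q ^ (2 * N + 1)"
      unfolding x by (simp only: power_add power_mult)
    have inj: False if "q ^ a = q ^ b" "a < b" for a b
    proof -
      have "q ^ a * q ^ (b - a) = q ^ b"
        using that(2) by (simp only: power_add[symmetric] le_add_diff_inverse less_imp_le)
      hence "q ^ (b - a) = 1" using that(1) q0 by simp
      thus False using q1[of "b - a"] that by simp
    qed
    have "2 + 2 * i \<noteq> 2 * N + 1" by presburger
    thus False
      using inj[OF *] inj[OF *[symmetric]] linorder_neqE_nat by blast
  qed
qed

lemma x_eq: "q * (q\<^sup>2) ^ N = x" "1 / (q\<^sup>2) ^ N = q / x"
  using q0 by (simp_all add: x power_mult)

text \<open>Both sides are (q;q^2)_(N+1), split at its first and at its last factor. This brings out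
  the 1 - x, hence the [n], of the congruence.\<close>

lemma prefactor: "(1 - q) * qpoch (q * q\<^sup>2) (q\<^sup>2) N = (1 - x) * qpoch q (q\<^sup>2) N"
  using qpoch_Suc[of q "q\<^sup>2" N] qpoch_Suc'[of q "q\<^sup>2" N] unfolding x_eq(1) by (simp add: mult.commute)

text \<open>Here the sixth parameter q/x = q^(-2N) terminates the series while \<alpha> stays
  free.\<close>

lemma deformed_sum_beta:
  assumes "\<alpha> \<noteq> 0" and \<alpha>: "\<And>i. q\<^sup>2 / \<alpha> * (q\<^sup>2) ^ i \<noteq> 1" "\<And>i. \<alpha> * q\<^sup>2 * (q\<^sup>2) ^ i \<noteq> 1"
  shows "(\<Sum>k\<le>N. deformed_summand q \<alpha> (1 / x) k) = (1 - x) / (1 - q)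
     * (qpoch q (q\<^sup>2) N ^ 2 / (qpoch (q\<^sup>2 / \<alpha>) (q\<^sup>2) N * qpoch (\<alpha> * q\<^sup>2) (q\<^sup>2) N))
     * (\<Sum>j\<le>N. deformed_4phi3_term q \<alpha> (1 / x) j)"
proof -
  have e: "q * q\<^sup>2 / (- q) = - (q\<^sup>2)" "q * q\<^sup>2 / (- q * - q) = q" "q * q\<^sup>2 / (\<alpha> * q) = q\<^sup>2 / \<alpha>"
    "q * q\<^sup>2 / (q / \<alpha>) = \<alpha> * q\<^sup>2" "q * q\<^sup>2 / (\<alpha> * q * (q / \<alpha>)) = q"
    "\<alpha> * q * (q / \<alpha>) / x = q\<^sup>2 / x" "\<alpha> * q * (q / \<alpha>) / (q * (q\<^sup>2) ^ N) = q\<^sup>2 / x" "q * q * (q\<^sup>2) ^ N = q * x"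
    "q * q\<^sup>2 * (q\<^sup>2) ^ N = q\<^sup>2 * x"
    using q0 \<open>\<alpha> \<noteq> 0\<close> by (simp_all add: x_eq[symmetric] power2_eq_square)
  have "q\<^sup>2 / x * (q\<^sup>2) ^ i \<noteq> 1" for i by (rule generic_facts)
  hence W: "(\<Sum>k\<le>N. qpoch q (q\<^sup>2) k * (1 - q * (q\<^sup>2) ^ (2 * k))
            * (qpoch (- q) (q\<^sup>2) k * qpoch (- q) (q\<^sup>2) k * qpoch (\<alpha> * q) (q\<^sup>2) k * qpoch (q / \<alpha>) (q\<^sup>2) k * qpoch (q / x) (q\<^sup>2) k)
            / (qpoch (q\<^sup>2) (q\<^sup>2) k * qpoch (- (q\<^sup>2)) (q\<^sup>2) k * qpoch (- (q\<^sup>2)) (q\<^sup>2) k * qpoch (q\<^sup>2 / \<alpha>) (q\<^sup>2) k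
                 * qpoch (\<alpha> * q\<^sup>2) (q\<^sup>2) k * qpoch (q\<^sup>2 * x) (q\<^sup>2) k) * (q * x) ^ k)
       = (1 - q) * (qpoch (q * q\<^sup>2) (q\<^sup>2) N * qpoch q (q\<^sup>2) N / (qpoch (q\<^sup>2 / \<alpha>) (q\<^sup>2) N * qpoch (\<alpha> * q\<^sup>2) (q\<^sup>2) N))
          * (\<Sum>j\<le>N. qpoch q (q\<^sup>2) j * qpoch (\<alpha> * q) (q\<^sup>2) j * qpoch (q / \<alpha>) (q\<^sup>2) j * qpoch (q / x) (q\<^sup>2) j
               / (qpoch (q\<^sup>2) (q\<^sup>2) j * qpoch (- (q\<^sup>2)) (q\<^sup>2) j * qpoch (- (q\<^sup>2)) (q\<^sup>2) j
                    * qpoch (q\<^sup>2 / x) (q\<^sup>2) j) * (q\<^sup>2) ^ j)"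
    using watson_8phi7[of q "- q" "- q" "\<alpha> * q" "q / \<alpha>" "q\<^sup>2" N, unfolded e x_eq]
      generic_facts[unfolded e] q0 \<open>\<alpha> \<noteq> 0\<close> \<alpha> by simp
  have 1: "(\<Sum>k\<le>N. deformed_summand q \<alpha> (1 / x) k) =
      (\<Sum>k\<le>N. qpoch q (q\<^sup>2) k * (1 - q * (q\<^sup>2) ^ (2 * k))
            * (qpoch (- q) (q\<^sup>2) k * qpoch (- q) (q\<^sup>2) k * qpoch (\<alpha> * q) (q\<^sup>2) k * qpoch (q / \<alpha>) (q\<^sup>2) k * qpoch (q / x) (q\<^sup>2) k)
            / (qpoch (q\<^sup>2) (q\<^sup>2) k * qpoch (- (q\<^sup>2)) (q\<^sup>2) k * qpoch (- (q\<^sup>2)) (q\<^sup>2) k * qpoch (q\<^sup>2 / \<alpha>) (q\<^sup>2) k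
                 * qpoch (\<alpha> * q\<^sup>2) (q\<^sup>2) k * qpoch (q\<^sup>2 * x) (q\<^sup>2) k) * (q * x) ^ k) / (1 - q)"
    unfolding sum_divide_distrib
  proof (intro sum.cong refl)
    fix k
    have e4: "q * (q\<^sup>2) ^ (2 * k) = q ^ (4 * k + 1)"
      by (simp flip: power_mult)
    show "deformed_summand q \<alpha> (1 / x) k = qpoch q (q\<^sup>2) k * (1 - q * (q\<^sup>2) ^ (2 * k))
            * (qpoch (- q) (q\<^sup>2) k * qpoch (- q) (q\<^sup>2) k * qpoch (\<alpha> * q) (q\<^sup>2) k * qpoch (q / \<alpha>) (q\<^sup>2) k * qpoch (q / x) (q\<^sup>2) k)
            / (qpoch (q\<^sup>2) (q\<^sup>2) k * qpoch (- (q\<^sup>2)) (q\<^sup>2) k * qpoch (- (q\<^sup>2)) (q\<^sup>2) k * qpoch (q\<^sup>2 / \<alpha>) (q\<^sup>2) k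
                 * qpoch (\<alpha> * q\<^sup>2) (q\<^sup>2) k * qpoch (q\<^sup>2 * x) (q\<^sup>2) k) * (q * x) ^ k / (1 - q)"
      unfolding e4 deformed_summand_def power_one_over
      by (simp add: even_factor_def power_mult_distrib power_divide power2_eq_square[of "qpoch a b c" for a b c]
        divide_inverse mult_ac)
  qed
  have 2: "(\<Sum>j\<le>N. qpoch q (q\<^sup>2) j * qpoch (\<alpha> * q) (q\<^sup>2) j * qpoch (q / \<alpha>) (q\<^sup>2) j * qpoch (q / x) (q\<^sup>2) j
               / (qpoch (q\<^sup>2) (q\<^sup>2) j * qpoch (- (q\<^sup>2)) (q\<^sup>2) j * qpoch (- (q\<^sup>2)) (q\<^sup>2) j
                    * qpoch (q\<^sup>2 / x) (q\<^sup>2) j) * (q\<^sup>2) ^ j) = (\<Sum>j\<le>N. deformed_4phi3_term q \<alpha> (1 / x) j)"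
    by (intro sum.cong refl)
       (simp add: deformed_4phi3_term_def even_factor_def power2_eq_square[of "qpoch a b c" for a b c] divide_inverse mult_ac)
  show ?thesis
    unfolding 1 W 2 mult.assoc[of "1 - q", symmetric] times_divide_eq_right[of "1 - q"] prefactor
    by (simp add: power2_eq_square mult_ac)
qed

text \<open>Now q/\<alpha> = q/x terminates the series, and the sixth parameter, equal to q, takes
  the role of e in Watson's formula. \<open>qpoch_half_reflect\<close> reduces the prefactor to the
  power 1/q^N.\<close>

lemma deformed_sum_alpha:
  shows "(\<Sum>k\<le>N. deformed_summand q x 1 k) = (1 - x) / (1 - q)
     * (1 / q ^ N) * (\<Sum>j\<le>N. deformed_4phi3_term q x 1 j)"
proof -
  have x0: "x \<noteq> 0" using q0 by (simp add: x)
  have e: "q * q\<^sup>2 / (- q) = - (q\<^sup>2)" "q * q\<^sup>2 / (- q * - q) = q" "q * q\<^sup>2 / (x * q) = q\<^sup>2 / x"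
    "q * q\<^sup>2 / q = q\<^sup>2" "q * q\<^sup>2 / (x * q * q) = q / x"
    "x * q * q / x = q\<^sup>2" "x * q * q / (q * (q\<^sup>2) ^ N) = q\<^sup>2" "q * (q / x) * (q\<^sup>2) ^ N = q"
    "q * q\<^sup>2 * (q\<^sup>2) ^ N = x * q\<^sup>2"
    using q0 by (simp_all add: x_eq[symmetric] power2_eq_square)
  have W: "(\<Sum>k\<le>N. qpoch q (q\<^sup>2) k * (1 - q * (q\<^sup>2) ^ (2 * k))
            * (qpoch (- q) (q\<^sup>2) k * qpoch (- q) (q\<^sup>2) k * qpoch (x * q) (q\<^sup>2) k * qpoch q (q\<^sup>2) k * qpoch (q / x) (q\<^sup>2) k)
            / (qpoch (q\<^sup>2) (q\<^sup>2) k * qpoch (- (q\<^sup>2)) (q\<^sup>2) k * qpoch (- (q\<^sup>2)) (q\<^sup>2) k * qpoch (q\<^sup>2 / x) (q\<^sup>2) k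
                 * qpoch (q\<^sup>2) (q\<^sup>2) k * qpoch (x * q\<^sup>2) (q\<^sup>2) k) * q ^ k)
       = (1 - q) * (qpoch (q * q\<^sup>2) (q\<^sup>2) N * qpoch (q / x) (q\<^sup>2) N / (qpoch (q\<^sup>2 / x) (q\<^sup>2) N * qpoch (q\<^sup>2) (q\<^sup>2) N))
          * (\<Sum>j\<le>N. qpoch q (q\<^sup>2) j * qpoch (x * q) (q\<^sup>2) j * qpoch q (q\<^sup>2) j * qpoch (q / x) (q\<^sup>2) j
               / (qpoch (q\<^sup>2) (q\<^sup>2) j * qpoch (- (q\<^sup>2)) (q\<^sup>2) j * qpoch (- (q\<^sup>2)) (q\<^sup>2) j
                    * qpoch (q\<^sup>2) (q\<^sup>2) j) * (q\<^sup>2) ^ j)"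
    using watson_8phi7[of q "- q" "- q" "x * q" q "q\<^sup>2" N, unfolded e x_eq]
      generic_facts[unfolded e] q0 x0 by simp
  have 1: "(\<Sum>k\<le>N. deformed_summand q x 1 k) =
      (\<Sum>k\<le>N. qpoch q (q\<^sup>2) k * (1 - q * (q\<^sup>2) ^ (2 * k))
            * (qpoch (- q) (q\<^sup>2) k * qpoch (- q) (q\<^sup>2) k * qpoch (x * q) (q\<^sup>2) k * qpoch q (q\<^sup>2) k * qpoch (q / x) (q\<^sup>2) k)
            / (qpoch (q\<^sup>2) (q\<^sup>2) k * qpoch (- (q\<^sup>2)) (q\<^sup>2) k * qpoch (- (q\<^sup>2)) (q\<^sup>2) k * qpoch (q\<^sup>2 / x) (q\<^sup>2) k
                 * qpoch (q\<^sup>2) (q\<^sup>2) k * qpoch (x * q\<^sup>2) (q\<^sup>2) k) * q ^ k) / (1 - q)"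
    unfolding sum_divide_distrib
  proof (intro sum.cong refl)
    fix k
    have e4: "q * (q\<^sup>2) ^ (2 * k) = q ^ (4 * k + 1)"
      by (simp flip: power_mult)
    show "deformed_summand q x 1 k = qpoch q (q\<^sup>2) k * (1 - q * (q\<^sup>2) ^ (2 * k))
            * (qpoch (- q) (q\<^sup>2) k * qpoch (- q) (q\<^sup>2) k * qpoch (x * q) (q\<^sup>2) k * qpoch q (q\<^sup>2) k * qpoch (q / x) (q\<^sup>2) k)
            / (qpoch (q\<^sup>2) (q\<^sup>2) k * qpoch (- (q\<^sup>2)) (q\<^sup>2) k * qpoch (- (q\<^sup>2)) (q\<^sup>2) k * qpoch (q\<^sup>2 / x) (q\<^sup>2) k
                 * qpoch (q\<^sup>2) (q\<^sup>2) k * qpoch (x * q\<^sup>2) (q\<^sup>2) k) * q ^ k / (1 - q)"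
      unfolding e4 deformed_summand_def
      by (simp add: even_factor_def power2_eq_square[of "qpoch a b c" for a b c]
        divide_inverse mult_ac)
  qed
  have 2: "(\<Sum>j\<le>N. qpoch q (q\<^sup>2) j * qpoch (x * q) (q\<^sup>2) j * qpoch q (q\<^sup>2) j * qpoch (q / x) (q\<^sup>2) j
               / (qpoch (q\<^sup>2) (q\<^sup>2) j * qpoch (- (q\<^sup>2)) (q\<^sup>2) j * qpoch (- (q\<^sup>2)) (q\<^sup>2) j
                    * qpoch (q\<^sup>2) (q\<^sup>2) j) * (q\<^sup>2) ^ j) = (\<Sum>j\<le>N. deformed_4phi3_term q x 1 j)"
    by (intro sum.cong refl)
       (simp add: deformed_4phi3_term_def even_factor_def power2_eq_square[of "qpoch a b c" for a b c] divide_inverse mult_ac)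
  have "qpoch (q\<^sup>2 / x) (q\<^sup>2) N \<noteq> 0" "qpoch (q\<^sup>2) (q\<^sup>2) N \<noteq> 0"
    by (intro qpoch_nonzero generic_facts)+
  hence 3: "qpoch q (q\<^sup>2) N * qpoch (q / x) (q\<^sup>2) N / (qpoch (q\<^sup>2 / x) (q\<^sup>2) N * qpoch (q\<^sup>2) (q\<^sup>2) N) = 1 / q ^ N"
    using qpoch_half_reflect[OF q0, of N] q0 unfolding x[symmetric] by (simp add: frac_eq_eq mult_ac)
  have "(1 - q) * (qpoch (q * q\<^sup>2) (q\<^sup>2) N * qpoch (q / x) (q\<^sup>2) N / (qpoch (q\<^sup>2 / x) (q\<^sup>2) N * qpoch (q\<^sup>2) (q\<^sup>2) N))
     = (1 - x) * (qpoch q (q\<^sup>2) N * qpoch (q / x) (q\<^sup>2) N / (qpoch (q\<^sup>2 / x) (q\<^sup>2) N * qpoch (q\<^sup>2) (q\<^sup>2) N))"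
    unfolding times_divide_eq_right mult.assoc[symmetric] prefactor ..
  thus ?thesis
    unfolding 1 W 2 3 by simp
qed

end

subsection \<open>First-order expansions\<close>

lemma qpoch_odd: "qpoch (c * q) (q\<^sup>2) k = (\<Prod>i<k. 1 - c * q ^ (2 * i + 1))"
  and qpoch_even: "qpoch (c * q\<^sup>2) (q\<^sup>2) k = (\<Prod>i<k. 1 - c * q ^ (2 * i + 2))"
  for c q :: "'a::comm_ring_1"
proof -
  have "(q\<^sup>2) ^ i = q ^ (2 * i)" for i
    by (simp add: power_mult)
  hence "c * q * (q\<^sup>2) ^ i = c * q ^ (2 * i + 1)" "c * q\<^sup>2 * (q\<^sup>2) ^ i = c * q ^ (2 * i + 2)" for i
    by (simp_all only: power_add power_one_right mult.assoc mult.commute[of q "q ^ (2 * i)"] mult.commute[of "q\<^sup>2" "q ^ (2 * i)"])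
  thus "qpoch (c * q) (q\<^sup>2) k = (\<Prod>i<k. 1 - c * q ^ (2 * i + 1))"
    "qpoch (c * q\<^sup>2) (q\<^sup>2) k = (\<Prod>i<k. 1 - c * q ^ (2 * i + 2))"
    by (simp_all only: qpoch_def)
qed

lemma deformed_summand_1_1:
  "deformed_summand q 1 1 k = (1 - q ^ (4 * k + 1)) / (1 - q) * vwp_term q k"
proof -
  have *: "qpoch (q ^ 2) (q ^ 4) k = qpoch q (q\<^sup>2) k * qpoch (- q) (q\<^sup>2) k"
    "qpoch (q ^ 4) (q ^ 4) k = qpoch (q\<^sup>2) (q\<^sup>2) k * qpoch (- (q\<^sup>2)) (q\<^sup>2) k"
    using qpoch_square[of q "q\<^sup>2" k] qpoch_square[of "q\<^sup>2" "q\<^sup>2" k] by (simp_all flip: power_mult)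
  show ?thesis
    unfolding deformed_summand_def even_factor_def vwp_term_def *
    by (simp add: power_mult_distrib power2_eq_square[of "qpoch a b c" for a b c] divide_inverse mult_ac)
qed

text \<open>A first-order expansion in u, which will be 1 - x or its square. Only the values of the
  cofactor on \<open>Z\<close> are recorded, since they determine it up to another factor 1 -
  x.\<close>

definition expands :: "complex set \<Rightarrow> rat poly fract \<Rightarrow> rat poly fract \<Rightarrow> (complex \<Rightarrow> complex) \<Rightarrow> bool" where
  "expands Z u A c \<longleftrightarrow> (\<exists>S. regular_on Z S \<and> A = 1 + u * S \<and> (\<forall>z\<in>Z. ev z S = c z))"

lemma expandsI: "regular_on Z S \<Longrightarrow> A = 1 + u * S \<Longrightarrow> (\<And>z. z \<in> Z \<Longrightarrow> ev z S = c z) \<Longrightarrow> expands Z u A c"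
  by (auto simp: expands_def)

lemma expands_1: "expands Z u 1 (\<lambda>_. 0)"
  by (rule expandsI[where S = 0]) (auto intro: regular_on_0)

context
  fixes Z :: "complex set" and u :: "rat poly fract"
  assumes u: "regular_on Z u" "\<And>z. z \<in> Z \<Longrightarrow> ev z u = 0"
begin

lemma expands_regular: "expands Z u A c \<Longrightarrow> regular_on Z A"
  and ev_expands: "expands Z u A c \<Longrightarrow> z \<in> Z \<Longrightarrow> ev z A = 1"
  using u by (auto simp: expands_def ev_add[of Z] ev_mult[of Z] regular_on_intros)

lemma expands_mult:
  assumes "expands Z u A c" "expands Z u B d"
  shows "expands Z u (A * B) (\<lambda>z. c z + d z)"
proof -
  from assms obtain S T where S: "regular_on Z S" "A = 1 + u * S" "\<And>z. z \<in> Z \<Longrightarrow> ev z S = c z"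
    and T: "regular_on Z T" "B = 1 + u * T" "\<And>z. z \<in> Z \<Longrightarrow> ev z T = d z"
    by (auto simp: expands_def)
  show ?thesis
  proof (rule expandsI)
    show "regular_on Z (S + T + u * S * T)"
      by (intro regular_on_intros u S T)
    show "A * B = 1 + u * (S + T + u * S * T)"
      by (simp add: S T algebra_simps)
    show "ev z (S + T + u * S * T) = c z + d z" if "z \<in> Z" for z
      using that S(1,3) T(1,3) u by (simp add: ev_add[of Z] ev_mult[of Z] regular_on_intros)
  qed
qed

lemma expands_divide:
  assumes "expands Z u A c" "expands Z u B d"
  shows "expands Z u (A / B) (\<lambda>z. c z - d z)"
proof (cases "B = 0")
  case True
  \<comment> \<open>A zero denominator can only occur for empty \<open>Z\<close>, where everything
    is regular. Then u is nonzero because 0 = B = 1 + u T, and the cofactor -1/u represents A / B =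
    0.\<close>
  hence "Z = {}" using ev_expands[OF assms(2)] by auto
  moreover have "\<exists>a b. C = to_fract a / to_fract b" for C :: "rat poly fract"
    by (metis Fract_conv_to_fract Fract_quot_of_fract)
  ultimately have reg: "regular_on Z C" for C
    by (auto simp: regular_on_def)
  have "A / B = 0" using True by simp
  have "u \<noteq> 0" using assms(2) True by (auto simp: expands_def)
  thus ?thesis
    using \<open>Z = {}\<close> by (intro expandsI[where S = "- 1 / u"] reg) (auto simp: True)
next
  case B0: False
  from assms obtain S T where S: "regular_on Z S" "A = 1 + u * S" "\<And>z. z \<in> Z \<Longrightarrow> ev z S = c z"
    and T: "regular_on Z T" "B = 1 + u * T" "\<And>z. z \<in> Z \<Longrightarrow> ev z T = d z"
    by (auto simp: expands_def)
  have B: "regular_on Z B" "\<And>z. z \<in> Z \<Longrightarrow> ev z B = 1"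
    using expands_regular[OF assms(2)] ev_expands[OF assms(2)] by auto
  show ?thesis
  proof (rule expandsI)
    show "regular_on Z ((S - T) / B)"
      using B by (intro regular_on_intros S T) auto
    have "A = B + u * (S - T)" by (simp add: S T algebra_simps)
    thus "A / B = 1 + u * ((S - T) / B)"
      using B0 by (simp add: add_divide_distrib)
    show "ev z ((S - T) / B) = c z - d z" if "z \<in> Z" for z
      using that S(1,3) T(1,3) B by (simp add: ev_diff[of Z] ev_divide[of Z] regular_on_intros)
  qed
qed

lemma expands_prod:
  assumes "\<And>i. i \<in> I \<Longrightarrow> expands Z u (A i) (c i)"
  shows "expands Z u (\<Prod>i\<in>I. A i) (\<lambda>z. \<Sum>i\<in>I. c i z)"
  using assms
  by (induction I rule: infinite_finite_induct) (auto intro: expands_1 expands_mult)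

end

lemma qvar_nonzero [simp]: "qvar \<noteq> 0"
  by (simp add: qvar_def)

lemma qvar_power_neq_1:
  assumes "0 < i" shows "qvar ^ i \<noteq> 1"
proof
  assume "qvar ^ i = 1"
  \<comment> \<open>Evaluation at 2 separates the powers of q.\<close>
  hence "ev 2 (qvar ^ i) = 1" by simp
  moreover have "ev 2 (qvar ^ i) = 2 ^ i"
    using ev_power[of "{2}" qvar 2 i] by (simp add: regular_on_qvar)
  ultimately have "(2::complex) ^ i = 1" by simp
  hence "norm ((2::complex) ^ i) = 1" by simp
  thus False using assms one_less_power[of "2 :: real" i] by (simp add: norm_power)
qed

section \<open>Expansions in 1 - x near the primitive n-th roots of unity\<close>

text \<open>N > 0 excludes n = 1, for which 1 - q itself would vanish at the root. The locale is
  used for n and again for its proper divisors greater than 1.\<close>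

locale cyclotomic_localization =
  fixes n N :: nat
  assumes n: "n = 2 * N + 1" and N: "N > 0"
begin

abbreviation "Z \<equiv> primitive_roots n"
abbreviation "q \<equiv> qvar"
definition "x = qvar ^ n"

lemma root: "z \<in> Z \<Longrightarrow> odd_root_of_unity z N"
  using n by unfold_locales (simp add: primitive_root_power_eq_1)

lemma root_power_neq_1: "z \<in> Z \<Longrightarrow> 0 < i \<Longrightarrow> i < n \<Longrightarrow> z ^ i \<noteq> 1"
  using odd_root_of_unity.root_neq_1[OF root] unfolding n by blast

lemma root_nonzero: "z \<in> Z \<Longrightarrow> z \<noteq> 0"
  using odd_root_of_unity.root_nonzero[OF root] by blast

lemmas ev_simps = ev_add[of Z] ev_diff[of Z] ev_mult[of Z] ev_minus[of Z] ev_power[of Z] ev_divide[of Z]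
  ev_of_nat[of _ Z] ev_sum[of _ Z] ev_prod[of _ Z] ev_qpoch[of Z]

lemma regular_x: "regular_on Z x" and ev_x: "z \<in> Z \<Longrightarrow> ev z x = 1" and x_nonzero: "x \<noteq> 0"
  using odd_root_of_unity.root_power[OF root, of z] unfolding n[symmetric]
  by (simp_all add: x_def ev_power[of Z] regular_on_intros)

lemma regular_eps: "regular_on Z (1 - x)" and ev_eps: "z \<in> Z \<Longrightarrow> ev z (1 - x) = 0"
  by (auto simp: regular_x ev_x ev_simps regular_on_intros)

lemma regular_eps2: "regular_on Z ((1 - x)\<^sup>2)" and ev_eps2: "z \<in> Z \<Longrightarrow> ev z ((1 - x)\<^sup>2) = 0"
  by (auto simp: regular_eps ev_eps ev_power[of Z] intro!: regular_on_power)

lemma ev_q_power: "z \<in> Z \<Longrightarrow> ev z (q ^ i) = z ^ i"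
  by (simp add: ev_simps regular_on_intros)

definition "pair_ratio i = (1 - q ^ i * x) * (1 - q ^ i / x) / (1 - q ^ i)\<^sup>2"
definition "inverse_ratio i = (1 - q ^ i / x) / (1 - q ^ i)"
definition "direct_ratio i = (1 - q ^ i * x) / (1 - q ^ i)"

lemma one_minus_q_power_nonzero: "0 < i \<Longrightarrow> 1 - q ^ i \<noteq> 0"
  using qvar_power_neq_1[of i] by simp

lemma regular_one_minus_q_power: "regular_on Z (1 - q ^ i)"
  by (intro regular_on_intros)

lemma ev_one_minus_q_power: "z \<in> Z \<Longrightarrow> ev z (1 - q ^ i) = 1 - z ^ i"
  by (simp add: ev_simps regular_on_intros)

text \<open>(1 - yx)(1 - y/x) = (1 - y)^2 - (1 - x)^2 y/x has no linear term. This is the gain from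
  keeping \<alpha> and 1/\<alpha> together.\<close>

lemma expands_pair_ratio:
  assumes "0 < i" "i < n"
  shows "expands Z ((1 - x)\<^sup>2) (pair_ratio i) (\<lambda>z. - koebe (z ^ i))"
proof (rule expandsI)
  have nz: "ev z ((1 - q ^ i)\<^sup>2 * x) \<noteq> 0" if "z \<in> Z" for z
    using root_power_neq_1[OF that assms] that
    by (simp add: ev_simps regular_on_intros regular_x ev_x)
  show "regular_on Z (- (q ^ i / ((1 - q ^ i)\<^sup>2 * x)))"
    by (intro regular_on_intros regular_x nz)
  have *: "(1 - y * x) * (1 - y / x) = (1 - y)\<^sup>2 - (1 - x)\<^sup>2 * (y / x)" for y
    using x_nonzero by (simp add: field_simps power2_eq_square)
  show "pair_ratio i = 1 + (1 - x)\<^sup>2 * - (q ^ i / ((1 - q ^ i)\<^sup>2 * x))"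
    unfolding pair_ratio_def * using one_minus_q_power_nonzero[OF assms(1)]
    by (simp add: diff_divide_distrib mult.commute)
  show "ev z (- (q ^ i / ((1 - q ^ i)\<^sup>2 * x))) = - koebe (z ^ i)" if "z \<in> Z" for z
  proof -
    have "ev z (q ^ i / ((1 - q ^ i)\<^sup>2 * x)) = ev z (q ^ i) / ev z ((1 - q ^ i)\<^sup>2 * x)"
      by (intro ev_divide[of Z] regular_on_intros regular_x nz that)
    moreover have "regular_on Z (q ^ i / ((1 - q ^ i)\<^sup>2 * x))"
      by (intro regular_on_intros regular_x nz)
    ultimately have "ev z (- (q ^ i / ((1 - q ^ i)\<^sup>2 * x))) = - (ev z (q ^ i) / ev z ((1 - q ^ i)\<^sup>2 * x))"
      using that by (simp only: ev_minus[of Z])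
    thus ?thesis
      using that by (simp add: koebe_def ev_simps regular_on_intros regular_x ev_x)
  qed
qed

lemma expands_inverse_ratio:
  assumes "0 < i" "i < n"
  shows "expands Z (1 - x) (inverse_ratio i) (\<lambda>z. - (z ^ i / (1 - z ^ i)))"
proof (rule expandsI)
  have nz: "ev z ((1 - q ^ i) * x) \<noteq> 0" if "z \<in> Z" for z
    using root_power_neq_1[OF that assms] that
    by (simp add: ev_simps regular_on_intros regular_x ev_x)
  show "regular_on Z (- (q ^ i / ((1 - q ^ i) * x)))"
    by (intro regular_on_intros regular_x nz)
  have *: "(1 - y / x) / (1 - y) = ((1 - y) - (1 - x) * (y / x)) / (1 - y)" for y
    using x_nonzero by (simp add: field_simps)
  show "inverse_ratio i = 1 + (1 - x) * - (q ^ i / ((1 - q ^ i) * x))"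
    unfolding inverse_ratio_def * using one_minus_q_power_nonzero[OF assms(1)]
    by (subst diff_divide_distrib) (simp add: mult.commute)
  show "ev z (- (q ^ i / ((1 - q ^ i) * x))) = - (z ^ i / (1 - z ^ i))" if "z \<in> Z" for z
  proof -
    have "ev z (q ^ i / ((1 - q ^ i) * x)) = ev z (q ^ i) / ev z ((1 - q ^ i) * x)"
      by (intro ev_divide[of Z] regular_on_intros regular_x nz that)
    moreover have "regular_on Z (q ^ i / ((1 - q ^ i) * x))"
      by (intro regular_on_intros regular_x nz)
    ultimately have "ev z (- (q ^ i / ((1 - q ^ i) * x))) = - (ev z (q ^ i) / ev z ((1 - q ^ i) * x))"
      using that by (simp only: ev_minus[of Z])
    thus ?thesis
      using that by (simp add: ev_simps regular_on_intros regular_x ev_x)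
  qed
qed

lemma expands_direct_ratio:
  assumes "0 < i" "i < n"
  shows "expands Z (1 - x) (direct_ratio i) (\<lambda>z. z ^ i / (1 - z ^ i))"
proof (rule expandsI)
  have nz: "ev z (1 - q ^ i) \<noteq> 0" if "z \<in> Z" for z
    using root_power_neq_1[OF that assms] that
    by (simp add: ev_one_minus_q_power)
  show "regular_on Z (q ^ i / (1 - q ^ i))"
    by (intro regular_on_intros nz)
  have *: "(1 - y * x) / (1 - y) = ((1 - y) + (1 - x) * y) / (1 - y)" for y
    by (simp add: algebra_simps)
  show "direct_ratio i = 1 + (1 - x) * (q ^ i / (1 - q ^ i))"
    unfolding direct_ratio_def * using one_minus_q_power_nonzero[OF assms(1)]
    by (simp add: add_divide_distrib)
  show "ev z (q ^ i / (1 - q ^ i)) = z ^ i / (1 - z ^ i)" if "z \<in> Z" for z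
  proof -
    have "ev z (q ^ i / (1 - q ^ i)) = ev z (q ^ i) / ev z (1 - q ^ i)"
      by (intro ev_divide[of Z] regular_on_intros nz that)
    thus ?thesis using that by (simp only: ev_one_minus_q_power ev_q_power)
  qed
qed

lemma expands_x: "expands Z (1 - x) x (\<lambda>_. - 1)"
  by (rule expandsI[where S = "- 1"])
     (auto intro!: regular_on_intros simp: ev_simps regular_on_intros)

lemma qpoch_ratio_prods:
  shows "even_factor q x k = even_factor q 1 k * (\<Prod>i<k. pair_ratio (2 * i + 1))"
    and "qpoch (q\<^sup>2 / x) (q\<^sup>2) k * qpoch (x * q\<^sup>2) (q\<^sup>2) k = (qpoch (q\<^sup>2) (q\<^sup>2) k)\<^sup>2 * (\<Prod>i<k. pair_ratio (2 * i + 2))"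
    and "qpoch (1 / x * q) (q\<^sup>2) k = qpoch q (q\<^sup>2) k * (\<Prod>i<k. inverse_ratio (2 * i + 1))"
    and "qpoch (1 / x * q\<^sup>2) (q\<^sup>2) k = qpoch (q\<^sup>2) (q\<^sup>2) k * (\<Prod>i<k. inverse_ratio (2 * i + 2))"
    and "qpoch (q\<^sup>2 / (1 / x)) (q\<^sup>2) k = qpoch (q\<^sup>2) (q\<^sup>2) k * (\<Prod>i<k. direct_ratio (2 * i + 2))"
proof -
  have c: "q / x = 1 / x * q" "q\<^sup>2 / x = 1 / x * q\<^sup>2" "q\<^sup>2 / (1 / x) = x * q\<^sup>2"
    by simp_all
  note o = qpoch_odd[of 1 q, simplified] and e = qpoch_even[of 1 q, simplified]
  have nz: "1 - q ^ (2 * i + 1) \<noteq> 0" "1 - q ^ (2 * i + 2) \<noteq> 0" for i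
    by (intro one_minus_q_power_nonzero; simp)+
  have PR: "(1 - x * q ^ i) * (1 - 1 / x * q ^ i) = (1 - q ^ i)\<^sup>2 * pair_ratio i"
    and IR: "1 - 1 / x * q ^ i = (1 - q ^ i) * inverse_ratio i" and DR: "1 - x * q ^ i = (1 - q ^ i) * direct_ratio i"
    if "1 - q ^ i \<noteq> 0" for i
    using that by (simp_all add: pair_ratio_def inverse_ratio_def direct_ratio_def mult.commute)
  show "even_factor q x k = even_factor q 1 k * (\<Prod>i<k. pair_ratio (2 * i + 1))"
    unfolding even_factor_def c qpoch_odd div_by_1 qpoch_odd[of 1 q, unfolded mult_1] prod.distrib[symmetric] mult_1
    by (intro prod.cong refl) (simp only: PR[OF nz(1)] power2_eq_square)
  show "qpoch (q\<^sup>2 / x) (q\<^sup>2) k * qpoch (x * q\<^sup>2) (q\<^sup>2) k = (qpoch (q\<^sup>2) (q\<^sup>2) k)\<^sup>2 * (\<Prod>i<k. pair_ratio (2 * i + 2))"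
    unfolding c qpoch_even qpoch_even[of 1 q, unfolded mult_1] power2_eq_square[of "prod f S" for f S] prod.distrib[symmetric]
    by (intro prod.cong refl) (simp only: PR[OF nz(2)] power2_eq_square mult.commute[of "1 - 1 / x * _"])
  show "qpoch (1 / x * q) (q\<^sup>2) k = qpoch q (q\<^sup>2) k * (\<Prod>i<k. inverse_ratio (2 * i + 1))"
    unfolding qpoch_odd qpoch_odd[of 1 q, unfolded mult_1] prod.distrib[symmetric]
    by (intro prod.cong refl) (simp only: IR[OF nz(1)])
  show "qpoch (1 / x * q\<^sup>2) (q\<^sup>2) k = qpoch (q\<^sup>2) (q\<^sup>2) k * (\<Prod>i<k. inverse_ratio (2 * i + 2))"
    unfolding qpoch_even qpoch_even[of 1 q, unfolded mult_1] prod.distrib[symmetric]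
    by (intro prod.cong refl) (simp only: IR[OF nz(2)])
  show "qpoch (q\<^sup>2 / (1 / x)) (q\<^sup>2) k = qpoch (q\<^sup>2) (q\<^sup>2) k * (\<Prod>i<k. direct_ratio (2 * i + 2))"
    unfolding c qpoch_even qpoch_even[of 1 q, unfolded mult_1] prod.distrib[symmetric]
    by (intro prod.cong refl) (simp only: DR[OF nz(2)])
qed

text \<open>The even ratios record the move of \<alpha> from 1 to x, the odd ones that of \<beta>
  from 1 to 1/x. Doing both multiplies the ratios.\<close>

definition "summand_ratio_even k = (\<Prod>i<k. pair_ratio (2 * i + 1)) / (\<Prod>i<k. pair_ratio (2 * i + 2))"
definition "summand_ratio_odd k = (\<Prod>i<k. inverse_ratio (2 * i + 1)) / (\<Prod>i<k. direct_ratio (2 * i + 2)) * x ^ k"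
definition "phi_ratio_even k = (\<Prod>i<k. pair_ratio (2 * i + 1))"
definition "phi_ratio_odd k = (\<Prod>i<k. inverse_ratio (2 * i + 1)) / (\<Prod>i<k. inverse_ratio (2 * i + 2))"

lemma deformed_summand_factor:
  shows "deformed_summand q x 1 k = deformed_summand q 1 1 k * summand_ratio_even k"
    and "deformed_summand q 1 (1 / x) k = deformed_summand q 1 1 k * summand_ratio_odd k"
    and "deformed_summand q x (1 / x) k = deformed_summand q 1 1 k * summand_ratio_even k * summand_ratio_odd k"
  unfolding deformed_summand_def qpoch_ratio_prods summand_ratio_even_def summand_ratio_odd_def power_one_over
  by (simp_all add: power2_eq_square[of "qpoch a b c" for a b c] divide_inverse mult_ac)

lemma deformed_4phi3_term_factor:
  shows "deformed_4phi3_term q x 1 k = deformed_4phi3_term q 1 1 k * phi_ratio_even k"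
    and "deformed_4phi3_term q 1 (1 / x) k = deformed_4phi3_term q 1 1 k * phi_ratio_odd k"
    and "deformed_4phi3_term q x (1 / x) k = deformed_4phi3_term q 1 1 k * phi_ratio_even k * phi_ratio_odd k"
  unfolding deformed_4phi3_term_def qpoch_ratio_prods phi_ratio_even_def phi_ratio_odd_def
  by (simp_all add: divide_inverse mult_ac)

text \<open>For k \<le> N all exponents stay between 1 and 2N < n, so no factor 1 - q^i vanishes at
  a root. Explicit coefficients matter only for the summand; for the 4phi3 terms regularity of the
  cofactor is enough.\<close>

lemma expands_factors:
  assumes "k \<le> N"
  shows "expands Z ((1 - x)\<^sup>2) (summand_ratio_even k) (\<lambda>z. even_coeff z k)"
    and "expands Z (1 - x) (summand_ratio_odd k) (\<lambda>z. - odd_coeff z k)"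
    and "\<exists>c. expands Z ((1 - x)\<^sup>2) (phi_ratio_even k) c"
    and "\<exists>c. expands Z (1 - x) (phi_ratio_odd k) c"
proof -
  note p = expands_prod[OF regular_eps ev_eps] and p2 = expands_prod[OF regular_eps2 ev_eps2]
  have A1: "expands Z ((1 - x)\<^sup>2) (\<Prod>i<k. pair_ratio (2 * i + 1)) (\<lambda>z. \<Sum>i<k. - koebe (z ^ (2 * i + 1)))"
    using assms n by (intro p2 expands_pair_ratio) auto
  have A2: "expands Z ((1 - x)\<^sup>2) (\<Prod>i<k. pair_ratio (2 * i + 2)) (\<lambda>z. \<Sum>i<k. - koebe (z ^ (2 * i + 2)))"
    using assms n by (intro p2 expands_pair_ratio) auto
  have B1: "expands Z (1 - x) (\<Prod>i<k. inverse_ratio (2 * i + 1)) (\<lambda>z. \<Sum>i<k. - (z ^ (2 * i + 1) / (1 - z ^ (2 * i + 1))))"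
    using assms n by (intro p expands_inverse_ratio) auto
  have B2: "expands Z (1 - x) (\<Prod>i<k. inverse_ratio (2 * i + 2)) (\<lambda>z. \<Sum>i<k. - (z ^ (2 * i + 2) / (1 - z ^ (2 * i + 2))))"
    using assms n by (intro p expands_inverse_ratio) auto
  have C2: "expands Z (1 - x) (\<Prod>i<k. direct_ratio (2 * i + 2)) (\<lambda>z. \<Sum>i<k. z ^ (2 * i + 2) / (1 - z ^ (2 * i + 2)))"
    using assms n by (intro p expands_direct_ratio) auto
  have X: "expands Z (1 - x) (\<Prod>i<k. x) (\<lambda>z. \<Sum>i<k. - 1)"
    by (intro p expands_x)
  have "(\<lambda>z. (\<Sum>i<k. - koebe (z ^ (2 * i + 1))) - (\<Sum>i<k. - koebe (z ^ (2 * i + 2)))) = (\<lambda>z :: complex. even_coeff z k)"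
    by (simp add: even_coeff_def sum_subtractf sum_negf)
  thus "expands Z ((1 - x)\<^sup>2) (summand_ratio_even k) (\<lambda>z. even_coeff z k)"
    using expands_divide[OF regular_eps2 ev_eps2 A1 A2] by (simp add: summand_ratio_even_def)
  have "(\<lambda>z. (\<Sum>i<k. - (z ^ (2 * i + 1) / (1 - z ^ (2 * i + 1)))) - (\<Sum>i<k. z ^ (2 * i + 2) / (1 - z ^ (2 * i + 2))) + (\<Sum>i<k. - 1))
     = (\<lambda>z :: complex. - odd_coeff z k)"
    by (simp add: odd_coeff_def sum_subtractf sum_negf sum.distrib)
  thus "expands Z (1 - x) (summand_ratio_odd k) (\<lambda>z. - odd_coeff z k)"
    using expands_mult[OF regular_eps ev_eps expands_divide[OF regular_eps ev_eps B1 C2] X]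
    by (simp add: summand_ratio_odd_def)
  show "\<exists>c. expands Z ((1 - x)\<^sup>2) (phi_ratio_even k) c"
    unfolding phi_ratio_even_def using A1 by blast
  show "\<exists>c. expands Z (1 - x) (phi_ratio_odd k) c"
    unfolding phi_ratio_odd_def using expands_divide[OF regular_eps ev_eps B1 B2] by blast
qed

end

subsection \<open>The congruences modulo powers of a cyclotomic polynomial\<close>

lemma deformed_4phi3_term_1_1:
  "deformed_4phi3_term q 1 1 j = qpoch q (q ^ 2) j ^ 4 / qpoch (q ^ 4) (q ^ 4) j ^ 2 * q ^ (2 * j)"
proof -
  have *: "qpoch (q ^ 4) (q ^ 4) j = qpoch (q\<^sup>2) (q\<^sup>2) j * qpoch (- (q\<^sup>2)) (q\<^sup>2) j"
    using qpoch_square[of "q\<^sup>2" "q\<^sup>2" j] by (simp flip: power_mult)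
  have **: "P ^ 4 = P * P * P * P" for P :: 'a
    by (simp add: eval_nat_numeral mult.assoc)
  show ?thesis
    unfolding deformed_4phi3_term_def even_factor_def * **[of "qpoch q (q\<^sup>2) j"] power_mult
    by (simp add: power_mult_distrib power2_eq_square[of "qpoch a b c" for a b c] divide_inverse mult_ac)
qed

section \<open>Gaussian binomials and regularity for every index\<close>

text \<open>The q-Pascal recurrence serves as definition because it shows without any division that
  the values are polynomials in q.\<close>

fun gauss_binomial :: "'a::comm_ring_1 \<Rightarrow> nat \<Rightarrow> nat \<Rightarrow> 'a" where
  "gauss_binomial q n 0 = 1"
| "gauss_binomial q 0 (Suc k) = 0"
| "gauss_binomial q (Suc n) (Suc k) = gauss_binomial q n k + q ^ Suc k * gauss_binomial q n (Suc k)"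

lemma gauss_binomial_eq_0: "n < k \<Longrightarrow> gauss_binomial q n k = 0"
  by (induction q n k rule: gauss_binomial.induct) auto

lemma gauss_binomial_qpoch:
  "gauss_binomial q (k + m) k * qpoch q q k * qpoch q q m = qpoch q q (k + m)"
proof (induction "k + m" arbitrary: k m)
  case (Suc n)
  show ?case
  proof (cases k)
    case (Suc j)
    note k = this
    have IH1: "gauss_binomial q (j + m) j * qpoch q q j * qpoch q q m = qpoch q q (j + m)"
      using Suc.hyps(2) k by (intro Suc.hyps(1)) simp
    have IH2: "gauss_binomial q (j + m) k * qpoch q q k * qpoch q q m = qpoch q q (j + m) * (1 - q ^ m)"
    proof (cases m)
      case 0
      thus ?thesis by (simp add: k gauss_binomial_eq_0)
    next
      case (Suc i)
      have "gauss_binomial q (k + i) k * qpoch q q k * qpoch q q i = qpoch q q (k + i)"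
        using Suc.hyps(2) k Suc by (intro Suc.hyps(1)) simp
      thus ?thesis
        by (simp add: k Suc qpoch_Suc[of q q i] mult.assoc[symmetric])
    qed
    have "gauss_binomial q (k + m) k * qpoch q q k * qpoch q q m =
       (gauss_binomial q (j + m) j * qpoch q q j * qpoch q q m) * (1 - q ^ k)
       + q ^ k * (gauss_binomial q (j + m) k * qpoch q q k * qpoch q q m)"
      by (simp add: k qpoch_Suc[of q q j] algebra_simps)
    also have "\<dots> = qpoch q q (j + m) * (1 - q ^ (k + m))"
      unfolding IH1 IH2 by (simp add: power_add algebra_simps)
    also have "\<dots> = qpoch q q (k + m)"
      by (simp add: k qpoch_Suc)
    finally show ?thesis .
  qed simp
qed simp

lemma qpoch_double: "qpoch q q (2 * k) = qpoch q (q\<^sup>2) k * qpoch (q\<^sup>2) (q\<^sup>2) k"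
proof (induction k)
  case (Suc k)
  have "qpoch q q (2 * Suc k) = qpoch q q (2 * k) * (1 - q * q ^ (2 * k)) * (1 - q * q ^ Suc (2 * k))"
    by (simp add: qpoch_Suc)
  moreover have "q * q ^ (2 * k) = q * (q\<^sup>2) ^ k"
    by (simp add: power_mult)
  moreover have "q * q ^ Suc (2 * k) = q\<^sup>2 * (q\<^sup>2) ^ k"
    by (simp only: power_mult[symmetric] power_add[symmetric] power_Suc[symmetric]) simp
  ultimately have "qpoch q q (2 * Suc k) =
      qpoch q (q\<^sup>2) k * qpoch (q\<^sup>2) (q\<^sup>2) k * (1 - q * (q\<^sup>2) ^ k) * (1 - q\<^sup>2 * (q\<^sup>2) ^ k)"
    by (simp only: Suc.IH)
  also have "\<dots> = qpoch q (q\<^sup>2) (Suc k) * qpoch (q\<^sup>2) (q\<^sup>2) (Suc k)"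
    by (simp only: qpoch_Suc mult_ac)
  finally show ?case .
qed simp

text \<open>Follows from (q;q)_(2k) = (q;q^2)_k (q^2;q^2)_k and (q^2;q^2)_k = (q;q)_k (-q;q)_k. The
  new denominator has no zero at a root of unity of odd order.\<close>

lemma qpoch_ratio_gauss_binomial:
  fixes q :: "'a::field"
  assumes "qpoch q q k \<noteq> 0"
  shows "qpoch q (q\<^sup>2) k / qpoch (q\<^sup>2) (q\<^sup>2) k = gauss_binomial q (2 * k) k / (qpoch (- q) q k)\<^sup>2"
proof -
  have "gauss_binomial q (2 * k) k * qpoch q q k * qpoch q q k = qpoch q (q\<^sup>2) k * (qpoch q q k * qpoch (- q) q k)"
    using gauss_binomial_qpoch[of q k k] qpoch_double[of q k] by (simp add: qpoch_square mult_2)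
  hence "gauss_binomial q (2 * k) k * qpoch q q k = qpoch q (q\<^sup>2) k * qpoch (- q) q k"
    using assms by (simp add: mult.left_commute mult.assoc)
  hence "qpoch q (q\<^sup>2) k * (qpoch (- q) q k * qpoch (- q) q k) = gauss_binomial q (2 * k) k * (qpoch q q k * qpoch (- q) q k)"
    by (simp only: mult.assoc[symmetric])
  \<comment> \<open>Here m stands for (-q;q)_k, which may be 0 in a general field; then both
    quotients are 0.\<close>
  moreover have "a / (p * m) = b / (m * m)" if "a * (m * m) = b * (p * m)" "p \<noteq> 0" for a b p m :: 'a
    using that by (cases "m = 0") (simp_all add: frac_eq_eq)
  ultimately show ?thesis
    using assms unfolding qpoch_square power2_eq_square[of "qpoch (- q) q k"] by blast
qed

text \<open>Prepares the block argument: if m is a multiple of the order of the root, the second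
  factor evaluates to the term with index r.\<close>

lemma vwp_term_add:
  fixes q :: "'a::field"
  shows "vwp_term q (m + r) = vwp_term q m *
     ((qpoch (q * (q ^ 2) ^ m) (q ^ 2) r ^ 2 * qpoch (q ^ 2 * (q ^ 4) ^ m) (q ^ 4) r ^ 2)
             / (qpoch (q ^ 2 * (q ^ 2) ^ m) (q ^ 2) r ^ 2 * qpoch (q ^ 4 * (q ^ 4) ^ m) (q ^ 4) r ^ 2) * q ^ r)"
  unfolding vwp_term_def qpoch_add power_mult_distrib power_add[of q m r]
  by (simp add: divide_inverse mult_ac)

context cyclotomic_localization
begin

lemma qpoch_even_nonzero:
  assumes "z \<in> Z" "k \<le> 2 * N"
  shows "qpoch (z\<^sup>2) (z\<^sup>2) k \<noteq> 0" "qpoch (z ^ 4) (z ^ 4) k \<noteq> 0"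
  using odd_root_of_unity.qpoch_even_nonzero[OF root[OF assms(1)] assms(2)]
    odd_root_of_unity.qpoch_even_nonzero[OF odd_root_of_unity.square_root_of_unity[OF root[OF assms(1)]] assms(2)]
  by (simp_all flip: power_mult)

lemma ev_vwp_term:
  assumes k: "k \<le> 2 * N" and z: "z \<in> Z"
  shows "ev z (vwp_term q k) = vwp_term z k"
proof -
  have nz: "ev w (qpoch (q ^ 2) (q ^ 2) k ^ 2 * qpoch (q ^ 4) (q ^ 4) k ^ 2) \<noteq> 0" if "w \<in> Z" for w
    using qpoch_even_nonzero[OF that k] that by (simp add: ev_simps regular_on_intros)
  have "ev z (vwp_term q k) = ev z ((qpoch q (q ^ 2) k ^ 2 * qpoch (q ^ 2) (q ^ 4) k ^ 2)
      / (qpoch (q ^ 2) (q ^ 2) k ^ 2 * qpoch (q ^ 4) (q ^ 4) k ^ 2)) * ev z (q ^ k)"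
    unfolding vwp_term_def by (intro ev_mult[of Z] regular_on_intros nz z)
  also have "ev z ((qpoch q (q ^ 2) k ^ 2 * qpoch (q ^ 2) (q ^ 4) k ^ 2)
      / (qpoch (q ^ 2) (q ^ 2) k ^ 2 * qpoch (q ^ 4) (q ^ 4) k ^ 2))
    = ev z (qpoch q (q ^ 2) k ^ 2 * qpoch (q ^ 2) (q ^ 4) k ^ 2)
      / ev z (qpoch (q ^ 2) (q ^ 2) k ^ 2 * qpoch (q ^ 4) (q ^ 4) k ^ 2)"
    by (intro ev_divide[of Z] regular_on_intros nz z)
  finally show ?thesis
    using z by (simp add: vwp_term_def ev_simps regular_on_intros)
qed

lemma root_power_neq_minus_1:
  assumes "z \<in> Z" shows "z ^ i \<noteq> - 1"
proof
  assume *: "z ^ i = - 1"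
  have "(z\<^sup>2) ^ i = (z ^ i)\<^sup>2"
    by (simp add: mult.commute flip: power_mult)
  hence "(z\<^sup>2) ^ i = 1" by (simp add: *)
  hence "z ^ i = 1"
    using odd_root_of_unity.power_eq_1_iff[OF root[OF assms]]
      odd_root_of_unity.power_eq_1_iff[OF odd_root_of_unity.square_root_of_unity[OF root[OF assms]]] by simp
  with * show False by simp
qed

lemma ev_qpoch_minus_nonzero:
  assumes "z \<in> Z" "0 < j" shows "ev z (qpoch (- (q ^ j)) (q ^ j) k) \<noteq> 0"
proof -
  have "1 - - (z ^ j) * (z ^ j) ^ i \<noteq> 0" for i
  proof -
    have "1 - - (z ^ j) * (z ^ j) ^ i = 1 + z ^ (j + j * i)"
      by (simp add: power_add power_mult)
    thus ?thesis
      using root_power_neq_minus_1[OF assms(1), of "j + j * i"] by (simp only: add_eq_0_iff not_False_eq_True)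
  qed
  hence "qpoch (- (z ^ j)) (z ^ j) k \<noteq> 0"
    by (simp add: qpoch_def)
  thus ?thesis
    using assms(1) by (simp add: ev_simps regular_on_intros)
qed

text \<open>The index k is unrestricted. For j = 1, 2 and k \<ge> n numerator and denominator both
  vanish at the roots, and the Gaussian binomial form shows the quotient to be finite.\<close>

lemma regular_qpoch_ratio:
  assumes "0 < j"
  shows "regular_on Z (qpoch (q ^ j) ((q ^ j)\<^sup>2) k / qpoch ((q ^ j)\<^sup>2) ((q ^ j)\<^sup>2) k)"
proof -
  have "q ^ j * (q ^ j) ^ i \<noteq> 1" for i
    using qvar_power_neq_1[of "j + j * i"] assms by (simp add: power_add power_mult)
  hence nz: "qpoch (q ^ j) (q ^ j) k \<noteq> 0"
    by (rule qpoch_nonzero)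
  have g: "regular_on Z (gauss_binomial (q ^ j) a b)" for a b
    by (induction "q ^ j" a b rule: gauss_binomial.induct) (auto intro!: regular_on_intros)
  have "ev z ((qpoch (- (q ^ j)) (q ^ j) k)\<^sup>2) \<noteq> 0" if "z \<in> Z" for z
    using ev_qpoch_minus_nonzero[OF that assms] ev_power[OF _ that, of "qpoch (- (q ^ j)) (q ^ j) k" 2]
    by (simp add: regular_on_intros)
  thus ?thesis
    unfolding qpoch_ratio_gauss_binomial[OF nz] by (intro regular_on_intros g)
qed

lemma regular_vwp_term: "regular_on Z (vwp_term q k)"
proof -
  have "vwp_term q k = (qpoch (q ^ 1) ((q ^ 1)\<^sup>2) k / qpoch ((q ^ 1)\<^sup>2) ((q ^ 1)\<^sup>2) k)\<^sup>2
      * (qpoch (q ^ 2) ((q ^ 2)\<^sup>2) k / qpoch ((q ^ 2)\<^sup>2) ((q ^ 2)\<^sup>2) k)\<^sup>2 * q ^ k"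
  proof -
    have e: "(q ^ 2) ^ 2 = q ^ 4" by (simp flip: power_mult)
    show ?thesis
      unfolding vwp_term_def power_one_right e power_divide by (simp only: times_divide_times_eq)
  qed
  also have "regular_on Z \<dots>"
    by (intro regular_on_intros regular_qpoch_ratio) simp_all
  finally show ?thesis .
qed

lemma regular_deformed_4phi3_term: "regular_on Z (deformed_4phi3_term q 1 1 k)"
proof -
  have "qpoch (q ^ 4) (q ^ 4) k = qpoch (q\<^sup>2) (q\<^sup>2) k * qpoch (- (q\<^sup>2)) (q\<^sup>2) k"
    using qpoch_square[of "q\<^sup>2" "q\<^sup>2" k] by (simp flip: power_mult)
  moreover have "a ^ 4 / (b * c)\<^sup>2 * d = a\<^sup>2 * (a / b)\<^sup>2 * (1 / c\<^sup>2) * d" for a b c d :: "rat poly fract"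
  proof -
    have "a ^ 4 = a\<^sup>2 * a\<^sup>2" by (simp flip: power_add)
    thus ?thesis by (simp add: power_divide power_mult_distrib)
  qed
  ultimately have "deformed_4phi3_term q 1 1 k = qpoch q (q\<^sup>2) k ^ 2 *
      (qpoch (q ^ 1) ((q ^ 1)\<^sup>2) k / qpoch ((q ^ 1)\<^sup>2) ((q ^ 1)\<^sup>2) k)\<^sup>2
      * (1 / (qpoch (- (q\<^sup>2)) (q\<^sup>2) k)\<^sup>2) * q ^ (2 * k)"
    by (simp only: deformed_4phi3_term_1_1 power_one_right)
  moreover have "ev z ((qpoch (- (q\<^sup>2)) (q\<^sup>2) k)\<^sup>2) \<noteq> 0" if "z \<in> Z" for z
    using ev_qpoch_minus_nonzero[OF that, of 2 k] ev_power[OF _ that, of "qpoch (- (q\<^sup>2)) (q\<^sup>2) k" 2]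
    by (simp add: regular_on_intros)
  ultimately show ?thesis
    by (simp only:) (intro regular_on_intros regular_qpoch_ratio; simp)
qed

definition "summand k = (1 - q ^ (4 * k + 1)) / (1 - q) * vwp_term q k"

lemma ev_one_minus_q: "z \<in> Z \<Longrightarrow> ev z (1 - q) \<noteq> 0"
  using ev_one_minus_q_power[of z 1] root_power_neq_1[of z 1] n N by simp

lemma regular_summand: "regular_on Z (summand k)"
  unfolding summand_def by (intro regular_on_intros regular_vwp_term ev_one_minus_q)

lemma ev_summand:
  assumes k: "k \<le> 2 * N" and z: "z \<in> Z"
  shows "ev z (summand k) = (1 - z ^ (4 * k + 1)) * vwp_term z k / (1 - z)"
proof -
  have "ev z (summand k) = ev z ((1 - q ^ (4 * k + 1)) / (1 - q)) * ev z (vwp_term q k)"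
    unfolding summand_def by (intro ev_mult[of Z] regular_on_intros ev_one_minus_q regular_vwp_term z)
  also have "ev z ((1 - q ^ (4 * k + 1)) / (1 - q)) = ev z (1 - q ^ (4 * k + 1)) / ev z (1 - q)"
    by (intro ev_divide[of Z] regular_on_intros ev_one_minus_q z)
  also have "ev z (1 - q) = 1 - z"
    using ev_one_minus_q_power[OF z, of 1] by simp
  finally show ?thesis
    by (simp only: ev_vwp_term[OF k z] ev_one_minus_q_power[OF z] times_divide_eq_left)
qed

section \<open>Four-term combinations and the congruence modulo the fourth power\<close>

lemma regular_ev_0_factor:
  assumes "regular_on Z Y" "\<And>z. z \<in> Z \<Longrightarrow> ev z Y = 0"
  obtains Y' where "regular_on Z Y'" "Y = (1 - x) * Y'"
  using regular_on_ev_eq_0[of n Y] assms n unfolding x_def by auto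

text \<open>With a summand T and its ratios A = 1 + (1 - x)^2 S and B = 1 + (1 - x) R, the
  combination is T (1 - A)(1 - B) = (1 - x)^3 T S R. The sum of the T S R vanishes at the roots by
  \<open>sum_vwp_summand_coeffs\<close>.\<close>

lemma deformed_summand_combination:
  obtains X where "regular_on Z X"
    "(\<Sum>k\<le>N. summand k) = (\<Sum>k\<le>N. deformed_summand q 1 (1 / x) k) + (\<Sum>k\<le>N. deformed_summand q x 1 k)
       - (\<Sum>k\<le>N. deformed_summand q x (1 / x) k) + (1 - x) ^ 4 * X"
proof -
  have "\<exists>S. \<forall>k\<le>N. regular_on Z (S k) \<and> summand_ratio_even k = 1 + (1 - x)\<^sup>2 * S k \<and> (\<forall>z\<in>Z. ev z (S k) = even_coeff z k)"
    using expands_factors(1) unfolding expands_def by metis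
  then obtain S where S: "\<And>k. k \<le> N \<Longrightarrow> regular_on Z (S k)" "\<And>k. k \<le> N \<Longrightarrow> summand_ratio_even k = 1 + (1 - x)\<^sup>2 * S k"
     "\<And>k z. k \<le> N \<Longrightarrow> z \<in> Z \<Longrightarrow> ev z (S k) = even_coeff z k" by metis
  have "\<exists>R. \<forall>k\<le>N. regular_on Z (R k) \<and> summand_ratio_odd k = 1 + (1 - x) * R k \<and> (\<forall>z\<in>Z. ev z (R k) = - odd_coeff z k)"
    using expands_factors(2) unfolding expands_def by metis
  then obtain R where R: "\<And>k. k \<le> N \<Longrightarrow> regular_on Z (R k)" "\<And>k. k \<le> N \<Longrightarrow> summand_ratio_odd k = 1 + (1 - x) * R k"
     "\<And>k z. k \<le> N \<Longrightarrow> z \<in> Z \<Longrightarrow> ev z (R k) = - odd_coeff z k" by metis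
  define Y where "Y = (\<Sum>k\<le>N. summand k * S k * R k)"
  have regY: "regular_on Z (summand k * S k * R k)" if "k \<le> N" for k
    using that by (intro regular_on_mult regular_summand S(1) R(1))
  hence "regular_on Z Y"
    unfolding Y_def by (intro regular_on_sum) auto
  moreover have "ev z Y = 0" if z: "z \<in> Z" for z
  proof -
    have "ev z Y = (\<Sum>k\<le>N. ev z (summand k * S k * R k))"
      unfolding Y_def using regY z by (intro ev_sum[of _ Z]) auto
    also have "\<dots> = (\<Sum>k\<le>N. - ((1 - z ^ (4 * k + 1)) * vwp_term z k * (even_coeff z k * odd_coeff z k)) / (1 - z))"
    proof (intro sum.cong refl)
      fix k assume "k \<in> {..N}"
      hence k: "k \<le> N" "k \<le> 2 * N" by auto
      show "ev z (summand k * S k * R k) = - ((1 - z ^ (4 * k + 1)) * vwp_term z k * (even_coeff z k * odd_coeff z k)) / (1 - z)"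
        using S(1)[OF k(1)] R(1)[OF k(1)] regular_summand[of k] z
        by (simp add: ev_mult[of Z] regular_on_mult ev_summand[OF k(2)] S(3)[OF k(1)] R(3)[OF k(1)])
    qed
    also have "\<dots> = 0"
      using odd_root_of_unity.sum_vwp_summand_coeffs[OF root[OF z]]
      by (simp only: sum_negf sum_divide_distrib[symmetric]) simp
    finally show ?thesis .
  qed
  ultimately obtain X where X: "regular_on Z X" "Y = (1 - x) * X"
    by (rule regular_ev_0_factor)
  have "(\<Sum>k\<le>N. summand k) - (\<Sum>k\<le>N. deformed_summand q 1 (1 / x) k) - (\<Sum>k\<le>N. deformed_summand q x 1 k)
       + (\<Sum>k\<le>N. deformed_summand q x (1 / x) k) = (\<Sum>k\<le>N. (1 - x) ^ 3 * (summand k * S k * R k))"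
    unfolding sum_subtractf[symmetric] sum.distrib[symmetric]
  proof (intro sum.cong refl)
    fix k assume "k \<in> {..N}"
    hence k: "k \<le> N" by simp
    show "summand k - deformed_summand q 1 (1 / x) k - deformed_summand q x 1 k + deformed_summand q x (1 / x) k
       = (1 - x) ^ 3 * (summand k * S k * R k)"
      unfolding deformed_summand_factor deformed_summand_1_1 summand_def[symmetric] S(2)[OF k] R(2)[OF k]
      by algebra
  qed
  also have "\<dots> = (1 - x) ^ 4 * X"
    unfolding sum_distrib_left[symmetric] Y_def[symmetric] X(2) by algebra
  finally have "(\<Sum>k\<le>N. summand k) = (\<Sum>k\<le>N. deformed_summand q 1 (1 / x) k) + (\<Sum>k\<le>N. deformed_summand q x 1 k)
       - (\<Sum>k\<le>N. deformed_summand q x (1 / x) k) + (1 - x) ^ 4 * X"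
    by (simp add: algebra_simps)
  with X(1) show ?thesis by (rule that)
qed

text \<open>The three relations are those needed to compare the Watson right-hand sides: moving
  \<alpha> costs (1 - x)^2, moving \<beta> costs 1 - x, and the mixed difference costs (1 -
  x)^3.\<close>

lemma deformed_4phi3_combination:
  defines "H \<equiv> \<lambda>\<alpha> \<beta>. \<Sum>j\<le>N. deformed_4phi3_term q \<alpha> \<beta> j"
  obtains Y1 Y2 Y3 where "regular_on Z Y1" "regular_on Z Y2" "regular_on Z Y3" "regular_on Z (H 1 1)"
    "H 1 (1 / x) = H x (1 / x) + (1 - x)\<^sup>2 * Y1"
    "H 1 (1 / x) = H 1 1 + (1 - x) * Y2"
    "H x 1 = H 1 1 + H x (1 / x) - H 1 (1 / x) + (1 - x) ^ 3 * Y3"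
proof -
  have "\<exists>S. \<forall>k\<le>N. regular_on Z (S k) \<and> phi_ratio_even k = 1 + (1 - x)\<^sup>2 * S k"
    using expands_factors(3) unfolding expands_def by metis
  then obtain S where S: "\<And>k. k \<le> N \<Longrightarrow> regular_on Z (S k)" "\<And>k. k \<le> N \<Longrightarrow> phi_ratio_even k = 1 + (1 - x)\<^sup>2 * S k"
    by metis
  have "\<exists>R. \<forall>k\<le>N. regular_on Z (R k) \<and> phi_ratio_odd k = 1 + (1 - x) * R k"
    using expands_factors(4) unfolding expands_def by metis
  then obtain R where R: "\<And>k. k \<le> N \<Longrightarrow> regular_on Z (R k)" "\<And>k. k \<le> N \<Longrightarrow> phi_ratio_odd k = 1 + (1 - x) * R k"
    by metis
  define V where "V = deformed_4phi3_term q 1 1"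
  have V: "regular_on Z (V k)" for k
    unfolding V_def by (rule regular_deformed_4phi3_term)
  note F = deformed_4phi3_term_factor[folded V_def]
  show ?thesis
  proof
    show "regular_on Z (\<Sum>k\<le>N. - (V k * S k * (1 + (1 - x) * R k)))"
      "regular_on Z (\<Sum>k\<le>N. V k * R k)" "regular_on Z (- (\<Sum>k\<le>N. V k * S k * R k))"
      using V S(1) R(1) by (auto intro!: regular_on_intros regular_eps)
    show "regular_on Z (H 1 1)"
      using V unfolding H_def V_def[symmetric] by (auto intro!: regular_on_intros)
    show "H 1 (1 / x) = H x (1 / x) + (1 - x)\<^sup>2 * (\<Sum>k\<le>N. - (V k * S k * (1 + (1 - x) * R k)))"
      unfolding H_def F sum_distrib_left sum.distrib[symmetric]
      by (intro sum.cong refl) (simp add: S(2) R(2) algebra_simps)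
    show "H 1 (1 / x) = H 1 1 + (1 - x) * (\<Sum>k\<le>N. V k * R k)"
      unfolding H_def F V_def[symmetric] sum_distrib_left sum.distrib[symmetric]
      by (intro sum.cong refl) (simp add: R(2) algebra_simps)
    have "H x 1 + H 1 (1 / x) = H 1 1 + H x (1 / x) + (1 - x) ^ 3 * (\<Sum>k\<le>N. - (V k * S k * R k))"
      unfolding H_def F V_def[symmetric] sum_distrib_left sum.distrib[symmetric]
    proof (intro sum.cong refl)
      fix k assume "k \<in> {..N}"
      hence k: "k \<le> N" by simp
      show "V k * phi_ratio_even k + V k * phi_ratio_odd k = V k + V k * phi_ratio_even k * phi_ratio_odd k + (1 - x) ^ 3 * - (V k * S k * R k)"
        unfolding S(2)[OF k] R(2)[OF k] by algebra
    qed
    thus "H x 1 = H 1 1 + H x (1 / x) - H 1 (1 / x) + (1 - x) ^ 3 * - (\<Sum>k\<le>N. V k * S k * R k)"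
      by (simp add: sum_negf algebra_simps)
  qed
qed


lemma x_eq_power: "x = q ^ (2 * N + 1)"
  unfolding x_def by (simp only: n)

lemmas generic = qvar_nonzero qvar_power_neq_1 x_eq_power

text \<open>\<open>c\<close> is the prefactor at \<alpha> = x. Dividing the one at \<alpha> = 1 by
  it leaves the product of the \<open>pair_ratio\<close> values at even exponents, whose coefficient
  at (1 - x)^2 is minus the sum in \<open>sum_koebe\<close>. At the roots \<open>c\<close> is
  evaluated by \<open>qpoch_half_square\<close>.\<close>

lemma prefactor_expansion:
  obtains g c where "regular_on Z g" "\<And>z. z \<in> Z \<Longrightarrow> ev z g = (of_nat n ^ 2 - 1) / 24"
    "regular_on Z c" "\<And>z. z \<in> Z \<Longrightarrow> ev z c = 1 / z ^ N"
    "qpoch q (q\<^sup>2) N ^ 2 / (qpoch (q\<^sup>2 / x) (q\<^sup>2) N * qpoch (x * q\<^sup>2) (q\<^sup>2) N) = c"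
    "qpoch q (q\<^sup>2) N ^ 2 / (qpoch (q\<^sup>2 / 1) (q\<^sup>2) N * qpoch (1 * q\<^sup>2) (q\<^sup>2) N) = c * (1 + (1 - x)\<^sup>2 * g)"
proof -
  define G where "G = (\<Prod>i<N. pair_ratio (2 * i + 2))"
  define b where "b = qpoch q (q\<^sup>2) N ^ 2 / (qpoch (q\<^sup>2) (q\<^sup>2) N)\<^sup>2"
  have G: "expands Z ((1 - x)\<^sup>2) G (\<lambda>z. \<Sum>i<N. - koebe (z ^ (2 * i + 2)))"
    unfolding G_def using n by (intro expands_prod[OF regular_eps2 ev_eps2] expands_pair_ratio) auto
  then obtain g where g: "regular_on Z g" "G = 1 + (1 - x)\<^sup>2 * g"
      "\<And>z. z \<in> Z \<Longrightarrow> ev z g = (\<Sum>i<N. - koebe (z ^ (2 * i + 2)))"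
    by (auto simp: expands_def)
  have nz: "ev z ((qpoch (q\<^sup>2) (q\<^sup>2) N)\<^sup>2) \<noteq> 0" if "z \<in> Z" for z
    using qpoch_even_nonzero(1)[OF that, of N] that by (simp add: ev_simps regular_on_intros)
  have b: "regular_on Z b"
    unfolding b_def by (intro regular_on_intros nz)
  have ev_b: "ev z b = 1 / z ^ N" if "z \<in> Z" for z
  proof -
    have "ev z b = ev z (qpoch q (q\<^sup>2) N ^ 2) / ev z ((qpoch (q\<^sup>2) (q\<^sup>2) N)\<^sup>2)"
      unfolding b_def by (intro ev_divide[of Z] regular_on_intros nz that)
    also have "\<dots> = qpoch z (z\<^sup>2) N ^ 2 / qpoch (z\<^sup>2) (z\<^sup>2) N ^ 2"
      using that by (simp add: ev_simps regular_on_intros)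
    also have "\<dots> = 1 / z ^ N"
      using odd_root_of_unity.qpoch_half_square[OF root[OF that]] qpoch_even_nonzero(1)[OF that, of N]
        root_nonzero[OF that] by (simp add: frac_eq_eq mult.commute)
    finally show ?thesis .
  qed
  have "G \<noteq> 0"
  proof
    assume "G = 0"
    hence "qpoch (q\<^sup>2 / x) (q\<^sup>2) N * qpoch (x * q\<^sup>2) (q\<^sup>2) N = 0"
      unfolding qpoch_ratio_prods(2) G_def by simp
    moreover have "qpoch (q\<^sup>2 / x) (q\<^sup>2) N \<noteq> 0"
      by (rule qpoch_nonzero) (rule generic_facts[OF generic])
    moreover have "qpoch (x * q\<^sup>2) (q\<^sup>2) N \<noteq> 0"
      by (rule qpoch_nonzero) (rule generic_facts[OF generic])
    ultimately show False by simp
  qed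
  have ev_G: "ev z G = 1" if "z \<in> Z" for z
    using ev_expands[OF regular_eps2 ev_eps2 G that] .
  have reg_G: "regular_on Z G"
    using expands_regular[OF regular_eps2 ev_eps2 G] .
  show ?thesis
  proof
    show "regular_on Z g" by (rule g)
    show "ev z g = (of_nat n ^ 2 - 1) / 24" if "z \<in> Z" for z
      unfolding g(3)[OF that] sum_negf odd_root_of_unity.sum_koebe[OF root[OF that]] n by simp
    show "regular_on Z (b / G)"
      by (intro regular_on_intros b reg_G) (simp add: ev_G)
    show "ev z (b / G) = 1 / z ^ N" if "z \<in> Z" for z
      using ev_divide[OF b reg_G] that by (simp add: ev_G ev_b)
    show "qpoch q (q\<^sup>2) N ^ 2 / (qpoch (q\<^sup>2 / x) (q\<^sup>2) N * qpoch (x * q\<^sup>2) (q\<^sup>2) N) = b / G"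
      unfolding qpoch_ratio_prods(2) G_def b_def by simp
    show "qpoch q (q\<^sup>2) N ^ 2 / (qpoch (q\<^sup>2 / 1) (q\<^sup>2) N * qpoch (1 * q\<^sup>2) (q\<^sup>2) N) = b / G * (1 + (1 - x)\<^sup>2 * g)"
      unfolding g(2)[symmetric] using \<open>G \<noteq> 0\<close> by (simp add: b_def power2_eq_square[of "qpoch (q\<^sup>2) (q\<^sup>2) N"])
  qed
qed

lemma congruence_half_sum:
  obtains X where "regular_on Z X"
    "(\<Sum>k\<le>N. summand k) = (1 - x) / (1 - q) * (1 / q ^ N)
       * (1 + (1 - x)\<^sup>2 * ((of_nat n ^ 2 - 1) / 24)) * (\<Sum>j\<le>N. deformed_4phi3_term q 1 1 j)
       + (1 - x) ^ 4 * X"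
proof -
  define H where "H \<alpha> \<beta> = (\<Sum>j\<le>N. deformed_4phi3_term q \<alpha> \<beta> j)" for \<alpha> \<beta>
  obtain X where X: "regular_on Z X"
    "(\<Sum>k\<le>N. summand k) = (\<Sum>k\<le>N. deformed_summand q 1 (1 / x) k) + (\<Sum>k\<le>N. deformed_summand q x 1 k)
       - (\<Sum>k\<le>N. deformed_summand q x (1 / x) k) + (1 - x) ^ 4 * X"
    by (rule deformed_summand_combination)
  obtain Y1 Y2 Y3 where Y: "regular_on Z Y1" "regular_on Z Y2" "regular_on Z Y3" "regular_on Z (H 1 1)"
    "H 1 (1 / x) = H x (1 / x) + (1 - x)\<^sup>2 * Y1"
    "H 1 (1 / x) = H 1 1 + (1 - x) * Y2"
    "H x 1 = H 1 1 + H x (1 / x) - H 1 (1 / x) + (1 - x) ^ 3 * Y3"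
    unfolding H_def by (rule deformed_4phi3_combination)
  obtain g c where g: "regular_on Z g" "\<And>z. z \<in> Z \<Longrightarrow> ev z g = (of_nat n ^ 2 - 1) / 24"
    and c: "regular_on Z c" "\<And>z. z \<in> Z \<Longrightarrow> ev z c = 1 / z ^ N"
    and pC: "qpoch q (q\<^sup>2) N ^ 2 / (qpoch (q\<^sup>2 / x) (q\<^sup>2) N * qpoch (x * q\<^sup>2) (q\<^sup>2) N) = c"
    and pA: "qpoch q (q\<^sup>2) N ^ 2 / (qpoch (q\<^sup>2 / 1) (q\<^sup>2) N * qpoch (1 * q\<^sup>2) (q\<^sup>2) N) = c * (1 + (1 - x)\<^sup>2 * g)"
    by (rule prefactor_expansion) blast
  define u v \<kappa> where "u = 1 / (1 - q)" and "v = 1 / q ^ N" and "\<kappa> = (of_nat n ^ 2 - 1 :: rat poly fract) / 24"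
  have u: "regular_on Z u"
    unfolding u_def by (intro regular_on_intros ev_one_minus_q)
  have q_nz: "ev z (q ^ N) \<noteq> 0" if "z \<in> Z" for z
    using root_nonzero[OF that] that by (simp add: ev_q_power)
  hence v: "regular_on Z v"
    unfolding v_def by (intro regular_on_intros)
  have ev_v: "ev z v = 1 / z ^ N" if "z \<in> Z" for z
  proof -
    have "ev z v = ev z 1 / ev z (q ^ N)"
      unfolding v_def by (intro ev_divide[of Z] regular_on_intros q_nz that)
    thus ?thesis using that by (simp add: ev_q_power)
  qed
  have \<kappa>_eq: "\<kappa> = (of_nat n ^ 2 - 1) / of_nat 24"
    by (simp add: \<kappa>_def)
  have ev_24: "ev z (of_nat 24) \<noteq> 0" if "z \<in> Z" for z
    using ev_of_nat[OF that, of 24] by simp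
  have \<kappa>: "regular_on Z \<kappa>"
    unfolding \<kappa>_eq by (intro regular_on_intros ev_24)
  have ev_\<kappa>: "ev z \<kappa> = (of_nat n ^ 2 - 1) / 24" if "z \<in> Z" for z
  proof -
    have "ev z \<kappa> = ev z (of_nat n ^ 2 - 1) / ev z (of_nat 24)"
      unfolding \<kappa>_eq by (intro ev_divide[of Z] regular_on_intros ev_24 that)
    also have "ev z (of_nat n ^ 2 - 1) = of_nat n ^ 2 - 1"
      using that by (simp only: ev_simps regular_on_intros ev_1)
    also have "ev z (of_nat 24) = 24"
      using ev_of_nat[OF that, of 24] by simp
    finally show ?thesis .
  qed
  have FA: "(\<Sum>k\<le>N. deformed_summand q 1 (1 / x) k) = (1 - x) * u * (c * (1 + (1 - x)\<^sup>2 * g)) * H 1 (1 / x)"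
    using deformed_sum_beta[OF generic, of 1] generic_facts[OF generic] 
    unfolding pA u_def H_def by simp
  have FC: "(\<Sum>k\<le>N. deformed_summand q x (1 / x) k) = (1 - x) * u * c * H x (1 / x)"
    using deformed_sum_beta[OF generic, of x] generic_facts[OF generic] x_nonzero
    unfolding pC u_def H_def by simp
  have FB: "(\<Sum>k\<le>N. deformed_summand q x 1 k) = (1 - x) * u * v * H x 1"
    using deformed_sum_alpha[OF generic] unfolding u_def v_def H_def by simp
  \<comment> \<open>Agreement of \<open>c\<close> and \<open>v\<close> at the roots suffices: their
    difference is multiplied by \<open>H 1 (1 / x) - H x (1 / x)\<close>, which has the factor (1 -
    x)^2, and by the 1 - x of the prefactor.\<close>
  obtain Y4 where Y4: "regular_on Z Y4" "c - v = (1 - x) * Y4"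
  proof (rule regular_ev_0_factor)
    show "regular_on Z (c - v)" by (intro regular_on_intros c v)
    show "ev z (c - v) = 0" if "z \<in> Z" for z
      using that by (simp add: ev_diff[of Z] c v ev_v)
  qed
  \<comment> \<open>The term with \<open>g\<close> already carries (1 - x)^3, so \<open>c\<close>,
    \<open>g\<close> and \<open>H 1 (1 / x)\<close> may be replaced by \<open>v\<close>,
    \<open>\<kappa>\<close> and \<open>H 1 1\<close>, which have the same values at the
    roots.\<close>
  obtain Y5 where Y5: "regular_on Z Y5" "c * g * (H 1 1 + (1 - x) * Y2) - v * \<kappa> * H 1 1 = (1 - x) * Y5"
  proof (rule regular_ev_0_factor)
    show "regular_on Z (c * g * (H 1 1 + (1 - x) * Y2) - v * \<kappa> * H 1 1)"
      by (intro regular_on_intros c v \<kappa> g Y regular_x)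
    show "ev z (c * g * (H 1 1 + (1 - x) * Y2) - v * \<kappa> * H 1 1) = 0" if "z \<in> Z" for z
    proof -
      have "ev z (c * g * (H 1 1 + (1 - x) * Y2) - v * \<kappa> * H 1 1)
          = ev z c * ev z g * (ev z (H 1 1) + ev z (1 - x) * ev z Y2) - ev z v * ev z \<kappa> * ev z (H 1 1)"
        using that by (simp only: ev_diff[of Z "c * g * (H 1 1 + (1 - x) * Y2)"] ev_add[of Z] ev_mult[of Z] c(1) v \<kappa> g(1) Y(1-4)
           regular_eps regular_on_add regular_on_mult)
      thus ?thesis
        using that by (simp add: c(2) g(2) ev_v ev_\<kappa> ev_eps)
    qed
  qed
  show ?thesis
  proof
    show "regular_on Z (u * (Y4 * Y1 + Y5 + v * Y3) + X)"
      by (intro regular_on_intros u v X Y Y4 Y5)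
    have alg: "e * u * (c * (1 + e\<^sup>2 * g)) * HA + e * u * v * HB - e * u * c * HC + e ^ 4 * X
       = e * u * v * (1 + e\<^sup>2 * k) * H0 + e ^ 4 * (u * (y4 * y1 + y5 + v * y3) + X)"
      if "HA = HC + e\<^sup>2 * y1" "HA = H0 + e * y2" "HB = H0 + HC - HA + e ^ 3 * y3"
        "c - v = e * y4" "c * g * (H0 + e * y2) - v * k * H0 = e * y5"
      for e u c g v k HA HB HC H0 X y1 y2 y3 y4 y5 :: "rat poly fract"
      using that by algebra
    show "(\<Sum>k\<le>N. summand k) = (1 - x) / (1 - q) * (1 / q ^ N)
       * (1 + (1 - x)\<^sup>2 * ((of_nat n ^ 2 - 1) / 24)) * (\<Sum>j\<le>N. deformed_4phi3_term q 1 1 j)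
       + (1 - x) ^ 4 * (u * (Y4 * Y1 + Y5 + v * Y3) + X)"
      using alg[OF Y(5,6,7) Y4(2) Y5(2), of u X]
      unfolding X(2) FA FB FC H_def[symmetric] \<kappa>_def[symmetric] v_def[symmetric]
      by (simp add: u_def)
  qed
qed

text \<open>Beyond N the factor with index N occurs: 1 - x in (q;q^2)_k and 1 - x^2 in (q^2;q^4)_k,
  both squared in the summand. The bound 2N keeps the denominator nonzero at the roots, so both
  choices of M are equivalent modulo (1 - x)^4.\<close>

lemma tail_summand:
  assumes "N < k" "k \<le> 2 * N"
  obtains X where "regular_on Z X" "summand k = (1 - x) ^ 4 * X"
proof -
  obtain m where k: "k = Suc N + m"
    using assms(1) less_imp_Suc_add by auto
  define a where "a = qpoch q (q ^ 2) N * qpoch (q * (q ^ 2) ^ Suc N) (q ^ 2) m"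
  define b where "b = qpoch (q ^ 2) (q ^ 4) N * qpoch (q ^ 2 * (q ^ 4) ^ Suc N) (q ^ 4) m"
  have 1: "q * (q ^ 2) ^ N = x" "q ^ 2 * (q ^ 4) ^ N = x\<^sup>2"
    unfolding x_eq_power by (simp_all add: power_mult_distrib flip: power_mult)
  have a: "qpoch q (q ^ 2) k = (1 - x) * a"
    unfolding k qpoch_add qpoch_Suc a_def 1 by (simp add: mult_ac)
  have b: "qpoch (q ^ 2) (q ^ 4) k = (1 - x) * ((1 + x) * b)"
    unfolding k qpoch_add qpoch_Suc b_def 1 by (simp add: mult_ac power2_eq_square algebra_simps)
  define X where "X = (1 - q ^ (4 * k + 1)) / (1 - q) * (a ^ 2 * ((1 + x) * b) ^ 2
       / (qpoch (q ^ 2) (q ^ 2) k ^ 2 * qpoch (q ^ 4) (q ^ 4) k ^ 2) * q ^ k)"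
  show ?thesis
  proof
    have nz: "ev w (qpoch (q ^ 2) (q ^ 2) k ^ 2 * qpoch (q ^ 4) (q ^ 4) k ^ 2) \<noteq> 0" if "w \<in> Z" for w
      using qpoch_even_nonzero[OF that assms(2)] that by (simp add: ev_simps regular_on_intros)
    show "regular_on Z X"
      unfolding X_def a_def b_def by (intro regular_on_intros nz ev_one_minus_q regular_x)
    have "(1 - x) ^ 4 = (1 - x)\<^sup>2 * (1 - x)\<^sup>2" by (simp flip: power_add)
    thus "summand k = (1 - x) ^ 4 * X"
      unfolding summand_def vwp_term_def a b X_def by (simp add: power_mult_distrib mult_ac)
  qed
qed

lemma congruence_sum:
  assumes "M = N \<or> M = 2 * N"
  obtains X where "regular_on Z X"
    "(\<Sum>k\<le>M. summand k) = (1 - x) / (1 - q) * (1 / q ^ N)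
       * (1 + (1 - x)\<^sup>2 * ((of_nat n ^ 2 - 1) / 24)) * (\<Sum>j\<le>N. deformed_4phi3_term q 1 1 j)
       + (1 - x) ^ 4 * X"
proof -
  obtain X where X: "regular_on Z X"
    "(\<Sum>k\<le>N. summand k) = (1 - x) / (1 - q) * (1 / q ^ N)
       * (1 + (1 - x)\<^sup>2 * ((of_nat n ^ 2 - 1) / 24)) * (\<Sum>j\<le>N. deformed_4phi3_term q 1 1 j)
       + (1 - x) ^ 4 * X"
    by (rule congruence_half_sum)
  have "\<forall>k\<in>{N<..2 * N}. \<exists>Y. regular_on Z Y \<and> summand k = (1 - x) ^ 4 * Y"
    using tail_summand by (metis greaterThanAtMost_iff)
  then obtain Y where Y: "\<And>k. k \<in> {N<..2 * N} \<Longrightarrow> regular_on Z (Y k) \<and> summand k = (1 - x) ^ 4 * Y k"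
    by metis
  from assms show ?thesis
  proof
    assume "M = N"
    with X that show ?thesis by simp
  next
    assume M: "M = 2 * N"
    have "{..M} = {..N} \<union> {N<..2 * N}" "{..N} \<inter> {N<..2 * N} = {}" using M by auto
    hence "(\<Sum>k\<le>M. summand k) = (\<Sum>k\<le>N. summand k) + (\<Sum>k\<in>{N<..2 * N}. summand k)"
      by (simp add: sum.union_disjoint)
    also have "(\<Sum>k\<in>{N<..2 * N}. summand k) = (1 - x) ^ 4 * (\<Sum>k\<in>{N<..2 * N}. Y k)"
      unfolding sum_distrib_left using Y by (intro sum.cong) auto
    finally have "(\<Sum>k\<le>M. summand k) = (1 - x) / (1 - q) * (1 / q ^ N)
       * (1 + (1 - x)\<^sup>2 * ((of_nat n ^ 2 - 1) / 24)) * (\<Sum>j\<le>N. deformed_4phi3_term q 1 1 j)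
       + (1 - x) ^ 4 * (X + (\<Sum>k\<in>{N<..2 * N}. Y k))"
      unfolding X(2) by (simp only: distrib_left add.assoc)
    moreover have "regular_on Z (X + (\<Sum>k\<in>{N<..2 * N}. Y k))"
      using X(1) Y by (intro regular_on_add regular_on_sum) auto
    ultimately show ?thesis using that by blast
  qed
qed

section \<open>Vanishing over blocks of length equal to the order\<close>

text \<open>At z the power q^(ln) becomes 1, so the shifted summand is a constant depending only on
  l times the unshifted one. Regularity of \<open>vwp_term q (l * n)\<close> is all that is required
  of this constant.\<close>

lemma ev_summand_shift:
  assumes z: "z \<in> Z" and r: "r < n"
  shows "ev z (summand (l * n + r)) = ev z (vwp_term q (l * n)) * ((1 - z ^ (4 * r + 1)) * vwp_term z r / (1 - z))"
proof -
  have r': "r \<le> 2 * N" using r n by simp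
  define y where "y = q ^ (l * n)"
  have zl: "w ^ (l * n) = 1" if "w \<in> Z" for w
  proof -
    have "n > 0" using n by simp
    thus ?thesis using primitive_root_power_eq_1[OF that, of "l * n"] by simp
  qed
  have y: "regular_on Z y" "ev w y = 1" if "w \<in> Z" for w
    using zl[OF that] that unfolding y_def
    by (auto intro!: regular_on_intros simp: ev_q_power)
  have yr: "regular_on Z y" unfolding y_def by (intro regular_on_intros)
  have yy: "(q ^ 2) ^ (l * n) = y\<^sup>2" "(q ^ 4) ^ (l * n) = y ^ 4"
    unfolding y_def by (simp_all flip: power_mult add: mult.commute)
  define a where "a = qpoch (q * y\<^sup>2) (q ^ 2) r ^ 2 * qpoch (q ^ 2 * y ^ 4) (q ^ 4) r ^ 2"
  define b where "b = qpoch (q ^ 2 * y\<^sup>2) (q ^ 2) r ^ 2 * qpoch (q ^ 4 * y ^ 4) (q ^ 4) r ^ 2"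
  define e where "e = (1 - q ^ (4 * (l * n + r) + 1)) / (1 - q)"
  have reg: "regular_on Z a" "regular_on Z b"
    unfolding a_def b_def by (intro regular_on_intros yr)+
  have ev_a: "ev z a = qpoch z (z\<^sup>2) r ^ 2 * qpoch (z\<^sup>2) (z ^ 4) r ^ 2"
    unfolding a_def using z by (simp add: ev_simps regular_on_intros yr y(2))
  have ev_b: "ev w b = qpoch (w\<^sup>2) (w\<^sup>2) r ^ 2 * qpoch (w ^ 4) (w ^ 4) r ^ 2" if "w \<in> Z" for w
    unfolding b_def using that by (simp add: ev_simps regular_on_intros yr y(2))
  have b_nz: "ev w b \<noteq> 0" if "w \<in> Z" for w
    using qpoch_even_nonzero[OF that r'] by (simp add: ev_b[OF that])
  have summand: "summand (l * n + r) = e * (vwp_term q (l * n) * (a / b * q ^ r))"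
    unfolding summand_def vwp_term_add yy a_def b_def e_def ..
  have e: "regular_on Z e"
    unfolding e_def by (intro regular_on_intros ev_one_minus_q)
  have "4 * (l * n + r) + 1 = l * n * 4 + (4 * r + 1)" by simp
  hence pw: "z ^ (4 * (l * n + r) + 1) = (z ^ (l * n)) ^ 4 * z ^ (4 * r + 1)"
    by (simp only: power_add power_mult)
  have "ev z e = ev z (1 - q ^ (4 * (l * n + r) + 1)) / ev z (1 - q)"
    unfolding e_def by (intro ev_divide[of Z] regular_on_intros ev_one_minus_q z)
  also have "ev z (1 - q) = 1 - z"
    using ev_one_minus_q_power[OF z, of 1] by simp
  finally have ev_e: "ev z e = (1 - z ^ (4 * r + 1)) / (1 - z)"
    unfolding ev_one_minus_q_power[OF z] pw zl[OF z] by simp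
  have "ev z (summand (l * n + r)) = ev z e * (ev z (vwp_term q (l * n)) * (ev z a / ev z b * ev z (q ^ r)))"
    unfolding summand using z e reg b_nz regular_vwp_term[of "l * n"]
    by (simp add: ev_mult[of Z] ev_divide[of Z] regular_on_intros del: times_divide_eq_left times_divide_eq_right)
  thus ?thesis
    unfolding ev_e ev_a ev_b[OF z] ev_q_power[OF z] vwp_term_def[of z r] by (simp add: mult_ac)
qed

lemma sum_ev_summand_block:
  assumes z: "z \<in> Z" and M: "M = N \<or> M = 2 * N"
  shows "(\<Sum>r\<le>M. ev z (summand (l * n + r))) = 0"
proof -
  have half: "(\<Sum>r\<le>N. (1 - z ^ (4 * r + 1)) * vwp_term z r) = 0"
    by (rule odd_root_of_unity.sum_vwp_summand[OF root[OF z]])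
  have "(\<Sum>r\<le>M. (1 - z ^ (4 * r + 1)) * vwp_term z r) = (\<Sum>r\<le>N. (1 - z ^ (4 * r + 1)) * vwp_term z r)"
    using M by (intro sum.mono_neutral_right)
       (auto simp: odd_root_of_unity.vwp_term_eq_0[OF root[OF z]])
  hence "(\<Sum>r\<le>M. ev z (vwp_term q (l * n)) * ((1 - z ^ (4 * r + 1)) * vwp_term z r / (1 - z))) = 0"
    unfolding half by (simp only: sum_distrib_left[symmetric] sum_divide_distrib[symmetric]) simp
  moreover have "(\<Sum>r\<le>M. ev z (summand (l * n + r))) = (\<Sum>r\<le>M. ev z (vwp_term q (l * n)) * ((1 - z ^ (4 * r + 1)) * vwp_term z r / (1 - z)))"
    using M n by (intro sum.cong refl ev_summand_shift z) auto
  ultimately show ?thesis by simp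
qed

text \<open>To be applied with a proper divisor of the theorem's n in place of \<open>n\<close>.
  Full blocks are the case M = 2N of \<open>sum_ev_summand_block\<close>; the last block may stop at
  N.\<close>

lemma ev_sum_summand_blocks:
  assumes z: "z \<in> Z" and M: "M = N \<or> M = 2 * N"
  shows "ev z (\<Sum>k\<le>m * n + M. summand k) = 0"
proof -
  have ev_sum': "ev z (\<Sum>k\<in>S. summand k) = (\<Sum>k\<in>S. ev z (summand k))" for S
    by (rule ev_sum[of S Z, OF regular_summand z])
  have "(\<Sum>k<m * n. ev z (summand k)) = (\<Sum>l<m. \<Sum>k\<in>{l * n..<l * n + n}. ev z (summand k))"
    by (rule sum.nat_group[symmetric])
  also have "\<dots> = 0"
  proof (rule sum.neutral, rule ballI)
    fix l
    have "(\<Sum>k\<in>{l * n..<l * n + n}. ev z (summand k)) = (\<Sum>r\<le>2 * N. ev z (summand (l * n + r)))"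
      using sum.shift_bounds_nat_ivl[of "\<lambda>k. ev z (summand k)" 0 "l * n" n] n
      by (simp add: add.commute atLeast0LessThan lessThan_Suc_atMost del: sum.lessThan_Suc)
    thus "(\<Sum>k\<in>{l * n..<l * n + n}. ev z (summand k)) = 0"
      using sum_ev_summand_block[OF z] by simp
  qed
  finally have 1: "(\<Sum>k<m * n. ev z (summand k)) = 0" .
  have "{..m * n + M} = {..<m * n} \<union> {m * n..m * n + M}" by auto
  hence "(\<Sum>k\<le>m * n + M. ev z (summand k)) = (\<Sum>k<m * n. ev z (summand k)) + (\<Sum>k\<in>{m * n..m * n + M}. ev z (summand k))"
    by (simp only:) (rule sum.union_disjoint; auto)
  also have "(\<Sum>k\<in>{m * n..m * n + M}. ev z (summand k)) = (\<Sum>r\<le>M. ev z (summand (m * n + r)))"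
    using sum.shift_bounds_cl_nat_ivl[of "\<lambda>k. ev z (summand k)" 0 "m * n" M]
    by (simp add: add.commute atMost_atLeast0)
  finally show ?thesis
    unfolding ev_sum' using 1 sum_ev_summand_block[OF z M] by simp
qed

end

subsection \<open>Combining the cyclotomic factors\<close>

lemma coprime_cyclotomics:
  assumes "d \<noteq> e" "d > 0" "e > 0"
  shows "coprime (cyclotomic d) (cyclotomic e)"
proof (rule coprime_cyclotomic[OF _ assms(2)])
  fix z assume z: "z \<in> primitive_roots d"
  show "rpoly z (cyclotomic e) \<noteq> 0"
  proof
    assume "rpoly z (cyclotomic e) = 0"
    hence "z \<in> primitive_roots e" by (simp add: primitive_roots_def)
    hence "d dvd i \<longleftrightarrow> e dvd i" for i
      using z assms primitive_root_power_eq_1[of z d i] primitive_root_power_eq_1[of z e i] by simp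
    from this[of d] this[of e] have "d = e" by (simp add: dvd_antisym)
    with assms(1) show False by contradiction
  qed
qed

lemma qint_eq_prod_cyclotomic:
  assumes "n > 0"
  shows "qint [:0, 1:] n = (\<Prod>d\<in>{d. d dvd n} - {1}. cyclotomic d)"
proof -
  have "{d. d dvd 1} = {1 :: nat}" by auto
  hence c1: "cyclotomic 1 = [:0, 1:] - 1"
    using prod_cyclotomic[of 1] by (simp only: prod.insert finite.emptyI empty_iff prod.empty power_one_right mult_1_right zero_less_one simp_thms)
  have "cyclotomic 1 * (\<Prod>d\<in>{d. d dvd n} - {1}. cyclotomic d) = [:0, 1:] ^ n - 1"
    using prod_cyclotomic[OF assms] assms prod.remove[of "{d. d dvd n}" 1 cyclotomic] by simp
  hence "1 - [:0, 1:] ^ n = (1 - [:0, 1:]) * (\<Prod>d\<in>{d. d dvd n} - {1}. cyclotomic d)"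
    unfolding c1 by (simp add: algebra_simps)
  moreover have "1 - [:0, 1:] \<noteq> (0 :: rat poly)"
    by (simp add: one_pCons)
  ultimately show ?thesis
    unfolding qint_def by (metis nonzero_mult_div_cancel_left)
qed

text \<open>[n] is the product of \<Phi>_d over the divisors d > 1, so the modulus is \<Phi>_n^4
  times the \<Phi>_d with 1 < d < n, and these factors are pairwise coprime.\<close>

lemma modulus_dvd:
  assumes n: "n > 1" and 4: "cyclotomic n ^ 4 dvd f"
    and 1: "\<And>d. d dvd n \<Longrightarrow> 1 < d \<Longrightarrow> d < n \<Longrightarrow> cyclotomic d dvd f"
  shows "qint [:0, 1:] n * cyclotomic n ^ 3 dvd f"
proof -
  define S where "S = {d. d dvd n} - {1} - {n}"
  have S: "finite S" "\<And>d. d \<in> S \<Longrightarrow> d dvd n \<and> 1 < d \<and> d < n"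
    using n by (auto simp: S_def dest: dvd_imp_le intro!: Nat.gr0I)
  have "(\<Prod>d\<in>T. cyclotomic d) dvd f" if "T \<subseteq> S" for T
    using finite_subset[OF that S(1)] that
  proof (induction T rule: finite_induct)
    case (insert d T)
    have "coprime (cyclotomic d) (\<Prod>e\<in>T. cyclotomic e)"
      using insert S(2) by (intro prod_coprime_right coprime_cyclotomics) force+
    thus ?case
      using insert 1 S(2) by (simp add: divides_mult)
  qed simp
  hence "(\<Prod>d\<in>S. cyclotomic d) dvd f" by blast
  moreover have "coprime (\<Prod>d\<in>S. cyclotomic d) (cyclotomic n ^ 4)"
    using S(2) n by (intro prod_coprime_left coprime_power_right_iff[THEN iffD2] disjI1 coprime_cyclotomics) force+
  ultimately have "(\<Prod>d\<in>S. cyclotomic d) * cyclotomic n ^ 4 dvd f"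
    using 4 by (intro divides_mult)
  also have "(\<Prod>d\<in>S. cyclotomic d) * cyclotomic n ^ 4 = qint [:0, 1:] n * cyclotomic n ^ 3"
  proof -
    have "qint [:0, 1:] n = cyclotomic n * (\<Prod>d\<in>S. cyclotomic d)"
      using n qint_eq_prod_cyclotomic[of n] prod.remove[of "{d. d dvd n} - {1}" n cyclotomic]
      by (simp add: S_def)
    thus ?thesis by (simp add: eval_nat_numeral mult_ac)
  qed
  finally show ?thesis .
qed

lemma qint_qvar_congruence:
  fixes n M :: nat
  assumes "n > 0" and "odd n"
    and "M = (n - 1) div 2 \<or> M = n - 1"
  shows "qint [:0, 1:] n * cyclotomic n ^ 3 dvd fst (quot_of_fract
     ((\<Sum>k\<le>M. (1 - qvar ^ (4 * k + 1)) / (1 - qvar) * vwp_term qvar k)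
      - (1 - qvar ^ n) / (1 - qvar) * (1 / qvar ^ ((n - 1) div 2))
       * (1 + (1 - qvar ^ n)\<^sup>2 * ((of_nat n ^ 2 - 1) / 24))
       * (\<Sum>j\<le>(n - 1) div 2. deformed_4phi3_term qvar 1 1 j)))" (is "_ dvd fst (quot_of_fract (?L - ?R))")
proof (cases "n = 1")
  case True
  \<comment> \<open>For n = 1 both sides equal 1: the sums have one term and n^2 - 1 is 0.\<close>
  thus ?thesis
    using assms by (simp add: vwp_term_def deformed_4phi3_term_1_1 divide_self_if qvar_neq_1[symmetric])
next
  case False
  obtain N where N: "n = 2 * N + 1" using \<open>odd n\<close> by (elim oddE)
  hence N0: "N > 0" and N': "(n - 1) div 2 = N" and n1: "n > 1" using False by auto
  have MN: "M = N \<or> M = 2 * N" using assms(3) unfolding N by auto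
  show ?thesis
  proof (rule modulus_dvd[OF n1])
    interpret cyclotomic_localization n N
      by unfold_locales (fact N, fact N0)
    from MN obtain X where X: "regular_on Z X"
      "(\<Sum>k\<le>M. summand k) = (1 - x) / (1 - q) * (1 / q ^ N)
       * (1 + (1 - x)\<^sup>2 * ((of_nat n ^ 2 - 1) / 24)) * (\<Sum>j\<le>N. deformed_4phi3_term q 1 1 j)
       + (1 - x) ^ 4 * X"
      by (rule congruence_sum)
    have "?L - ?R = (1 - qvar ^ n) ^ 4 * X"
      using X(2) unfolding summand_def x_def N' by simp
    thus "cyclotomic n ^ 4 dvd fst (quot_of_fract (?L - ?R))"
      using assms(1) X(1) by (intro cyclotomic_power_dvd_numerator)
  next
    fix d assume d: "d dvd n" "1 < d" "d < n"
    then obtain m where m: "n = d * m" by auto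
    have odd: "odd d" "odd m" using \<open>odd n\<close> m by auto
    obtain D where D: "d = 2 * D + 1" using odd(1) by (elim oddE)
    obtain m' where m': "m = 2 * m' + 1" using odd(2) by (elim oddE)
    have "2 * N + 1 = (2 * D + 1) * (2 * m' + 1)"
      using m unfolding N D m' .
    also have "\<dots> = 2 * (m' * d + D) + 1"
      unfolding D by (simp add: algebra_simps)
    finally have NN: "N = m' * d + D" by simp
    \<comment> \<open>The index range splits into full blocks of length d and a last piece ending at
      D or 2D, the two cases of the block lemma.\<close>
    have MN': "M = m' * d + D \<or> M = 2 * m' * d + 2 * D"
      using MN unfolding NN by (simp only: distrib_left mult.assoc)
    interpret cyclotomic_localization d D
      by unfold_locales (use D d in auto)
    have reg_x: "regular_on Z (1 - q ^ n)" "ev z (1 - q ^ n) = 0" if "z \<in> Z" for z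
      using that primitive_root_power_eq_1[OF that, of n] d by (auto simp: ev_one_minus_q_power intro: regular_one_minus_q_power)
    have L: "ev z ?L = 0" if "z \<in> Z" for z
      using MN' ev_sum_summand_blocks[OF that, of D m'] ev_sum_summand_blocks[OF that, of "2 * D" "2 * m'"]
      unfolding summand_def by auto
    have regL: "regular_on Z ?L"
      using regular_summand unfolding summand_def by (intro regular_on_sum)
    define r where "r = 1 / (1 - q) * (1 / q ^ N) * (1 + (1 - q ^ n)\<^sup>2 * ((of_nat n ^ 2 - 1) / of_nat 24))
       * (\<Sum>j\<le>N. deformed_4phi3_term q 1 1 j)"
    \<comment> \<open>On the right-hand side the vanishing at primitive d-th roots is visible: 1 -
      q^n is a factor, and the rest is regular because 1 - q and q are nonzero there.\<close>
    have R: "?R = (1 - q ^ n) * r"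
      unfolding r_def N' by simp
    have ev24: "ev z (of_nat 24) \<noteq> 0" if "z \<in> Z" for z
      using ev_of_nat[OF that, of 24] by simp
    have "ev z (q ^ N) \<noteq> 0" if "z \<in> Z" for z
      using root_nonzero[OF that] that by (simp add: ev_q_power)
    hence r: "regular_on Z r"
      unfolding r_def
      by (intro regular_on_intros regular_deformed_4phi3_term ev_one_minus_q ev24)
    have evR: "ev z ?R = 0" if "z \<in> Z" for z
      unfolding R ev_mult[OF regular_one_minus_q_power r that] reg_x(2)[OF that] by (rule mult_zero_left)
    have regR: "regular_on Z ?R"
      unfolding R by (intro regular_on_mult regular_one_minus_q_power r)
    have "regular_on Z (?L - ?R)"
      by (intro regular_on_diff regL regR)
    moreover have "ev z (?L - ?R) = 0" if "z \<in> Z" for z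
      unfolding ev_diff[OF regL regR that] L[OF that] evR[OF that] by (rule diff_self)
    moreover have "d > 0" using d by simp
    ultimately obtain B where B: "regular_on Z B" "?L - ?R = (1 - q ^ d) * B"
      using regular_on_ev_eq_0[of d "?L - ?R"] by blast
    have "cyclotomic d ^ 1 dvd fst (quot_of_fract (?L - ?R))"
      using \<open>d > 0\<close> B(1) by (rule cyclotomic_power_dvd_numerator) (simp only: B(2) power_one_right)
    thus "cyclotomic d dvd fst (quot_of_fract (?L - ?R))"
      by (simp only: power_one_right)
  qed
qed

theorem corollary2p3:
  fixes n M :: nat
  assumes "n > 0" and "odd n"
    and "M = (n - 1) div 2 \<or> M = n - 1"
  shows "[(\<Sum>k=0..M. qint qvar (4 * k + 1)
             * (qpoch qvar (qvar ^ 2) k ^ 2 * qpoch (qvar ^ 2) (qvar ^ 4) k ^ 2)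
             / (qpoch (qvar ^ 2) (qvar ^ 2) k ^ 2 * qpoch (qvar ^ 4) (qvar ^ 4) k ^ 2)
             * qvar ^ k)
          \<equiv> qint qvar n * qvar powi ((1 - int n) div 2)
             * (1 + qint qvar n ^ 2 * ((of_nat n ^ 2 - 1) * (1 - qvar) ^ 2 / 24))
             * (\<Sum>k=0..(n - 1) div 2. qpoch qvar (qvar ^ 2) k ^ 4
                  / qpoch (qvar ^ 4) (qvar ^ 4) k ^ 2 * qvar ^ (2 * k))]
         (ratmod (qint [:0, 1:] n * cyclotomic n ^ 3))"
proof -
  have L: "qint qvar (4 * k + 1)
             * (qpoch qvar (qvar ^ 2) k ^ 2 * qpoch (qvar ^ 2) (qvar ^ 4) k ^ 2)
             / (qpoch (qvar ^ 2) (qvar ^ 2) k ^ 2 * qpoch (qvar ^ 4) (qvar ^ 4) k ^ 2)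
             * qvar ^ k = (1 - qvar ^ (4 * k + 1)) / (1 - qvar) * vwp_term qvar k" for k
    by (simp only: qint_field vwp_term_def mult.assoc times_divide_eq_right times_divide_eq_left)
  obtain N where N: "n = 2 * N + 1" using \<open>odd n\<close> by (elim oddE)
  have "(1 - int n) div 2 = - int N" using N by simp
  hence powi: "qvar powi ((1 - int n) div 2) = 1 / qvar ^ ((n - 1) div 2)"
    using N by (simp add: power_int_minus divide_inverse)
  \<comment> \<open>The factor (1 - q)^2 of the statement turns [n]^2 into (1 - q^n)^2, whose
    coefficient is then a constant.\<close>
  have sq: "qint qvar n ^ 2 * ((of_nat n ^ 2 - 1) * (1 - qvar) ^ 2 / 24) = (1 - qvar ^ n)\<^sup>2 * ((of_nat n ^ 2 - 1) / 24)"
    using qvar_neq_1 by (simp add: qint_field power_divide)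
  show ?thesis
    using qint_qvar_congruence[OF assms]
    unfolding ratfun_cong_def L powi sq unfolding atLeast0AtMost qint_field[of qvar] deformed_4phi3_term_1_1
    by this
qed

end
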